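(* If $f \in \mathsf{RO}$, then there exist inner functions $\phi_n^+$ and $\phi_n^-$ ($n\ge1$) so that $$f = |f(0)| \prod_{n \geq 1} \left(\frac{1 -i \phi_n^+}{1 + i \phi_n^+} \right) \left(\frac{1 + i \phi_n^-}{1 - i \phi_n^-} \right),$$ where the product converges locally uniformly on $\mathbb{D}$.
   Context: $\mathbb{D}$ is the open unit disk, $\mathbb{T}$ the unit circle. The Smirnov class is $N^+ = \{f/g : f,g \in H^\infty,\ g \text{ outer}\}$, and $\mathsf{RO}$ is the set of outer functions in $N^+$ whose radial boundary values are real a.e.~on $\mathbb{T}$. *)

theory Defs
  imports "HOL-Analysis.Analysis"
begin

text \<open>The unit disk is \<open>ball 0 1\<close>; the unit circle is parametrised by
  \<open>cis \<theta>\<close>, \<open>\<theta> \<in> {0..2*pi}\<close>, with Lebesgue measure (so "a.e. on the circle"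
  means a.e. in \<open>\<theta>\<close>).\<close>

definition radial_limit :: "(complex \<Rightarrow> complex) \<Rightarrow> real \<Rightarrow> complex \<Rightarrow> bool" where
  "radial_limit f \<theta> L \<longleftrightarrow> ((\<lambda>r::real. f (complex_of_real r * cis \<theta>)) \<longlongrightarrow> L) (at_left 1)"

definition Hinf :: "(complex \<Rightarrow> complex) set" where
  "Hinf = {f. f holomorphic_on ball 0 1 \<and> bounded (f ` ball 0 1)}"

definition inner_fun :: "(complex \<Rightarrow> complex) \<Rightarrow> bool" where
  "inner_fun \<phi> \<longleftrightarrow> \<phi> \<in> Hinf \<and>
     (AE \<theta> in lborel. \<theta> \<in> {0..2*pi} \<longrightarrow> (\<exists>L. radial_limit \<phi> \<theta> L \<and> norm L = 1))"

definition outer_fun :: "(complex \<Rightarrow> complex) \<Rightarrow> bool" where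
  "outer_fun F \<longleftrightarrow> (\<exists>c w. norm c = 1 \<and> (\<forall>\<theta>. w \<theta> > (0::real)) \<and>
     set_integrable lborel {0..2*pi} (\<lambda>\<theta>. ln (w \<theta>)) \<and>
     (\<forall>z\<in>ball 0 1. F z = c * exp (complex_of_real (1 / (2*pi)) *
        (LINT \<theta>:{0..2*pi}|lborel. ((cis \<theta> + z) / (cis \<theta> - z)) * complex_of_real (ln (w \<theta>))))))"

definition smirnov :: "(complex \<Rightarrow> complex) set" where
  "smirnov = {f. \<exists>g h. g \<in> Hinf \<and> h \<in> Hinf \<and> outer_fun h \<and> (\<forall>z\<in>ball 0 1. f z = g z / h z)}"

definition RO :: "(complex \<Rightarrow> complex) set" where
  "RO = {f. f \<in> smirnov \<and> outer_fun f \<and>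
     (AE \<theta> in lborel. \<theta> \<in> {0..2*pi} \<longrightarrow> (\<exists>L. radial_limit f \<theta> L \<and> Im L = 0))}"

end

theory Submission
  imports Defs "HOL-Probability.Probability" "HOL-Complex_Analysis.Complex_Analysis"
begin

text \<open>
  Write \<open>f = exp (i \<alpha> + p\<^sub>1 - p\<^sub>2)\<close>, where \<open>p\<^sub>1, p\<^sub>2\<close> are the Herglotz integrals of the positive
  and negative parts of the logarithm of the modulus of \<open>f\<close> on the circle. Both have
  nonnegative real part, hence radial limits a.e., so the boundary argument \<open>v = \<alpha> + Im p\<^sub>1 - Im p\<^sub>2\<close> is defined a.e., and it takes values in \<open>\<pi>\<int>\<close> because
  \<open>f\<close> is real on the circle. The truncation of \<open>v\<close> to \<open>[-N\<pi>, N\<pi>]\<close> is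
  \<open>\<pi> \<Sum>\<^sub>k (\<chi>{v \<ge> k\<pi>} - \<chi>{v \<le> -k\<pi>})\<close>, \<open>1 \<le> k \<le> N\<close>. If \<open>S\<close> is the Herglotz integral of the indicator of a
  set, then \<open>exp (i\<pi> (S - 1/2)) = (1 - i\<phi>) / (1 + i\<phi>)\<close> with \<open>\<phi>\<close> inner, so the \<open>N\<close>-th partial product is
  the exponential of \<open>i\<close> times the Herglotz integral of the truncated argument. Although \<open>v\<close> need not be
  integrable, these integrals converge to \<open>log f - log \<bar>f 0\<bar>\<close>: truncation at level \<open>m\<close> differs by
  \<open>o(1)\<close> in \<open>L\<^sup>1\<close> from replacing each \<open>p\<^sub>j\<close> by the bounded function \<open>p\<^sub>j / (1 + p\<^sub>j/m)\<close>, for which the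
  Cauchy formula is exact.

  Fatou's theorem for bounded \<open>F\<close> follows from Lebesgue's differentiation theorem: a primitive of \<open>F\<close> is Lipschitz up
  to the circle and is there an indefinite integral, and \<open>F\<close> has a radial limit wherever that integral
  is differentiable.
\<close>

section \<open>Herglotz kernel on the circle\<close>

text \<open>The obstacle is that the harmonic conjugate of an integrable function need not be
  integrable, so \<open>v\<close> itself need not have a Herglotz integral. What rescues the
  truncations is that no mass is lost at the circle: \<open>p\<close> is the Herglotz integral of a
  function, not of a singular measure, so its boundary real part has mean \<open>p 0\<close>. If
  \<open>A + i B\<close> is the boundary value of \<open>p\<close>, then the boundary real part of
  \<open>q = p / (1 + p/m)\<close> is a term dominated by \<open>A\<close>, plus
  \<open>B^2/m\<close> divided by the squared modulus of \<open>1 + p/m\<close>. Its mean is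
  \<open>Re (q 0)\<close>, which tends to \<open>p 0\<close>; the dominated term has the same limit,
  so the other tends to 0 in mean. Since that other term is at least \<open>m/65\<close> where
  \<open>A \<le> m\<close> and B exceeds \<open>m/4\<close> in modulus, truncation is cheap.

  The shift by 1/2 centres the strip between \<open>Re S = 0\<close> and \<open>Re S = 1\<close>, so
  that the exponential lies in the right half-plane and reaches the imaginary axis a.e. on the
  circle; a Cayley transform turns this axis into the circle. Pairing level k with level -k cancels
  the shifts.\<close>

definition circ :: "real measure" where
  "circ = density lborel (\<lambda>t. ennreal (indicator {0..2*pi} t / (2*pi)))"

lemma sets_circ [simp, measurable_cong]: "sets circ = sets borel"
  and space_circ [simp]: "space circ = UNIV"
  by (simp_all add: circ_def)

lemma prob_space_circ: "prob_space circ"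
proof
  have "emeasure circ (space circ) = (\<integral>\<^sup>+t. ennreal (1/(2*pi)) * indicator {0..2*pi} t \<partial>lborel)"
    unfolding circ_def by (subst emeasure_density) (auto intro!: nn_integral_cong simp: indicator_def)
  also have "\<dots> = 1"
    by (subst nn_integral_cmult_indicator) (auto simp flip: ennreal_mult)
  finally show "emeasure circ (space circ) = 1" .
qed

interpretation circ: prob_space circ by (rule prob_space_circ)

lemma measure_circ_UNIV [simp]: "measure circ UNIV = 1"
  using circ.prob_space by simp

lemma AE_circ: "(AE t in circ. P t) \<longleftrightarrow> (AE t in lborel. t \<in> {0..2*pi} \<longrightarrow> P t)"
  unfolding circ_def by (subst AE_density) (auto simp: indicator_def)

text \<open>Both endpoints parametrise the same point of the circle; away from them
  \<open>cis\<close> separates points of the interval, and two-sided derivatives in the angle make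
  sense.\<close>

lemma AE_circ_open_interval: "AE t in circ. t \<in> {0<..<2*pi}"
proof -
  have "AE t in lborel. t \<noteq> (0::real)" "AE t in lborel. t \<noteq> 2*pi"
    by (rule AE_lborel_singleton)+
  then show ?thesis unfolding AE_circ by eventually_elim auto
qed

lemma integrable_circ_iff:
  fixes f :: "real \<Rightarrow> 'a::{banach,second_countable_topology}"
  assumes "f \<in> borel_measurable borel"
  shows "integrable circ f \<longleftrightarrow> set_integrable lborel {0..2*pi} f"
proof -
  have "integrable circ f \<longleftrightarrow> integrable lborel (\<lambda>t. (indicator {0..2*pi} t / (2*pi)) *\<^sub>R f t)"
    unfolding circ_def using assms by (subst integrable_density) auto
  also have "\<dots> \<longleftrightarrow> integrable lborel (\<lambda>t. (1/(2*pi)) *\<^sub>R (indicator {0..2*pi} t *\<^sub>R f t))"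
    by (rule arg_cong[where f="integrable lborel"]) (auto simp: indicator_def)
  also have "\<dots> \<longleftrightarrow> set_integrable lborel {0..2*pi} f" (is "integrable lborel ?g \<longleftrightarrow> _")
  proof
    assume "integrable lborel ?g"
    then have "integrable lborel (\<lambda>t. (2*pi) *\<^sub>R ?g t)" by (rule integrable_scaleR_right)
    then show "set_integrable lborel {0..2*pi} f" unfolding set_integrable_def by simp
  qed (unfold set_integrable_def, rule integrable_scaleR_right)
  finally show ?thesis .
qed

lemma integral_circ:
  fixes f :: "real \<Rightarrow> 'a::{banach,second_countable_topology}"
  assumes "f \<in> borel_measurable borel"
  shows "integral\<^sup>L circ f = (1/(2*pi)) *\<^sub>R (LINT t:{0..2*pi}|lborel. f t)"
proof -
  have "integral\<^sup>L circ f = integral\<^sup>L lborel (\<lambda>t. (indicator {0..2*pi} t / (2*pi)) *\<^sub>R f t)"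
    unfolding circ_def using assms by (subst integral_density) auto
  also have "\<dots> = integral\<^sup>L lborel (\<lambda>t. (1/(2*pi)) *\<^sub>R (indicator {0..2*pi} t *\<^sub>R f t))"
    by (rule arg_cong[where f="integral\<^sup>L lborel"]) (auto simp: indicator_def)
  also have "\<dots> = (1/(2*pi)) *\<^sub>R (LINT t:{0..2*pi}|lborel. f t)"
    unfolding set_lebesgue_integral_def by (rule integral_scaleR_right)
  finally show ?thesis .
qed

lemma integral_circ_HK:
  fixes f :: "real \<Rightarrow> 'a::euclidean_space"
  assumes "continuous_on UNIV f"
  shows "integral\<^sup>L circ f = (1/(2*pi)) *\<^sub>R integral {0..2*pi} f"
proof -
  have [measurable]: "f \<in> borel_measurable borel"
    using assms by (rule borel_measurable_continuous_onI)
  have "set_integrable lborel {0..2*pi} f"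
    by (rule borel_integrable_atLeastAtMost') (rule continuous_on_subset[OF assms], simp)
  then show ?thesis
    by (simp add: integral_circ set_borel_integral_eq_integral)
qed

lemma continuous_cis_comp:
  fixes F :: "complex \<Rightarrow> 'a::topological_space"
  assumes "continuous_on (cball 0 1) F"
  shows "continuous_on UNIV (\<lambda>t. F (cis t))"
  by (rule continuous_on_compose2[OF assms]) (auto intro!: continuous_intros)

lemma integrable_circ_bounded:
  fixes f :: "real \<Rightarrow> 'a::{banach,second_countable_topology}"
  assumes "f \<in> borel_measurable borel" "AE t in circ. norm (f t) \<le> B"
  shows "integrable circ f"
  using assms by (intro circ.integrable_const_bound[where B=B]) auto

lemma integrable_circ_continuous:
  fixes f :: "real \<Rightarrow> 'a::euclidean_space"
  assumes "continuous_on UNIV f"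
  shows "integrable circ f"
proof -
  have [measurable]: "f \<in> borel_measurable borel"
    using assms by (rule borel_measurable_continuous_onI)
  have "set_integrable lborel {0..2*pi} f"
    by (rule borel_integrable_atLeastAtMost') (rule continuous_on_subset[OF assms], simp)
  then show ?thesis by (simp add: integrable_circ_iff)
qed

lemma Cauchy_circ:
  assumes "continuous_on (cball 0 1) F" "F holomorphic_on ball 0 1" "norm w < 1"
  shows "(\<integral>t. F (cis t) * cis t / (cis t - w) \<partial>circ) = F w"
proof -
  have "((\<lambda>u. F u / (u - w)) has_contour_integral (2 * of_real pi * \<i> * F w)) (circlepath 0 1)"
    using assms by (intro Cauchy_integral_circlepath) auto
  then have "((\<lambda>t. F (cis t) / (cis t - w) * \<i> * cis t) has_integral (2 * of_real pi * \<i> * F w)) {0..2*pi}"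
    unfolding circlepath_def by (subst (asm) has_contour_integral_part_circlepath_iff) auto
  then have "((\<lambda>t. - \<i> * (F (cis t) / (cis t - w) * \<i> * cis t)) has_integral - \<i> * (2 * of_real pi * \<i> * F w)) {0..2*pi}"
    by (rule has_integral_mult_right)
  then have "((\<lambda>t. F (cis t) * cis t / (cis t - w)) has_integral (2 * of_real pi * F w)) {0..2*pi}"
    by (simp add: mult_ac)
  then have "integral {0..2*pi} (\<lambda>t. F (cis t) * cis t / (cis t - w)) = 2 * of_real pi * F w"
    by (rule integral_unique)
  moreover have "cis t - w \<noteq> 0" for t
    using assms(3) by (metis eq_iff_diff_eq_0 norm_cis less_irrefl)
  then have "continuous_on UNIV (\<lambda>t. F (cis t) * cis t / (cis t - w))"
    by (intro continuous_intros continuous_cis_comp assms) auto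
  ultimately show ?thesis
    by (simp add: integral_circ_HK scaleR_conv_of_real)
qed

lemma mean_value_circ:
  assumes "continuous_on (cball 0 1) F" "F holomorphic_on ball 0 1"
  shows "(\<integral>t. F (cis t) \<partial>circ) = F 0"
  using Cauchy_circ[OF assms, of 0] by simp

definition herglotz :: "complex \<Rightarrow> real \<Rightarrow> complex" where
  "herglotz z t = (cis t + z) / (cis t - z)"

lemma cis_minus_nonzero: "norm z < 1 \<Longrightarrow> cis t - z \<noteq> 0"
  by (metis eq_iff_diff_eq_0 norm_cis less_irrefl)

lemma norm_cis_minus_ge: "1 - norm z \<le> norm (cis t - z)"
  by (metis norm_cis norm_triangle_ineq2)

lemma continuous_herglotz: "norm z < 1 \<Longrightarrow> continuous_on UNIV (herglotz z)"
  unfolding herglotz_def[abs_def] by (intro continuous_intros) (auto simp: cis_minus_nonzero)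

lemma measurable_herglotz [measurable]: "herglotz z \<in> borel_measurable borel"
  unfolding herglotz_def[abs_def]
  by (intro borel_measurable_divide borel_measurable_continuous_onI continuous_intros)

lemma norm_herglotz_le:
  assumes "norm z < 1"
  shows "norm (herglotz z t) \<le> 2 / (1 - norm z)"
proof -
  have "norm (cis t + z) \<le> 2"
    using norm_triangle_ineq[of "cis t" z] assms by simp
  then show ?thesis
    unfolding herglotz_def norm_divide using assms norm_cis_minus_ge[of z t]
    by (intro frac_le) auto
qed

lemma Re_herglotz:
  assumes "norm z < 1"
  shows "Re (herglotz z t) = (1 - (norm z)^2) / (norm (cis t - z))^2"
proof -
  have "herglotz z t = (cis t + z) * cnj (cis t - z) / (norm (cis t - z))^2"
    unfolding herglotz_def by (rule complex_div_cnj)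
  then have "Re (herglotz z t) = Re ((cis t + z) * cnj (cis t - z)) / (norm (cis t - z))^2"
    by (metis Re_divide_of_real of_real_power)
  also have "Re ((cis t + z) * cnj (cis t - z)) = (norm (cis t))^2 - (norm z)^2"
    unfolding cmod_power2 by (simp add: algebra_simps power2_eq_square)
  finally show ?thesis by simp
qed

lemma Re_herglotz_pos: "norm z < 1 \<Longrightarrow> 0 < Re (herglotz z t)"
  using cis_minus_nonzero[of z t]
  by (subst Re_herglotz) (auto simp: power_less_one_iff abs_square_less_1 intro!: divide_pos_pos)

lemma herglotz_0 [simp]: "herglotz 0 t = 1"
  by (simp add: herglotz_def)

lemma cnj_herglotz:
  assumes "norm z < 1"
  shows "cnj (herglotz z t) = (1 + cnj z * cis t) / (1 - cnj z * cis t)"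
proof -
  have "cnj (herglotz z t) = (cis (-t) + cnj z) / (cis (-t) - cnj z)"
    by (simp add: herglotz_def cis_cnj)
  also have "\<dots> = ((cis (-t) + cnj z) * cis t) / ((cis (-t) - cnj z) * cis t)"
    by simp
  also have "cis (-t) * cis t = 1"
    by (simp add: cis_mult)
  then have "((cis (-t) + cnj z) * cis t) / ((cis (-t) - cnj z) * cis t) = (1 + cnj z * cis t) / (1 - cnj z * cis t)"
    by (simp add: ring_distribs)
  finally show ?thesis .
qed

text \<open>The kernel is twice the Cauchy kernel \<open>cis t / (cis t - w)\<close> minus 1, hence
  twice the Cauchy formula minus the mean value.\<close>

lemma herglotz_reproduces:
  assumes "continuous_on (cball 0 1) F" "F holomorphic_on ball 0 1" "norm w < 1"
  shows "(\<integral>t. F (cis t) * herglotz w t \<partial>circ) = 2 * F w - F 0"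
proof -
  have eq: "F (cis t) * herglotz w t = 2 * (F (cis t) * cis t / (cis t - w)) - F (cis t)" for t
    using cis_minus_nonzero[OF assms(3), of t] by (simp add: herglotz_def field_simps)
  have "integrable circ (\<lambda>t. F (cis t) * cis t / (cis t - w))" "integrable circ (\<lambda>t. F (cis t))"
    using cis_minus_nonzero[OF assms(3)]
    by (intro integrable_circ_continuous continuous_intros continuous_cis_comp assms; simp)+
  then have "(\<integral>t. F (cis t) * herglotz w t \<partial>circ) = 2 * (\<integral>t. F (cis t) * cis t / (cis t - w) \<partial>circ) - (\<integral>t. F (cis t) \<partial>circ)"
    unfolding eq by (simp only: Bochner_Integration.integral_diff integrable_mult_right integral_mult_right_zero)
  then show ?thesis
    by (simp only: Cauchy_circ[OF assms] mean_value_circ[OF assms(1,2)])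
qed

text \<open>On the circle conjugation inverts \<open>cis t\<close>, so the conjugated kernel is a
  function of \<open>cis t\<close> with its pole outside the closed disk and value 1 at the origin;
  the mean value property applies to the product.\<close>

lemma cnj_herglotz_reproduces:
  assumes "continuous_on (cball 0 1) F" "F holomorphic_on ball 0 1" "norm w < 1"
  shows "(\<integral>t. F (cis t) * cnj (herglotz w t) \<partial>circ) = F 0"
proof -
  define G where "G = (\<lambda>z. F z * ((1 + cnj w * z) / (1 - cnj w * z)))"
  have nz: "1 - cnj w * z \<noteq> 0" if "z \<in> cball 0 1" for z
  proof
    assume "1 - cnj w * z = 0"
    then have "norm (cnj w * z) = 1" by (metis eq_iff_diff_eq_0 norm_one)
    moreover have "norm w * norm z \<le> norm w * 1"
      using that by (intro mult_left_mono) auto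
    ultimately show False using assms(3) by (simp add: norm_mult)
  qed
  have "continuous_on (cball 0 1) G" "G holomorphic_on ball 0 1"
    unfolding G_def using nz
    by (auto intro!: continuous_intros holomorphic_intros assms)
  from mean_value_circ[OF this] show ?thesis
    by (simp add: G_def cnj_herglotz assms)
qed

lemma integral_herglotz: "norm w < 1 \<Longrightarrow> (\<integral>t. herglotz w t \<partial>circ) = 1"
  using herglotz_reproduces[of "\<lambda>_. 1" w] by simp

lemma integral_Re_herglotz:
  assumes "norm w < 1" shows "(\<integral>t. Re (herglotz w t) \<partial>circ) = 1"
proof -
  have "integrable circ (herglotz w)"
    using assms by (intro integrable_circ_continuous continuous_herglotz)
  from integral_Re[OF this] show ?thesis using integral_herglotz[OF assms] by simp
qed

section \<open>Fatou's theorem for bounded functions\<close>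

lemma borel_measurable_cnj [measurable (raw)]:
  "f \<in> borel_measurable M \<Longrightarrow> (\<lambda>x. cnj (f x)) \<in> borel_measurable M"
  by (rule borel_measurable_continuous_on[where f=cnj]) (auto intro!: continuous_intros)

lemma sums_integral_circ:
  fixes f :: "nat \<Rightarrow> real \<Rightarrow> complex"
  assumes meas [measurable]: "\<And>n. f n \<in> borel_measurable borel"
    and v: "integrable circ v" and le: "\<And>n t. norm (f n t) \<le> b n * v t" and b: "summable b"
    and F: "\<And>t. (\<lambda>n. f n t) sums F t"
  shows "(\<lambda>n. \<integral>t. f n t \<partial>circ) sums (\<integral>t. F t \<partial>circ)"
proof -
  have int: "integrable circ (f n)" for n
    by (rule Bochner_Integration.integrable_bound[of circ "\<lambda>t. b n * v t"])
       (use v in \<open>auto intro!: AE_I2 order_trans[OF le]\<close>)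
  have "summable (\<lambda>n. norm (f n t))" for t
    by (rule summable_comparison_test'[where N=0, OF summable_mult2[OF b, of "v t"]]) (use le in auto)
  moreover have "summable (\<lambda>n. \<integral>t. norm (f n t) \<partial>circ)"
  proof (rule summable_comparison_test'[where N=0])
    show "summable (\<lambda>n. b n * (\<integral>t. v t \<partial>circ))" by (rule summable_mult2[OF b])
    fix n
    have "(\<integral>t. norm (f n t) \<partial>circ) \<le> (\<integral>t. b n * v t \<partial>circ)"
      by (rule integral_mono) (use int v le in auto)
    then show "norm (\<integral>t. norm (f n t) \<partial>circ) \<le> b n * (\<integral>t. v t \<partial>circ)" by simp
  qed
  ultimately have "(\<lambda>n. \<integral>t. f n t \<partial>circ) sums (\<integral>t. (\<Sum>n. f n t) \<partial>circ)"
    using int by (intro sums_integral) auto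
  then show ?thesis using F by (simp add: sums_iff)
qed

section \<open>Parseval's identity and mean-square convergence of dilations\<close>

lemma cis_power_orthogonal:
  "(\<integral>t. (cis t)^n * cnj ((cis t)^m) \<partial>circ) = (if n = m then 1 else 0)"
proof -
  have ge: "(\<integral>t. (cis t)^n * cnj ((cis t)^m) \<partial>circ) = (if n = m then 1 else 0)" if "m \<le> n" for n m
  proof -
    have "(cis t)^n * cnj ((cis t)^m) = (cis t)^(n-m)" for t
    proof -
      have "(cis t)^n = (cis t)^(n-m) * (cis t)^m"
        using that by (simp flip: power_add)
      moreover have "(cis t)^m * cnj ((cis t)^m) = 1"
        using complex_norm_square[of "(cis t)^m"]
        by (metis norm_cis norm_power of_real_1 power_one)
      ultimately show ?thesis by (metis mult.assoc mult.right_neutral)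
    qed
    then have "(\<integral>t. (cis t)^n * cnj ((cis t)^m) \<partial>circ) = (\<integral>t. (cis t)^(n-m) \<partial>circ)" by simp
    also have "\<dots> = 0^(n-m)"
      by (rule mean_value_circ) (auto intro!: continuous_intros holomorphic_intros)
    finally show ?thesis using that by (auto simp: power_0_left)
  qed
  show ?thesis
  proof (cases "m \<le> n")
    case False
    have "(\<integral>t. (cis t)^n * cnj ((cis t)^m) \<partial>circ) = (\<integral>t. cnj ((cis t)^m * cnj ((cis t)^n)) \<partial>circ)"
      by (simp add: mult.commute)
    also have "\<dots> = cnj (\<integral>t. (cis t)^m * cnj ((cis t)^n) \<partial>circ)"
      by (rule Bochner_Integration.integral_cnj)
    also have "\<dots> = 0" using ge[of n m] False by simp
    finally show ?thesis using False by simp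
  qed (rule ge)
qed

text \<open>Absolute summability allows termwise integration twice: first to identify
  \<open>d m\<close> as a Fourier coefficient of \<open>D\<close>, then to expand the conjugated
  factor of \<open>D t * cnj (D t)\<close>.\<close>

lemma Parseval_circ:
  fixes d :: "nat \<Rightarrow> complex"
  assumes d: "summable (\<lambda>n. norm (d n))" and D [measurable]: "D \<in> borel_measurable borel"
    and sums: "\<And>t. (\<lambda>n. d n * (cis t)^n) sums D t"
  shows "(\<lambda>n. (norm (d n))^2) sums (\<integral>t. (norm (D t))^2 \<partial>circ)"
proof -
  have [measurable]: "cis \<in> borel_measurable borel"
    by (intro borel_measurable_continuous_onI continuous_intros)
  have coeff: "(\<integral>t. D t * cnj ((cis t)^m) \<partial>circ) = d m" for m
  proof -
    have "(\<lambda>n. \<integral>t. d n * (cis t)^n * cnj ((cis t)^m) \<partial>circ) sums (\<integral>t. D t * cnj ((cis t)^m) \<partial>circ)"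
      by (rule sums_integral_circ[where v="\<lambda>_. 1", OF _ _ _ d])
         (auto simp: norm_mult norm_power intro!: sums_mult2 sums)
    moreover have "(\<lambda>n. \<integral>t. d n * (cis t)^n * cnj ((cis t)^m) \<partial>circ) = (\<lambda>n. if n = m then d n else 0)"
      unfolding mult.assoc by (intro ext) (simp only: integral_mult_right_zero cis_power_orthogonal, simp)
    ultimately show ?thesis
      using sums_single[of m d] sums_unique2 by metis
  qed
  have bound: "norm (D t) \<le> (\<Sum>n. norm (d n))" for t
  proof -
    have "norm (\<Sum>n. d n * (cis t)^n) \<le> (\<Sum>n. norm (d n * (cis t)^n))"
      by (rule summable_norm) (use d in \<open>auto simp: norm_mult norm_power\<close>)
    then show ?thesis using sums[of t] by (simp add: sums_iff norm_mult norm_power)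
  qed
  have "(\<lambda>m. \<integral>t. D t * cnj (d m * (cis t)^m) \<partial>circ) sums (\<integral>t. D t * cnj (D t) \<partial>circ)"
  proof (rule sums_integral_circ[where v="\<lambda>_. \<Sum>n. norm (d n)", OF _ _ _ d])
    show "norm (D t * cnj (d n * cis t ^ n)) \<le> norm (d n) * (\<Sum>n. norm (d n))" for n t
      using mult_right_mono[OF bound[of t], of "norm (d n)"] by (simp add: norm_mult norm_power mult.commute)
    show "(\<lambda>m. D t * cnj (d m * (cis t)^m)) sums (D t * cnj (D t))" for t
      using sums[of t] by (intro sums_mult) (simp only: sums_cnj)
  qed auto
  moreover have "(\<integral>t. D t * cnj (d m * (cis t)^m) \<partial>circ) = complex_of_real ((norm (d m))^2)" for m
  proof -
    have "(\<integral>t. D t * cnj (d m * (cis t)^m) \<partial>circ) = (\<integral>t. cnj (d m) * (D t * cnj ((cis t)^m)) \<partial>circ)"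
      by (simp add: mult_ac)
    also have "\<dots> = cnj (d m) * d m" by (simp only: integral_mult_right_zero coeff)
    finally show ?thesis by (simp only: complex_norm_square mult.commute)
  qed
  moreover have "(\<integral>t. D t * cnj (D t) \<partial>circ) = complex_of_real (\<integral>t. (norm (D t))^2 \<partial>circ)"
    by (subst integral_complex_of_real[symmetric]) (simp only: complex_norm_square)
  ultimately show ?thesis by (simp only: sums_of_real_iff)
qed

lemma continuous_radial:
  assumes "continuous_on (ball 0 1) F" "0 \<le> r" "r < 1"
  shows "continuous_on UNIV (\<lambda>t. F (complex_of_real r * cis t))"
  by (rule continuous_on_compose2[OF assms(1)])
     (use assms in \<open>auto intro!: continuous_intros simp: norm_mult\<close>)

lemma measurable_radial:
  fixes F :: "complex \<Rightarrow> complex"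
  assumes "continuous_on (ball 0 1) F" "0 \<le> r" "r < 1"
  shows "(\<lambda>t. F (complex_of_real r * cis t)) \<in> borel_measurable borel"
  by (rule borel_measurable_continuous_onI[OF continuous_radial[OF assms]])

text \<open>By Parseval the integral is the sum of \<open>(norm (c n))^2 * (s^n - s'^n)^2\<close>,
  at most the sum of \<open>(norm (c n))^2 * (1 - r^n)^2\<close>. Boundedness of \<open>F\<close>
  makes the squared Taylor coefficients summable, so Tannery's theorem sends the majorant to 0 as
  \<open>r\<close> tends to 1.\<close>

lemma Hinf_radial_L2:
  assumes F: "F \<in> Hinf" and e: "e > 0"
  shows "\<forall>\<^sub>F r in at_left 1. \<forall>s\<in>{r..<1}. \<forall>s'\<in>{r..<1}.
           (\<integral>t. (norm (F (complex_of_real s * cis t) - F (complex_of_real s' * cis t)))^2 \<partial>circ) < e"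
proof -
  from F have hol: "F holomorphic_on ball 0 1" and "bounded (F ` ball 0 1)"
    by (auto simp: Hinf_def)
  then obtain M where "\<forall>y\<in>F ` ball 0 1. norm y \<le> M"
    unfolding bounded_iff by blast
  then have M: "norm (F z) \<le> M" if "norm z < 1" for z
    using that by auto
  note cont = holomorphic_on_imp_continuous_on[OF hol]
  define c where "c n = (deriv ^^ n) F 0 / fact n" for n
  have c: "(\<lambda>n. c n * z^n) sums F z" if "norm z < 1" for z
    using holomorphic_power_series[OF hol, of z] that by (simp add: c_def)
  have abs: "summable (\<lambda>n. norm (c n) * s^n)" if "0 \<le> s" "s < 1" for s
  proof -
    obtain x where x: "s < x" "x < 1" using \<open>s < 1\<close> dense by blast
    have "summable (\<lambda>n. norm (c n * complex_of_real s ^ n))"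
      by (rule powser_insidea[of _ "complex_of_real x"])
         (use c[of "complex_of_real x"] x that in \<open>auto simp: sums_iff\<close>)
    then show ?thesis using that by (simp add: norm_mult norm_power)
  qed
  have pars: "(\<lambda>n. (norm (c n))^2 * (s^n - s'^n)^2) sums
      (\<integral>t. (norm (F (complex_of_real s * cis t) - F (complex_of_real s' * cis t)))^2 \<partial>circ)"
    if s: "0 \<le> s" "s < 1" "0 \<le> s'" "s' < 1" for s s'
  proof -
    have "(\<lambda>n. (norm (c n * complex_of_real (s^n - s'^n)))^2) sums
      (\<integral>t. (norm (F (complex_of_real s * cis t) - F (complex_of_real s' * cis t)))^2 \<partial>circ)"
    proof (rule Parseval_circ)
      show "summable (\<lambda>n. norm (c n * complex_of_real (s^n - s'^n)))"
      proof (rule summable_comparison_test'[where N=0])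
        show "summable (\<lambda>n. norm (c n) * s^n + norm (c n) * s'^n)"
          by (intro summable_add abs s)
        have "\<bar>s^n - s'^n\<bar> \<le> s^n + s'^n" for n using s by (auto simp: abs_le_iff)
        then have "norm (c n) * \<bar>s^n - s'^n\<bar> \<le> norm (c n) * (s^n + s'^n)" for n
          by (rule mult_left_mono) auto
        then show "norm (norm (c n * complex_of_real (s^n - s'^n))) \<le> norm (c n) * s^n + norm (c n) * s'^n" for n
          by (simp add: norm_mult distrib_left abs_mult del: of_real_diff of_real_power)
      qed
      show "(\<lambda>t. F (complex_of_real s * cis t) - F (complex_of_real s' * cis t)) \<in> borel_measurable borel"
        by (intro borel_measurable_diff measurable_radial[OF cont] s)
      show "(\<lambda>n. c n * complex_of_real (s^n - s'^n) * cis t ^ n) sums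
          (F (complex_of_real s * cis t) - F (complex_of_real s' * cis t))" for t
        using sums_diff[OF c[of "complex_of_real s * cis t"] c[of "complex_of_real s' * cis t"]] s
        by (simp add: norm_mult algebra_simps power_mult_distrib)
    qed
    then show ?thesis by (simp add: norm_mult power_mult_distrib flip: of_real_power of_real_diff)
  qed
  have sumc: "summable (\<lambda>n. (norm (c n))^2)"
  proof (rule summableI_nonneg_bounded)
    fix N
    have le: "(\<Sum>n<N. (norm (c n))^2 * (s^n - 0^n)^2) \<le> (2*M)^2" if s: "0 \<le> s" "s < 1" for s :: real
    proof -
      have "(\<Sum>n<N. (norm (c n))^2 * (s^n - 0^n)^2) \<le>
        (\<integral>t. (norm (F (complex_of_real s * cis t) - F (complex_of_real 0 * cis t)))^2 \<partial>circ)"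
        using sum_le_suminf[of "\<lambda>n. (norm (c n))^2 * (s^n - 0^n)^2" "{..<N}"] pars[of s 0] s
        by (auto simp: sums_iff)
      also have "\<dots> \<le> (\<integral>t. (2*M)^2 \<partial>circ)"
      proof (rule integral_mono)
        show "integrable circ (\<lambda>t. (norm (F (complex_of_real s * cis t) - F (complex_of_real 0 * cis t)))^2)"
          by (intro integrable_circ_continuous continuous_intros continuous_radial[OF cont] s) auto
        fix t
        have "norm (F (complex_of_real s * cis t) - F (complex_of_real 0 * cis t)) \<le> M + M"
          using s by (intro norm_triangle_le_diff add_mono M) (auto simp: norm_mult)
        then show "(norm (F (complex_of_real s * cis t) - F (complex_of_real 0 * cis t)))^2 \<le> (2*M)^2"
          by (intro power_mono) auto
      qed auto
      finally show ?thesis by simp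
    qed
    have "((\<lambda>s::real. \<Sum>n<N. (norm (c n))^2 * (s^n - 0^n)^2) \<longlongrightarrow> (\<Sum>n<N. (norm (c n))^2 * (1^n - 0^n)^2)) (at_left 1)"
      by (intro tendsto_intros)
    then have "(\<Sum>n<N. (norm (c n))^2 * (1^n - 0^n)^2) \<le> (2*M)^2"
      by (rule tendsto_upperbound)
         (use le in \<open>auto simp: eventually_at_left_field intro!: exI[of _ 0]\<close>)
    \<comment> \<open>\<open>0^n\<close> is 1 at \<open>n = 0\<close>, so comparing with radius 0
      loses the constant coefficient; it is added back here.\<close>
    moreover have "(norm (c n))^2 \<le> (norm (c n))^2 * (1^n - 0^n)^2 + (if n = 0 then (norm (c 0))^2 else 0)" for n
      by (auto simp: power_0_left)
    then have "(\<Sum>n<N. (norm (c n))^2) \<le> (\<Sum>n<N. (norm (c n))^2 * (1^n - 0^n)^2 + (if n = 0 then (norm (c 0))^2 else 0))"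
      by (intro sum_mono)
    ultimately show "(\<Sum>n<N. (norm (c n))^2) \<le> (2*M)^2 + (norm (c 0))^2"
      by (auto simp: sum.distrib sum.delta split: if_splits intro: order_trans add_increasing2)
  qed auto
  have rng: "\<forall>\<^sub>F r in at_left (1::real). 0 < r \<and> r < 1"
    by (auto simp: eventually_at_left_field intro!: exI[of _ 0])
  have "((\<lambda>r. \<Sum>n. (norm (c n))^2 * (1 - r^n)^2) \<longlongrightarrow> (\<Sum>n. (norm (c n))^2 * (1 - 1^n)^2)) (at_left (1::real))"
  proof -
    have "\<forall>\<^sub>F x in at_top \<times>\<^sub>F at_left 1. True \<and> (0 < snd x \<and> snd x < (1::real))"
      by (rule eventually_prodI[of "\<lambda>_. True", OF _ rng]) auto
    then have "\<forall>\<^sub>F x in at_top \<times>\<^sub>F at_left 1. case x of (n, r) \<Rightarrow> norm ((norm (c n))^2 * (1 - r^n)^2) \<le> (norm (c n))^2"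
    proof eventually_elim
      case (elim x)
      then have "\<bar>1 - snd x ^ fst x\<bar> \<le> 1" by (auto simp: abs_le_iff power_le_one)
      then have "(1 - snd x ^ fst x)^2 \<le> 1" by (simp add: abs_square_le_1)
      then show ?case by (auto simp: split_beta norm_mult intro!: mult_left_le)
    qed
    then show ?thesis
      by (intro tannerys_theorem[OF _ _ sumc, THEN conjunct2, THEN conjunct2] tendsto_intros) auto
  qed
  then have "\<forall>\<^sub>F r in at_left (1::real). (\<Sum>n. (norm (c n))^2 * (1 - r^n)^2) < e"
    by (intro order_tendstoD(2)) (use e in auto)
  with rng show ?thesis
  proof eventually_elim
    case (elim r)
    show ?case
    proof (intro ballI)
      fix s s' assume s: "s \<in> {r..<1}" "s' \<in> {r..<1}"
      have "(\<integral>t. (norm (F (complex_of_real s * cis t) - F (complex_of_real s' * cis t)))^2 \<partial>circ)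
            = (\<Sum>n. (norm (c n))^2 * (s^n - s'^n)^2)"
        using pars[of s s'] s elim by (auto simp: sums_iff)
      also have "\<dots> \<le> (\<Sum>n. (norm (c n))^2 * (1 - r^n)^2)"
      proof (rule suminf_le)
        fix n
        have "r^n \<le> s^n" "r^n \<le> s'^n" "s^n \<le> 1" "s'^n \<le> 1"
          using s elim by (auto intro!: power_mono power_le_one)
        then have "\<bar>s^n - s'^n\<bar> \<le> \<bar>1 - r^n\<bar>" by (auto simp: abs_le_iff)
        then have "(s^n - s'^n)^2 \<le> (1 - r^n)^2" by (simp only: abs_le_square_iff)
        then show "(norm (c n))^2 * (s^n - s'^n)^2 \<le> (norm (c n))^2 * (1 - r^n)^2"
          by (rule mult_left_mono) auto
      next
        show "summable (\<lambda>n. (norm (c n))^2 * (s^n - s'^n)^2)"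
          using pars[of s s'] s elim by (auto simp: sums_iff)
        show "summable (\<lambda>n. (norm (c n))^2 * (1 - r^n)^2)"
        proof (rule summable_comparison_test'[where N=0, OF sumc])
          fix n
          have "\<bar>1 - r ^ n\<bar> \<le> 1" using elim by (auto simp: abs_le_iff power_le_one)
          then have "(1 - r ^ n)^2 \<le> 1" by (simp add: abs_square_le_1)
          then show "norm ((norm (c n))^2 * (1 - r^n)^2) \<le> (norm (c n))^2"
            by (auto simp: norm_mult intro!: mult_left_le)
        qed
      qed
      also have "\<dots> < e" using elim by simp
      finally show "(\<integral>t. (norm (F (complex_of_real s * cis t) - F (complex_of_real s' * cis t)))^2 \<partial>circ) < e" .
    qed
  qed
qed

lemma Hinf_bound:
  assumes "F \<in> Hinf"
  obtains M where "M \<ge> 0" "\<And>z. norm z < 1 \<Longrightarrow> norm (F z) \<le> M"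
proof -
  from assms obtain M where M: "\<forall>y\<in>F ` ball 0 1. norm y \<le> M"
    unfolding Hinf_def bounded_iff by blast
  then have "norm (F 0) \<le> M" by auto
  then have "M \<ge> 0" using norm_ge_zero order_trans by blast
  with M show ?thesis by (intro that[of M]) auto
qed

lemma Hinf_continuous: "F \<in> Hinf \<Longrightarrow> continuous_on (ball 0 1) F"
  by (auto simp: Hinf_def intro: holomorphic_on_imp_continuous_on)

text \<open>The radii grow so fast that consecutive dilations differ by at most
  \<open>(1/2)^n\<close> in mean; the differences are then absolutely summable a.e., and the
  dilations converge by telescoping. Convergence along one sequence is weaker than a radial limit,
  but it supplies a boundary density for the primitive.\<close>

lemma Hinf_radial_subseq:
  assumes F: "F \<in> Hinf"
  obtains \<rho> :: "nat \<Rightarrow> real" and g where "\<And>n. 0 \<le> \<rho> n" "\<And>n. \<rho> n < 1" "\<rho> \<longlonglongrightarrow> 1"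
    "g \<in> borel_measurable borel" "AE t in circ. (\<lambda>n. F (complex_of_real (\<rho> n) * cis t)) \<longlonglongrightarrow> g t"
proof -
  note cont = Hinf_continuous[OF F]
  define I where "I s s' = (\<integral>t. (norm (F (complex_of_real s * cis t) - F (complex_of_real s' * cis t)))^2 \<partial>circ)" for s s'
  have "\<exists>r. 1 - inverse (real (Suc n)) \<le> r \<and> 0 \<le> r \<and> r < 1 \<and> (\<forall>s\<in>{r..<1}. \<forall>s'\<in>{r..<1}. I s s' < ((1/2)^n)^2)" for n
  proof -
    have "\<forall>\<^sub>F r in at_left 1. \<forall>s\<in>{r..<1}. \<forall>s'\<in>{r..<1}. I s s' < ((1/2)^n)^2"
      unfolding I_def by (rule Hinf_radial_L2[OF F]) auto
    moreover have "\<forall>\<^sub>F r in at_left (1::real). 1 - inverse (real (Suc n)) < r \<and> r < 1"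
      by (subst eventually_at_left_field) (auto intro!: exI[of _ "1 - inverse (real (Suc n))"])
    ultimately have "\<forall>\<^sub>F r in at_left 1. 1 - inverse (real (Suc n)) \<le> r \<and> 0 \<le> r \<and> r < 1 \<and> (\<forall>s\<in>{r..<1}. \<forall>s'\<in>{r..<1}. I s s' < ((1/2)^n)^2)"
    proof eventually_elim
      case (elim r)
      have "inverse (real (Suc n)) \<le> 1" by (simp add: inverse_le_1_iff)
      with elim show ?case by auto
    qed
    then show ?thesis by (auto dest: eventually_happens)
  qed
  then obtain R where R: "\<And>n. 1 - inverse (real (Suc n)) \<le> R n" "\<And>n. 0 \<le> R n" "\<And>n. R n < 1"
    "\<And>n s s'. s \<in> {R n..<1} \<Longrightarrow> s' \<in> {R n..<1} \<Longrightarrow> I s s' < ((1/2)^n)^2"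
    by metis
  \<comment> \<open>The running maximum puts both \<open>\<rho> n\<close> and
    \<open>\<rho> (Suc n)\<close> beyond \<open>R n\<close>, as the bound on consecutive differences
    demands.\<close>
  define \<rho> where "\<rho> n = Max (R ` {..n})" for n
  have ge: "R m \<le> \<rho> n" if "m \<le> n" for m n
    unfolding \<rho>_def by (rule Max_ge) (use that in auto)
  have lt: "\<rho> n < 1" for n
    unfolding \<rho>_def by (subst Max_less_iff) (use R in auto)
  have nonneg: "0 \<le> \<rho> n" for n using ge[of n n] R(2)[of n] by simp
  have lim: "\<rho> \<longlonglongrightarrow> 1"
  proof (rule tendsto_sandwich)
    show "(\<lambda>n. 1 + - inverse (real (Suc n))) \<longlonglongrightarrow> 1" by (rule LIMSEQ_inverse_real_of_nat_add_minus)
    show "(\<lambda>n. 1::real) \<longlonglongrightarrow> 1" by simp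
    show "\<forall>\<^sub>F n in sequentially. 1 + - inverse (real (Suc n)) \<le> \<rho> n"
      using R(1) ge[OF order_refl] order_trans by (fastforce intro!: always_eventually)
    show "\<forall>\<^sub>F n in sequentially. \<rho> n \<le> 1" using lt by (auto intro!: always_eventually less_imp_le)
  qed
  define D where "D n t = F (complex_of_real (\<rho> (Suc n)) * cis t) - F (complex_of_real (\<rho> n) * cis t)" for n t
  have Dc: "continuous_on UNIV (D n)" for n
    unfolding D_def[abs_def] by (intro continuous_intros continuous_radial[OF cont] nonneg lt)
  have [measurable]: "D n \<in> borel_measurable borel" for n
    by (rule borel_measurable_continuous_onI[OF Dc])
  have Dle: "(\<integral>t. norm (D n t) \<partial>circ) \<le> (1/2)^n" for n
  proof -
    define q :: real where "q = (1/2)^n"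
    have q: "q > 0" by (simp add: q_def)
    have i2: "integrable circ (\<lambda>t. (norm (D n t))^2)"
      by (intro integrable_circ_continuous continuous_intros Dc)
    have "(\<integral>t. norm (D n t) \<partial>circ) \<le> (\<integral>t. q/2 + (norm (D n t))^2 / (2*q) \<partial>circ)"
    proof (rule integral_mono)
      show "integrable circ (\<lambda>t. norm (D n t))" by (intro integrable_circ_continuous continuous_intros Dc)
      show "integrable circ (\<lambda>t. q/2 + (norm (D n t))^2 / (2*q))" using i2 by auto
      fix t
      \<comment> \<open>The arithmetic-geometric mean inequality with weight \<open>q\<close> stands
        in for Cauchy-Schwarz; each of its two terms integrates to at most
        \<open>q/2\<close>.\<close>
      have "0 \<le> (norm (D n t) - q)^2" by simp
      then have "norm (D n t) * (2*q) \<le> q^2 + (norm (D n t))^2"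
        by (simp add: power2_eq_square algebra_simps)
      then show "norm (D n t) \<le> q/2 + (norm (D n t))^2 / (2*q)"
        using q by (simp add: field_simps power2_eq_square)
    qed
    also have "\<dots> = q/2 + (\<integral>t. (norm (D n t))^2 \<partial>circ) / (2*q)"
      using i2 by (subst Bochner_Integration.integral_add) auto
    also have "(\<integral>t. (norm (D n t))^2 \<partial>circ) = I (\<rho> (Suc n)) (\<rho> n)"
      by (simp add: I_def D_def)
    also have "\<dots> < q^2"
      unfolding q_def using ge[of n "Suc n"] ge[of n n] lt by (intro R) auto
    then have "q/2 + I (\<rho> (Suc n)) (\<rho> n) / (2*q) \<le> q/2 + q^2/(2*q)"
      using q by (intro add_left_mono divide_right_mono) auto
    also have "\<dots> = q" using q by (simp add: power2_eq_square field_simps)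
    finally show ?thesis by (simp add: q_def)
  qed
  have "(\<integral>\<^sup>+t. (\<Sum>n. ennreal (norm (D n t))) \<partial>circ) = (\<Sum>n. \<integral>\<^sup>+t. ennreal (norm (D n t)) \<partial>circ)"
    by (rule nn_integral_suminf) measurable
  also have "\<dots> \<le> (\<Sum>n. ennreal ((1/2)^n))"
  proof (rule suminf_le)
    fix n
    have "(\<integral>\<^sup>+t. ennreal (norm (D n t)) \<partial>circ) = ennreal (\<integral>t. norm (D n t) \<partial>circ)"
      by (intro nn_integral_eq_integral integrable_circ_continuous continuous_intros Dc) auto
    then show "(\<integral>\<^sup>+t. ennreal (norm (D n t)) \<partial>circ) \<le> ennreal ((1/2)^n)"
      using Dle[of n] by (simp add: ennreal_leI)
  qed auto
  also have "\<dots> < top"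
    by (subst suminf_ennreal2) (auto simp: summable_geometric)
  finally have "(\<integral>\<^sup>+t. (\<Sum>n. ennreal (norm (D n t))) \<partial>circ) \<noteq> \<infinity>" by simp
  then have "AE t in circ. (\<Sum>n. ennreal (norm (D n t))) \<noteq> \<infinity>"
    by (intro nn_integral_PInf_AE) measurable
  then have "AE t in circ. convergent (\<lambda>n. F (complex_of_real (\<rho> n) * cis t))"
  proof eventually_elim
    case (elim t)
    then have "summable (\<lambda>n. norm (D n t))"
      by (intro summable_suminf_not_top) auto
    then have "summable (\<lambda>n. D n t)" by (rule summable_norm_cancel)
    then have "convergent (\<lambda>n. \<Sum>i<n. D i t)" by (simp add: summable_iff_convergent)
    then have "convergent (\<lambda>n. F (complex_of_real (\<rho> 0) * cis t) + (\<Sum>i<n. D i t))"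
      by (intro convergent_add convergent_const)
    moreover have "F (complex_of_real (\<rho> 0) * cis t) + (\<Sum>i<n. D i t) = F (complex_of_real (\<rho> n) * cis t)" for n
      unfolding D_def by (subst sum_lessThan_telescope) auto
    ultimately show ?case by simp
  qed
  then have "AE t in circ. (\<lambda>n. F (complex_of_real (\<rho> n) * cis t)) \<longlonglongrightarrow> lim (\<lambda>n. F (complex_of_real (\<rho> n) * cis t))"
    by eventually_elim (simp add: convergent_LIMSEQ_iff)
  moreover have "(\<lambda>t. lim (\<lambda>n. F (complex_of_real (\<rho> n) * cis t))) \<in> borel_measurable borel"
    by (intro borel_measurable_lim_metric measurable_radial[OF cont] nonneg lt)
  ultimately show ?thesis by (intro that[OF nonneg lt lim])
qed

section \<open>Boundary values of the primitive\<close>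

lemma Hinf_primitive_extends:
  assumes F: "F \<in> Hinf"
  obtains \<Phi> where "continuous_on (cball 0 1) \<Phi>"
    "\<And>z. z \<in> ball 0 1 \<Longrightarrow> (\<Phi> has_field_derivative F z) (at z)"
proof -
  from F have hol: "F holomorphic_on ball 0 1" by (simp add: Hinf_def)
  obtain M where M: "\<And>z. norm z < 1 \<Longrightarrow> norm (F z) \<le> M" using Hinf_bound[OF F] by blast
  obtain \<Phi>0 where \<Phi>0: "\<And>z. z \<in> ball 0 1 \<Longrightarrow> (\<Phi>0 has_field_derivative F z) (at z within ball 0 1)"
    using holomorphic_convex_primitive'[OF convex_ball open_ball hol] by blast
  have "uniformly_continuous_on (ball 0 1) \<Phi>0"
  proof (rule lipschitz_on_uniformly_continuous)
    show "(\<bar>M\<bar>)-lipschitz_on (ball 0 1) \<Phi>0"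
    proof (rule lipschitz_onI)
      fix x y :: complex assume "x \<in> ball 0 1" "y \<in> ball 0 1"
      then have "norm (\<Phi>0 x - \<Phi>0 y) \<le> \<bar>M\<bar> * norm (x - y)"
        by (intro field_differentiable_bound[of "ball 0 1" \<Phi>0 F] \<Phi>0)
           (use M in \<open>auto intro: order_trans[OF _ abs_ge_self]\<close>)
      then show "dist (\<Phi>0 x) (\<Phi>0 y) \<le> \<bar>M\<bar> * dist x y" by (simp add: dist_norm)
    qed auto
  qed
  then obtain \<Phi> where \<Phi>: "uniformly_continuous_on (closure (ball 0 1)) \<Phi>" "\<And>x. x \<in> ball 0 1 \<Longrightarrow> \<Phi>0 x = \<Phi> x"
    by (rule uniformly_continuous_on_extension_on_closure) blast
  show ?thesis
  proof (rule that[of \<Phi>])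
    show "continuous_on (cball 0 1) \<Phi>"
      using uniformly_continuous_imp_continuous[OF \<Phi>(1)] by simp
    fix z :: complex assume z: "z \<in> ball 0 1"
    then have "(\<Phi>0 has_field_derivative F z) (at z)"
      using \<Phi>0[OF z] at_within_open[OF z open_ball] by metis
    then show "(\<Phi> has_field_derivative F z) (at z)"
      by (rule has_field_derivative_transform_within_open[OF _ open_ball z \<Phi>(2)])
  qed
qed

section \<open>The Cauchy kernel for the derivative and its reflected pole\<close>

lemma contour_integral_unit_circle:
  assumes "continuous_on (sphere 0 1) f"
  shows "contour_integral (circlepath 0 1) f = 2 * of_real pi * \<i> * (\<integral>t. f (cis t) * cis t \<partial>circ)"
proof -
  have c: "continuous_on UNIV (\<lambda>t. f (cis t) * cis t)"
    by (intro continuous_intros continuous_on_compose2[OF assms]) auto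
  have "contour_integral (circlepath 0 1) f = integral {0..2*pi} (\<lambda>t. f (cis t) * \<i> * cis t)"
    unfolding circlepath_def by (subst contour_integral_part_circlepath_eq) auto
  also have "\<dots> = integral {0..2*pi} (\<lambda>t. \<i> * (f (cis t) * cis t))" by (simp add: mult_ac)
  also have "\<dots> = \<i> * integral {0..2*pi} (\<lambda>t. f (cis t) * cis t)" by (rule integral_mult_right)
  finally show ?thesis
    by (simp add: integral_circ_HK[OF c] scaleR_conv_of_real)
qed

lemma Cauchy_derivative_circ:
  assumes "continuous_on (cball 0 1) \<Phi>" "\<Phi> holomorphic_on ball 0 1" "norm z < 1"
  shows "(\<Phi> has_field_derivative (\<integral>t. \<Phi> (cis t) / (cis t - z)^2 * cis t \<partial>circ)) (at z)"
proof -
  have "(\<Phi> has_field_derivative (1 / (2 * of_real pi * \<i>) * contour_integral (circlepath 0 1) (\<lambda>u. \<Phi> u / (u-z)^2))) (at z)"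
    using assms by (intro Cauchy_derivative_integral_circlepath) auto
  moreover have "continuous_on (sphere 0 1) (\<lambda>u. \<Phi> u / (u-z)^2)"
    using assms(3) by (intro continuous_intros continuous_on_subset[OF assms(1)]) auto
  ultimately show ?thesis by (simp add: contour_integral_unit_circle)
qed

text \<open>Both squares expand to \<open>1 + r^2 - 2 * r * Re (a * cnj b)\<close>. Dividing by
  \<open>r\<close> gives the distance from a point of the circle to the reflected pole
  \<open>b / r\<close>.\<close>

lemma norm_diff_reflected:
  assumes "norm a = 1" "norm b = 1"
  shows "norm (complex_of_real r * a - b) = norm (a - complex_of_real r * b)"
proof -
  have "(norm (complex_of_real r * a - b))^2 = (norm (a - complex_of_real r * b))^2"
  proof -
    have "(Re a)^2 + (Im a)^2 = 1" "(Re b)^2 + (Im b)^2 = 1"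
      using assms by (simp_all flip: cmod_power2)
    then show ?thesis by (simp add: cmod_power2) algebra
  qed
  then show ?thesis by simp
qed

text \<open>With \<open>p\<close>, \<open>q\<close> the differences to the inner and the reflected
  pole, the kernel is \<open>(q - p) * (p + q) / (p^2 * q^2)\<close>. The poles are
  \<open>(1 - r^2) / r\<close> apart and \<open>q\<close> has modulus \<open>x / r\<close>, which
  yields \<open>(1 - r^2) * (1 + r) / x^3\<close>. For the second bound, moving the inner pole out
  to \<open>\<zeta>0\<close> costs \<open>1 - r \<le> x\<close>.\<close>

lemma double_pole_kernel_bound:
  fixes \<zeta> \<zeta>0 :: complex
  assumes t: "norm \<zeta> = 1" "norm \<zeta>0 = 1" and r: "0 < r" "r < 1"
  defines "x \<equiv> norm (\<zeta> - of_real r * \<zeta>0)"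
  shows "norm (1 / (\<zeta> - of_real r * \<zeta>0)^2 - 1 / (\<zeta> - \<zeta>0 / of_real r)^2) \<le> 2 * (1 - r^2) / x^3"
    and "norm (\<zeta> - \<zeta>0) \<le> 2 * x" and "0 < x"
proof -
  have "norm (of_real r * \<zeta>0) = r" using t r by (simp add: norm_mult)
  then have "1 - r \<le> x"
    unfolding x_def using norm_triangle_ineq2[of \<zeta> "of_real r * \<zeta>0"] t by simp
  then show x: "0 < x" using r by simp
  have "norm (\<zeta> - \<zeta>0) \<le> x + norm (of_real r * \<zeta>0 - \<zeta>0)"
    unfolding x_def by (rule norm_diff_triangle_le[OF order_refl order_refl])
  also have "of_real r * \<zeta>0 - \<zeta>0 = of_real (r - 1) * \<zeta>0" by (simp add: algebra_simps)
  also have "norm \<dots> = 1 - r" using t r by (simp add: norm_mult del: of_real_diff)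
  finally show "norm (\<zeta> - \<zeta>0) \<le> 2 * x" using \<open>1 - r \<le> x\<close> by simp
  have xr: "norm (\<zeta> - \<zeta>0 / of_real r) = x / r"
  proof -
    have "\<zeta> - \<zeta>0 / of_real r = (of_real r * \<zeta> - \<zeta>0) / of_real r"
      using r by (simp add: field_simps)
    then show ?thesis
      using norm_diff_reflected[OF t, of r] r by (simp add: norm_divide x_def)
  qed
  have zw: "norm (of_real r * \<zeta>0 - \<zeta>0 / of_real r) = (1 - r^2) / r"
  proof -
    have "of_real r * \<zeta>0 - \<zeta>0 / of_real r = of_real ((r^2 - 1) / r) * \<zeta>0"
      using r by (simp add: field_simps power2_eq_square)
    moreover have "r^2 < 1" using r by (simp add: power_less_one_iff)
    ultimately show ?thesis
      using t r by (simp add: norm_mult abs_divide del: of_real_divide of_real_diff of_real_power)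
  qed
  have nz: "\<zeta> - of_real r * \<zeta>0 \<noteq> 0" "\<zeta> - \<zeta>0 / of_real r \<noteq> 0"
    using x xr r unfolding x_def by auto
  have "1 / (\<zeta> - of_real r * \<zeta>0)^2 - 1 / (\<zeta> - \<zeta>0 / of_real r)^2
      = (of_real r * \<zeta>0 - \<zeta>0 / of_real r) * ((\<zeta> - of_real r * \<zeta>0) + (\<zeta> - \<zeta>0 / of_real r))
        / ((\<zeta> - of_real r * \<zeta>0)^2 * (\<zeta> - \<zeta>0 / of_real r)^2)"
  proof -
    have "1 / p^2 - 1 / q^2 = (q - p) * (p + q) / (p^2 * q^2)" if "p \<noteq> 0" "q \<noteq> 0" for p q :: complex
      using that by (simp add: field_simps power2_eq_square)
    from this[OF nz] show ?thesis by simp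
  qed
  also have "norm \<dots> \<le> ((1 - r^2) / r) * (x + x / r) / (x^2 * (x/r)^2)"
  proof -
    have "norm ((\<zeta> - of_real r * \<zeta>0) + (\<zeta> - \<zeta>0 / of_real r)) \<le> x + x / r"
      using norm_triangle_ineq[of "\<zeta> - of_real r * \<zeta>0" "\<zeta> - \<zeta>0 / of_real r"] xr by (simp add: x_def)
    moreover have "0 \<le> (1 - r^2) / r" using r by (simp add: power_le_one)
    ultimately show ?thesis
      unfolding norm_mult norm_divide norm_power zw xr x_def[symmetric]
      by (intro divide_right_mono mult_left_mono mult_mono) (auto simp: x_def)
  qed
  also have "\<dots> = (1 - r^2) * (1 + r) / x^3"
    using r x by (simp add: divide_simps) (simp add: algebra_simps power2_eq_square power3_eq_cube power4_eq_xxxx)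
  also have "\<dots> \<le> (1 - r^2) * 2 / x^3"
    using r x by (intro divide_right_mono mult_left_mono) (auto simp: power_le_one)
  finally show "norm (1 / (\<zeta> - of_real r * \<zeta>0)^2 - 1 / (\<zeta> - \<zeta>0 / of_real r)^2) \<le> 2 * (1 - r^2) / x^3"
    by (simp add: mult.commute)
qed

text \<open>The reflected term may be subtracted because its pole lies outside the closed disk: its
  integral is the mean of a function that is holomorphic inside and vanishes at the origin thanks to
  the factor \<open>u\<close>.\<close>

lemma derivative_reflected_kernel:
  assumes cont: "continuous_on (cball 0 1) \<Psi>" and hol: "\<Psi> holomorphic_on ball 0 1"
    and der: "(\<Psi> has_field_derivative D) (at (of_real r * cis s))" and r: "0 < r" "r < 1"
  shows "D = (\<integral>t. \<Psi> (cis t) * (1 / (cis t - of_real r * cis s)^2 - 1 / (cis t - cis s / of_real r)^2) * cis t \<partial>circ)"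
proof -
  have nz: "norm (of_real r * cis s) < 1" using r by (simp add: norm_mult)
  have nw: "norm (cis s / of_real r) > 1" using r by (simp add: norm_divide)
  have nz1: "cis t - of_real r * cis s \<noteq> 0" for t by (rule cis_minus_nonzero[OF nz])
  have nw1: "u - cis s / of_real r \<noteq> 0" if "u \<in> cball 0 1" for u
    using nw that by auto
  have nw2: "cis t - cis s / of_real r \<noteq> 0" for t by (rule nw1) simp
  have "D = (\<integral>t. \<Psi> (cis t) / (cis t - of_real r * cis s)^2 * cis t \<partial>circ)"
    using DERIV_unique[OF der Cauchy_derivative_circ[OF cont hol nz]] .
  moreover have "(\<integral>t. \<Psi> (cis t) / (cis t - cis s / of_real r)^2 * cis t \<partial>circ) = 0"
  proof -
    have "continuous_on (cball 0 1) (\<lambda>u. \<Psi> u / (u - cis s / of_real r)^2 * u)"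
      by (intro continuous_intros cont) (use nw1 in auto)
    moreover have "(\<lambda>u. \<Psi> u / (u - cis s / of_real r)^2 * u) holomorphic_on ball 0 1"
      by (intro holomorphic_intros hol) (use nw1 in auto)
    ultimately show ?thesis using mean_value_circ by fastforce
  qed
  moreover have "integrable circ (\<lambda>t. \<Psi> (cis t) / (cis t - of_real r * cis s)^2 * cis t)"
    by (intro integrable_circ_continuous continuous_intros continuous_cis_comp[OF cont]) (use nz1 in auto)
  moreover have "integrable circ (\<lambda>t. \<Psi> (cis t) / (cis t - cis s / of_real r)^2 * cis t)"
    by (intro integrable_circ_continuous continuous_intros continuous_cis_comp[OF cont]) (use nw2 in auto)
  ultimately have "D = (\<integral>t. \<Psi> (cis t) / (cis t - of_real r * cis s)^2 * cis t - \<Psi> (cis t) / (cis t - cis s / of_real r)^2 * cis t \<partial>circ)"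
    by (subst Bochner_Integration.integral_diff) auto
  then show ?thesis by (simp add: algebra_simps divide_inverse)
qed

lemma cis_eq_imp_eq:
  assumes "t \<in> {0..2*pi}" "s \<in> {0<..<2*pi}" "cis t = cis s"
  shows "t = s"
proof -
  from assms(3) have "cis (t - s) = 1" by (simp flip: cis_divide)
  then have "cos (t - s) = 1" by (simp add: complex_eq_iff)
  then obtain n :: int where n: "t - s = 2 * pi * n" by (auto simp: cos_one_2pi_int)
  have "\<bar>t - s\<bar> < 2 * pi" using assms by auto
  then have "2 * pi * \<bar>real_of_int n\<bar> < 2 * pi * 1" unfolding n by (simp add: abs_mult)
  then have "\<bar>real_of_int n\<bar> < 1" by (subst (asm) mult_less_cancel_left_pos) auto
  then have "n = 0" by linarith
  with n show ?thesis by simp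
qed

text \<open>The reflected pole \<open>cis s / r\<close> makes the kernel decay like the Poisson kernel
  divided by \<open>\<bar>\<zeta> - \<zeta>\<^sub>0\<bar>\<close>; the plain Cauchy kernel for the derivative would lose a logarithm.\<close>

lemma radial_limit_of_boundary_derivative:
  assumes cont: "continuous_on (cball 0 1) \<Phi>"
    and der: "\<And>z. z \<in> ball 0 1 \<Longrightarrow> (\<Phi> has_field_derivative F z) (at z)"
    and s: "s \<in> {0<..<2*pi}"
    and bd: "((\<lambda>t. \<Phi> (cis t)) has_vector_derivative (\<i> * cis s * a)) (at s)"
  shows "radial_limit F s a"
proof -
  \<comment> \<open>Without its first-order part at \<open>cis s\<close> the primitive is of smaller
    order than \<open>cis t - cis s\<close> on the circle, and its derivative is
    \<open>F - a\<close>; it remains to send that derivative to 0 along the radius.\<close>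
  define \<Psi> where "\<Psi> u = \<Phi> u - \<Phi> (cis s) - a * (u - cis s)" for u
  have cont': "continuous_on (cball 0 1) \<Psi>"
    unfolding \<Psi>_def[abs_def] by (intro continuous_intros cont)
  have der': "(\<Psi> has_field_derivative (F z - a)) (at z)" if "z \<in> ball 0 1" for z
    unfolding \<Psi>_def[abs_def] by (auto intro!: derivative_eq_intros der[OF that])
  have hol: "\<Psi> holomorphic_on ball 0 1"
    unfolding holomorphic_on_open[OF open_ball] using der' by blast
  have cisd: "(cis has_vector_derivative (\<i> * cis s)) (at s)"
    unfolding has_vector_derivative_def by (rule has_derivative_cis[OF has_derivative_ident])
  have "((\<lambda>t. \<Psi> (cis t)) has_vector_derivative (\<i> * cis s * a - 0 - a * (\<i> * cis s - 0))) (at s)"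
    unfolding \<Psi>_def by (intro has_vector_derivative_diff has_vector_derivative_const bd
        has_vector_derivative_mult_right cisd)
  then have \<Psi>d: "((\<lambda>t. \<Psi> (cis t)) has_derivative (\<lambda>h. h *\<^sub>R 0)) (at s)"
    by (simp add: has_vector_derivative_def mult.commute)
  have \<Psi>0: "\<Psi> (cis s) = 0" by (simp add: \<Psi>_def)
  \<comment> \<open>The factor 2 converts angles to chords:
    \<open>\<bar>t - s\<bar> \<le> 2 * norm (cis t - cis s)\<close> close to
    \<open>s\<close>.\<close>
  have near: "\<exists>d>0. \<forall>t. \<bar>t - s\<bar> < d \<longrightarrow> norm (\<Psi> (cis t)) \<le> 2 * e * norm (cis t - cis s)" if e: "e > 0" for e
  proof -
    from \<Psi>d e obtain d1 where d1: "d1 > 0" "\<And>t. norm (t - s) < d1 \<Longrightarrow> norm (\<Psi> (cis t) - \<Psi> (cis s) - (t - s) *\<^sub>R 0) \<le> e * norm (t - s)"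
      unfolding has_derivative_at_alt by blast
    from cisd obtain d2 where d2: "d2 > 0" "\<And>t. norm (t - s) < d2 \<Longrightarrow> norm (cis t - cis s - (t - s) *\<^sub>R (\<i> * cis s)) \<le> (1/2) * norm (t - s)"
      unfolding has_vector_derivative_def has_derivative_at_alt by (metis half_gt_zero_iff zero_less_one)
    show ?thesis
    proof (intro exI[of _ "min d1 d2"] conjI allI impI)
      fix t assume t: "\<bar>t - s\<bar> < min d1 d2"
      have "norm ((t - s) *\<^sub>R (\<i> * cis s)) = \<bar>t - s\<bar>" by (simp add: norm_mult)
      then have "\<bar>t - s\<bar> \<le> norm (cis t - cis s) + norm (cis t - cis s - (t - s) *\<^sub>R (\<i> * cis s))"
        using norm_triangle_ineq4[of "cis t - cis s" "cis t - cis s - (t - s) *\<^sub>R (\<i> * cis s)"]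
        by (simp add: norm_mult)
      also have "\<dots> \<le> norm (cis t - cis s) + (1/2) * \<bar>t - s\<bar>" using d2(2)[of t] t by simp
      finally have le: "\<bar>t - s\<bar> \<le> 2 * norm (cis t - cis s)" by simp
      have "norm (\<Psi> (cis t)) \<le> e * \<bar>t - s\<bar>" using d1(2)[of t] t \<Psi>0 by simp
      also have "\<dots> \<le> e * (2 * norm (cis t - cis s))" using le e by (intro mult_left_mono) auto
      finally show "norm (\<Psi> (cis t)) \<le> 2 * e * norm (cis t - cis s)" by simp
    qed (use d1 d2 in auto)
  qed
  \<comment> \<open>The exponent 3 is chosen to cancel the \<open>x^3\<close> in the kernel bound,
    so that the part away from \<open>s\<close> keeps only the vanishing factor
    \<open>1 - r^2\<close>.\<close>
  have glob: "\<exists>B\<ge>0. \<forall>t\<in>{0..2*pi}. norm (\<Psi> (cis t)) \<le> 2 * e * norm (cis t - cis s) + B * (norm (cis t - cis s))^3" if e: "e > 0" for e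
  proof -
    obtain d where d: "d > 0" "\<And>t. \<bar>t - s\<bar> < d \<Longrightarrow> norm (\<Psi> (cis t)) \<le> 2 * e * norm (cis t - cis s)"
      using near[OF e] by blast
    define T where "T = {0..2*pi} - ball s d"
    have "compact T" unfolding T_def by (intro compact_diff) auto
    moreover have "continuous_on T (\<lambda>t. norm (\<Psi> (cis t)) / (norm (cis t - cis s))^3)"
    proof (intro continuous_intros)
      show "continuous_on T (\<lambda>t. \<Psi> (cis t))"
        by (rule continuous_on_subset[OF continuous_cis_comp[OF cont']]) simp
      show "\<forall>t\<in>T. (norm (cis t - cis s))^3 \<noteq> 0"
        using cis_eq_imp_eq[OF _ s] \<open>d > 0\<close> by (fastforce simp: T_def)
    qed
    ultimately have "bounded ((\<lambda>t. norm (\<Psi> (cis t)) / (norm (cis t - cis s))^3) ` T)"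
      by (intro compact_imp_bounded compact_continuous_image)
    then obtain B where B: "\<And>t. t \<in> T \<Longrightarrow> \<bar>norm (\<Psi> (cis t)) / (norm (cis t - cis s))^3\<bar> \<le> B"
      unfolding bounded_iff by auto
    show ?thesis
    proof (intro exI[of _ "\<bar>B\<bar>"] conjI ballI)
      fix t assume t: "t \<in> {0..2*pi}"
      show "norm (\<Psi> (cis t)) \<le> 2 * e * norm (cis t - cis s) + \<bar>B\<bar> * (norm (cis t - cis s))^3"
      proof (cases "t \<in> T")
        case False
        then have "\<bar>t - s\<bar> < d" using t by (auto simp: T_def dist_real_def)
        from d(2)[OF this] show ?thesis by (simp add: add_increasing2)
      next
        case True
        then have "cis t \<noteq> cis s" using cis_eq_imp_eq[OF t s] \<open>d > 0\<close> by (auto simp: T_def)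
        then have "norm (\<Psi> (cis t)) \<le> \<bar>B\<bar> * (norm (cis t - cis s))^3"
          using order_trans[OF B[OF True] abs_ge_self] by (simp add: divide_le_eq)
        then show ?thesis using e by (simp add: add_increasing)
      qed
    qed auto
  qed
  \<comment> \<open>After inserting \<open>y \<le> 2 * x\<close> and the kernel bound, the linear
    term is \<open>8 * e\<close> times the Poisson kernel, which has mean 1, and the cubic term is
    the constant \<open>16 * B * (1 - r^2)\<close>.\<close>
  have est: "\<exists>B\<ge>0. \<forall>r. 0 < r \<and> r < 1 \<longrightarrow> norm (F (of_real r * cis s) - a) \<le> 8 * e + 16 * B * (1 - r^2)" if e: "e > 0" for e
  proof -
    obtain B where B: "B \<ge> 0" "\<And>t. t \<in> {0..2*pi} \<Longrightarrow> norm (\<Psi> (cis t)) \<le> 2 * e * norm (cis t - cis s) + B * (norm (cis t - cis s))^3"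
      using glob[OF e] by blast
    show ?thesis
    proof (intro exI[of _ B] conjI allI impI B(1))
      fix r :: real assume "0 < r \<and> r < 1"
      then have r: "0 < r" "r < 1" by auto
      define K where "K t = \<Psi> (cis t) * (1 / (cis t - of_real r * cis s)^2 - 1 / (cis t - cis s / of_real r)^2) * cis t" for t
      have nz: "norm (of_real r * cis s) < 1" using r by (simp add: norm_mult)
      then have zb: "of_real r * cis s \<in> ball 0 1" by simp
      have "F (of_real r * cis s) - a = (\<integral>t. K t \<partial>circ)"
        unfolding K_def by (rule derivative_reflected_kernel[OF cont' hol der'[OF zb] r])
      also have "norm \<dots> \<le> (\<integral>t. norm (K t) \<partial>circ)" by (rule integral_norm_bound)
      also have "\<dots> \<le> (\<integral>t. 8 * e * Re (herglotz (of_real r * cis s) t) + 16 * B * (1 - r^2) \<partial>circ)"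
      proof (rule integral_mono_AE)
        have "cis t - cis s / of_real r \<noteq> 0" for t
        proof
          assume "cis t - cis s / of_real r = 0"
          then have "norm (cis t) = norm (cis s / of_real r)" by simp
          with r show False by (simp add: norm_divide)
        qed
        then show "integrable circ (\<lambda>t. norm (K t))" unfolding K_def
          by (intro integrable_circ_continuous continuous_intros continuous_cis_comp[OF cont'])
             (use cis_minus_nonzero[OF nz] in auto)
        show "integrable circ (\<lambda>t. 8 * e * Re (herglotz (of_real r * cis s) t) + 16 * B * (1 - r^2))"
          by (intro integrable_circ_continuous continuous_intros continuous_herglotz nz)
        have "AE t in circ. t \<in> {0<..<2*pi}" by (rule AE_circ_open_interval)
        then show "AE t in circ. norm (K t) \<le> 8 * e * Re (herglotz (of_real r * cis s) t) + 16 * B * (1 - r^2)"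
        proof eventually_elim
          case (elim t)
          define x where "x = norm (cis t - of_real r * cis s)"
          define y where "y = norm (cis t - cis s)"
          define k where "k = 2 * (1 - r^2)"
          have k: "k \<ge> 0" using r by (simp add: k_def power_le_one)
          have kb: "norm (1 / (cis t - of_real r * cis s)^2 - 1 / (cis t - cis s / of_real r)^2) \<le> k / x^3"
            and yx: "y \<le> 2 * x" and x: "x > 0"
            unfolding x_def y_def k_def using double_pole_kernel_bound[of "cis t" "cis s" r] r by auto
          have y: "y \<ge> 0" by (simp add: y_def)
          have P: "Re (herglotz (of_real r * cis s) t) = (1 - r^2) / x^2"
            using r by (subst Re_herglotz[OF nz]) (simp add: x_def norm_mult)
          have "norm (K t) \<le> (2 * e * y + B * y^3) * (k / x^3)"
          proof -
            have "norm (\<Psi> (cis t)) \<le> 2 * e * y + B * y^3" using B(2)[of t] elim by (simp add: y_def)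
            then have "norm (\<Psi> (cis t)) * norm (1 / (cis t - of_real r * cis s)^2 - 1 / (cis t - cis s / of_real r)^2)
                \<le> (2 * e * y + B * y^3) * (k / x^3)"
              using kb e B(1) y by (intro mult_mono add_nonneg_nonneg mult_nonneg_nonneg) auto
            then show ?thesis by (simp only: K_def norm_mult norm_cis mult_1_right)
          qed
          also have "\<dots> \<le> (2 * e * (2 * x) + B * (2*x)^3) * (k / x^3)"
            using e B(1) k x y yx by (intro mult_right_mono add_mono mult_left_mono power_mono) auto
          also have "\<dots> = 4 * e * k / x^2 + 8 * B * k"
            using x by (simp add: field_simps power2_eq_square power3_eq_cube)
          also have "\<dots> = 8 * e * Re (herglotz (of_real r * cis s) t) + 16 * B * (1 - r^2)"
            unfolding P by (simp add: k_def algebra_simps flip: add_divide_distrib)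
          finally show ?case .
        qed
      qed
      also have "\<dots> = 8 * e + 16 * B * (1 - r^2)"
        by (subst Bochner_Integration.integral_add)
           (auto simp: integral_Re_herglotz[OF nz] intro!: integrable_circ_continuous continuous_intros continuous_herglotz nz)
      finally show "norm (F (of_real r * cis s) - a) \<le> 8 * e + 16 * B * (1 - r^2)" .
    qed
  qed
  show ?thesis
    unfolding radial_limit_def tendsto_iff dist_norm
  proof (intro allI impI)
    fix \<epsilon> :: real assume \<epsilon>: "\<epsilon> > 0"
    obtain B where B: "\<And>r. 0 < r \<and> r < 1 \<Longrightarrow> norm (F (of_real r * cis s) - a) \<le> 8 * (\<epsilon>/16) + 16 * B * (1 - r^2)"
      using est[of "\<epsilon>/16"] \<epsilon> by auto
    have "((\<lambda>r::real. 8 * (\<epsilon>/16) + 16 * B * (1 - r^2)) \<longlongrightarrow> 8 * (\<epsilon>/16) + 16 * B * (1 - 1^2)) (at_left 1)"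
      by (intro tendsto_intros)
    then have "\<forall>\<^sub>F r in at_left 1. 8 * (\<epsilon>/16) + 16 * B * (1 - r^2) < \<epsilon>"
      by (rule order_tendstoD(2)) (use \<epsilon> in auto)
    moreover have "\<forall>\<^sub>F r in at_left (1::real). 0 < r \<and> r < 1"
      by (auto simp: eventually_at_left_field intro!: exI[of _ 0])
    ultimately show "\<forall>\<^sub>F r in at_left 1. norm (F (of_real r * cis s) - a) < \<epsilon>"
      by eventually_elim (use B in force)
  qed
qed

text \<open>The form of Lebesgue's differentiation theorem applied here is one-sided, to the right.
  The left derivative at \<open>s\<close> comes from the reflected function
  \<open>\<lambda>x. G (- x)\<close> at \<open>- s\<close>, which is why the exceptional set
  contains a reflected null set.\<close>

lemma has_vector_derivative_AE_integral:
  fixes G :: "real \<Rightarrow> 'a::euclidean_space"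
  assumes G: "integrable lborel G"
    and \<Gamma>: "\<And>s t. a \<le> s \<Longrightarrow> s \<le> t \<Longrightarrow> t \<le> b \<Longrightarrow> \<Gamma> t - \<Gamma> s = integral {s..t} G"
  shows "AE s in lborel. s \<in> {a<..<b} \<longrightarrow> (\<Gamma> has_vector_derivative G s) (at s)"
proof -
  have int: "H integrable_on cbox c d" if "integrable lborel H" for H :: "real \<Rightarrow> 'a" and c d
    using set_borel_integral_eq_integral(1)[of "cbox c d" H] integrable_mult_indicator[OF _ that, of "cbox c d"]
    by (auto simp: set_integrable_def)
  have G': "integrable lborel (\<lambda>x. G (- x))"
    using lborel_integrable_real_affine[OF G, of "-1" 0] by simp
  obtain N where N: "negligible N"
    "\<And>x e. \<lbrakk>x \<notin> N; 0 < e\<rbrakk> \<Longrightarrow> \<exists>d>0. \<forall>h. 0 < h \<and> h < d \<longrightarrow> norm (integral (cbox x (x + h)) G /\<^sub>R h - G x) < e"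
    using integrable_ccontinuous_explicit[of G] int[OF G] by auto
  obtain N' where N': "negligible N'"
    "\<And>x e. \<lbrakk>x \<notin> N'; 0 < e\<rbrakk> \<Longrightarrow> \<exists>d>0. \<forall>h. 0 < h \<and> h < d \<longrightarrow> norm (integral (cbox x (x + h)) (\<lambda>x. G (- x)) /\<^sub>R h - G (- x)) < e"
    using integrable_ccontinuous_explicit[of "\<lambda>x. G (- x)"] int[OF G'] by auto
  have "negligible (N \<union> uminus ` N')"
    using N(1) negligible_differentiable_image_negligible[OF order_refl N'(1), of uminus]
    by (auto intro!: derivative_intros)
  then have "AE s in lebesgue. s \<notin> N \<union> uminus ` N'"
    by (intro AE_not_in) (simp add: negligible_iff_null_sets)
  then have "AE s in lborel. s \<notin> N \<union> uminus ` N'" by (simp add: AE_completion_iff)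
  then show ?thesis
  proof (eventually_elim, intro impI)
    fix s assume s: "s \<notin> N \<union> uminus ` N'" "s \<in> {a<..<b}"
    then have sN: "s \<notin> N" "- s \<notin> N'" by (auto simp: image_iff)
    show "(\<Gamma> has_vector_derivative G s) (at s)"
      unfolding has_vector_derivative_def has_derivative_at_alt
    proof (intro conjI allI impI bounded_linear_scaleR_left)
      fix e :: real assume e: "e > 0"
      obtain d1 where d1: "d1 > 0" "\<And>h. 0 < h \<Longrightarrow> h < d1 \<Longrightarrow> norm (integral (cbox s (s + h)) G /\<^sub>R h - G s) < e"
        using N(2)[OF sN(1) e] by blast
      obtain d2 where d2: "d2 > 0" "\<And>h. 0 < h \<Longrightarrow> h < d2 \<Longrightarrow> norm (integral (cbox (-s) (-s + h)) (\<lambda>x. G (- x)) /\<^sub>R h - G s) < e"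
        using N'(2)[OF sN(2) e] by auto
      define d where "d = Min {d1, d2, s - a, b - s}"
      have d: "d > 0" "d \<le> d1" "d \<le> d2" "d \<le> s - a" "d \<le> b - s"
        using d1 d2 s unfolding d_def by auto
      have scale: "norm (I - h *\<^sub>R v) \<le> e * h" if "0 < h" "norm (I /\<^sub>R h - v) < e" for I v :: 'a and h
      proof -
        have "norm (I - h *\<^sub>R v) = norm (h *\<^sub>R (I /\<^sub>R h - v))" using that by (simp add: scaleR_diff_right)
        also have "\<dots> \<le> e * h" using that by (simp add: mult.commute)
        finally show ?thesis .
      qed
      show "\<exists>d>0. \<forall>y. norm (y - s) < d \<longrightarrow> norm (\<Gamma> y - \<Gamma> s - (y - s) *\<^sub>R G s) \<le> e * norm (y - s)"
      proof (intro exI[of _ d] conjI allI impI d(1))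
        fix y assume y: "norm (y - s) < d"
        consider "y = s" | "y > s" | "y < s" by linarith
        then show "norm (\<Gamma> y - \<Gamma> s - (y - s) *\<^sub>R G s) \<le> e * norm (y - s)"
        proof cases
          case 2
          then have "\<Gamma> y - \<Gamma> s = integral {s..y} G" using y d s by (intro \<Gamma>) auto
          moreover have "norm (integral {s..y} G - (y - s) *\<^sub>R G s) \<le> e * (y - s)"
            using d1(2)[of "y - s"] 2 y d by (intro scale) auto
          ultimately show ?thesis using 2 by simp
        next
          case 3
          then have "\<Gamma> s - \<Gamma> y = integral {y..s} G" using y d s by (intro \<Gamma>) auto
          moreover have "integral {y..s} G = integral (cbox (-s) (-s + (s - y))) (\<lambda>x. G (- x))"
            using integral_reflect_real[of s y G] by simp
          moreover have "norm (integral (cbox (-s) (-s + (s - y))) (\<lambda>x. G (- x)) - (s - y) *\<^sub>R G s) \<le> e * (s - y)"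
            using d2(2)[of "s - y"] 3 y d by (intro scale) auto
          ultimately have "norm (\<Gamma> s - \<Gamma> y - (s - y) *\<^sub>R G s) \<le> e * (s - y)" by metis
          moreover have "norm (\<Gamma> y - \<Gamma> s - (y - s) *\<^sub>R G s) = norm (\<Gamma> s - \<Gamma> y - (s - y) *\<^sub>R G s)"
            by (subst norm_minus_cancel[symmetric]) (simp add: algebra_simps)
          ultimately show ?thesis using 3 by simp
        qed simp
      qed
    qed
  qed
qed

theorem Fatou_Hinf:
  assumes F: "F \<in> Hinf"
  shows "AE t in circ. \<exists>L. radial_limit F t L"
proof -
  note Fc = Hinf_continuous[OF F]
  obtain M where M: "M \<ge> 0" "\<And>z. norm z < 1 \<Longrightarrow> norm (F z) \<le> M" using Hinf_bound[OF F] by blast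
  obtain \<rho> g where \<rho>: "\<And>n. 0 \<le> \<rho> n" "\<And>n. \<rho> n < 1" "\<rho> \<longlonglongrightarrow> 1"
    and g [measurable]: "g \<in> borel_measurable borel"
    and lim: "AE t in circ. (\<lambda>n. F (complex_of_real (\<rho> n) * cis t)) \<longlonglongrightarrow> g t"
    using Hinf_radial_subseq[OF F] by blast
  obtain \<Phi> where cont: "continuous_on (cball 0 1) \<Phi>"
    and der: "\<And>z. z \<in> ball 0 1 \<Longrightarrow> (\<Phi> has_field_derivative F z) (at z)"
    using Hinf_primitive_extends[OF F] by blast
  define H where "H n t = \<i> * of_real (\<rho> n) * cis t * F (complex_of_real (\<rho> n) * cis t)" for n t
  define G where "G t = indicator {0..2*pi} t *\<^sub>R (\<i> * cis t * g t)" for t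
  have Hc: "continuous_on UNIV (H n)" for n
    unfolding H_def[abs_def] by (intro continuous_intros continuous_radial[OF Fc] \<rho>)
  have [measurable]: "H n \<in> borel_measurable borel" for n
    by (rule borel_measurable_continuous_onI[OF Hc])
  have [measurable]: "cis \<in> borel_measurable borel"
    by (intro borel_measurable_continuous_onI continuous_intros)
  have Hle: "norm (H n t) \<le> M" for n t
  proof -
    have "\<rho> n * norm (F (complex_of_real (\<rho> n) * cis t)) \<le> 1 * M"
      using \<rho>(1,2)[of n] M by (intro mult_mono) (auto simp: norm_mult)
    then show ?thesis using \<rho>(1) by (simp add: H_def norm_mult)
  qed
  have HG: "AE t in lborel. (\<lambda>n. indicator {0..2*pi} t *\<^sub>R H n t) \<longlonglongrightarrow> G t"
    using lim[unfolded AE_circ]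
  proof eventually_elim
    case (elim t)
    show ?case
    proof (cases "t \<in> {0..2*pi}")
      case True
      then have "(\<lambda>n. H n t) \<longlonglongrightarrow> \<i> * of_real 1 * cis t * g t"
        unfolding H_def using elim by (intro tendsto_intros \<rho>) auto
      then show ?thesis using True by (simp add: G_def)
    qed (simp add: G_def)
  qed
  have bint: "integrable lborel (\<lambda>t. M * indicator {0..2*pi} t)" by simp
  have bd: "AE t in lborel. norm (indicator {0..2*pi} t *\<^sub>R H n t) \<le> M * indicator {0..2*pi} t" for n
    using Hle by (auto simp: indicator_def)
  have [measurable]: "G \<in> borel_measurable borel" unfolding G_def[abs_def] by measurable
  have Gint: "integrable lborel G"
    by (rule integrable_dominated_convergence[OF _ _ bint HG bd]) measurable
  \<comment> \<open>On the circle of radius \<open>\<rho> n\<close> this is the fundamental theorem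
    of calculus; dominated convergence carries it to the unit circle, where the sequential limit
    \<open>g\<close> enters through \<open>G\<close>.\<close>
  have \<Gamma>: "\<Phi> (cis t) - \<Phi> (cis s) = integral {s..t} G" if st: "0 \<le> s" "s \<le> t" "t \<le> 2*pi" for s t
  proof -
    have eq: "\<Phi> (of_real (\<rho> n) * cis t) - \<Phi> (of_real (\<rho> n) * cis s)
              = (LINT x|lborel. indicator {s..t} x *\<^sub>R indicator {0..2*pi} x *\<^sub>R H n x)" for n
    proof -
      have "(H n has_integral (\<Phi> (of_real (\<rho> n) * cis t) - \<Phi> (of_real (\<rho> n) * cis s))) {s..t}"
      proof (rule fundamental_theorem_of_calculus[OF st(2)])
        fix x
        have "norm (of_real (\<rho> n) * cis x) < 1" using \<rho>(1,2)[of n] by (simp add: norm_mult)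
        then have "(\<Phi> has_field_derivative F (of_real (\<rho> n) * cis x)) (at (of_real (\<rho> n) * cis x))"
          by (intro der) simp
        moreover have "((\<lambda>x. of_real (\<rho> n) * cis x) has_vector_derivative (of_real (\<rho> n) * (\<i> * cis x))) (at x within {s..t})"
          by (rule has_vector_derivative_mult_right)
             (unfold has_vector_derivative_def, rule has_derivative_cis[OF has_derivative_ident])
        ultimately have "((\<Phi> \<circ> (\<lambda>x. of_real (\<rho> n) * cis x)) has_vector_derivative
            (of_real (\<rho> n) * (\<i> * cis x) * F (of_real (\<rho> n) * cis x))) (at x within {s..t})"
          by (intro field_vector_diff_chain_within) (auto intro: has_field_derivative_at_within)
        then show "((\<lambda>x. \<Phi> (of_real (\<rho> n) * cis x)) has_vector_derivative H n x) (at x within {s..t})"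
          by (simp add: o_def H_def mult_ac)
      qed
      then have "integral {s..t} (H n) = \<Phi> (of_real (\<rho> n) * cis t) - \<Phi> (of_real (\<rho> n) * cis s)"
        by (rule integral_unique)
      moreover have "set_integrable lborel {s..t} (H n)"
        by (rule borel_integrable_atLeastAtMost') (rule continuous_on_subset[OF Hc], simp)
      ultimately have "\<Phi> (of_real (\<rho> n) * cis t) - \<Phi> (of_real (\<rho> n) * cis s) = (LINT x:{s..t}|lborel. H n x)"
        by (simp add: set_borel_integral_eq_integral)
      also have "\<dots> = (LINT x|lborel. indicator {s..t} x *\<^sub>R indicator {0..2*pi} x *\<^sub>R H n x)"
        unfolding set_lebesgue_integral_def using st
        by (intro Bochner_Integration.integral_cong) (auto simp: indicator_def)
      finally show ?thesis .
    qed
    have "(\<lambda>n. LINT x|lborel. indicator {s..t} x *\<^sub>R indicator {0..2*pi} x *\<^sub>R H n x)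
          \<longlonglongrightarrow> (LINT x|lborel. indicator {s..t} x *\<^sub>R G x)"
    proof (rule integral_dominated_convergence[OF _ _ bint])
      show "AE x in lborel. (\<lambda>n. indicator {s..t} x *\<^sub>R indicator {0..2*pi} x *\<^sub>R H n x) \<longlonglongrightarrow> indicator {s..t} x *\<^sub>R G x"
        using HG by eventually_elim (intro tendsto_intros)
      show "AE x in lborel. norm (indicator {s..t} x *\<^sub>R indicator {0..2*pi} x *\<^sub>R H n x) \<le> M * indicator {0..2*pi} x" for n
        using Hle M by (auto simp: indicator_def)
    qed measurable
    moreover have "set_integrable lborel {s..t} G"
      unfolding set_integrable_def by (rule integrable_mult_indicator[OF _ Gint]) simp
    then have "(LINT x|lborel. indicator {s..t} x *\<^sub>R G x) = integral {s..t} G"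
      using set_borel_integral_eq_integral(2) unfolding set_lebesgue_integral_def by blast
    moreover have "(\<lambda>n. \<Phi> (of_real (\<rho> n) * cis t) - \<Phi> (of_real (\<rho> n) * cis s)) \<longlonglongrightarrow> \<Phi> (cis t) - \<Phi> (cis s)"
    proof -
      have "(\<lambda>n. \<Phi> (of_real (\<rho> n) * cis x)) \<longlonglongrightarrow> \<Phi> (cis x)" for x
      proof (rule continuous_on_tendsto_compose[OF cont])
        have "(\<lambda>n. of_real (\<rho> n) * cis x) \<longlonglongrightarrow> of_real 1 * cis x" by (intro tendsto_intros \<rho>)
        then show "(\<lambda>n. of_real (\<rho> n) * cis x) \<longlonglongrightarrow> cis x" by simp
        show "\<forall>\<^sub>F n in sequentially. of_real (\<rho> n) * cis x \<in> cball 0 1"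
          using \<rho>(1,2) by (auto simp: norm_mult intro!: always_eventually less_imp_le)
      qed simp
      then show ?thesis by (intro tendsto_diff)
    qed
    ultimately show ?thesis unfolding eq by (metis LIMSEQ_unique)
  qed
  have "AE s in lborel. s \<in> {0<..<2*pi} \<longrightarrow> ((\<lambda>t. \<Phi> (cis t)) has_vector_derivative G s) (at s)"
    by (rule has_vector_derivative_AE_integral[OF Gint \<Gamma>])
  then have "AE s in circ. s \<in> {0<..<2*pi} \<longrightarrow> ((\<lambda>t. \<Phi> (cis t)) has_vector_derivative G s) (at s)"
    unfolding AE_circ by eventually_elim auto
  with AE_circ_open_interval show ?thesis
  proof eventually_elim
    case (elim s)
    then have "((\<lambda>t. \<Phi> (cis t)) has_vector_derivative (\<i> * cis s * g s)) (at s)"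
      by (simp add: G_def)
    then show ?case
      using radial_limit_of_boundary_derivative[OF cont der] elim by blast
  qed
qed

section \<open>Boundary values and Herglotz integrals\<close>

definition radius :: "nat \<Rightarrow> real" where "radius n = 1 - inverse (real (Suc n))"

lemma radius_nonneg: "0 \<le> radius n" and radius_less: "radius n < 1"
  by (auto simp: radius_def inverse_le_1_iff)

lemma radius_LIMSEQ: "radius \<longlonglongrightarrow> 1"
  using LIMSEQ_inverse_real_of_nat_add_minus[of 1] by (simp add: radius_def[abs_def])

lemma radius_at_left: "filterlim radius (at_left 1) sequentially"
  by (rule tendsto_imp_filterlim_at_left[OF radius_LIMSEQ]) (auto simp: radius_less)

lemma norm_radius_cis: "norm (of_real (radius n) * cis t) < 1"
  using radius_nonneg[of n] radius_less[of n] by (simp add: norm_mult)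

lemma radius_mult_ball:
  fixes z :: complex
  assumes "norm z \<le> 1"
  shows "norm (of_real (radius n) * z) < 1"
proof -
  from assms have "radius n * norm z \<le> radius n * 1" using radius_nonneg[of n] by (intro mult_left_mono) auto
  then show ?thesis using radius_nonneg[of n] radius_less[of n] by (simp add: norm_mult)
qed

lemma dilation_continuous_holomorphic:
  assumes "F holomorphic_on ball 0 1"
  shows "continuous_on (cball 0 1) (\<lambda>z. F (of_real (radius n) * z))"
    and "(\<lambda>z. F (of_real (radius n) * z)) holomorphic_on ball 0 1"
proof -
  show "continuous_on (cball 0 1) (\<lambda>z. F (of_real (radius n) * z))"
    by (rule continuous_on_compose2[OF holomorphic_on_imp_continuous_on[OF assms]])
       (use radius_mult_ball in \<open>auto intro!: continuous_intros\<close>)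
  have "(F \<circ> (\<lambda>z. of_real (radius n) * z)) holomorphic_on ball 0 1"
    by (rule holomorphic_on_compose_gen[OF _ assms])
       (use radius_mult_ball in \<open>auto intro!: holomorphic_intros\<close>)
  then show "(\<lambda>z. F (of_real (radius n) * z)) holomorphic_on ball 0 1" by (simp add: o_def)
qed

text \<open>A limit along a fixed sequence of radii is a measurable function on the whole line
  whether or not radial limits exist, and it agrees with the radial limit wherever there is
  one.\<close>

definition bdry :: "(complex \<Rightarrow> complex) \<Rightarrow> real \<Rightarrow> complex" where
  "bdry F t = lim (\<lambda>n. F (of_real (radius n) * cis t))"

lemma radial_limit_LIMSEQ: "radial_limit F t L \<Longrightarrow> (\<lambda>n. F (of_real (radius n) * cis t)) \<longlonglongrightarrow> L"
  unfolding radial_limit_def by (rule filterlim_compose[OF _ radius_at_left])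

lemma radial_limit_bdry: "radial_limit F t L \<Longrightarrow> bdry F t = L"
  unfolding bdry_def by (rule limI) (rule radial_limit_LIMSEQ)

lemma measurable_radius:
  fixes F :: "complex \<Rightarrow> complex"
  shows "F holomorphic_on ball 0 1 \<Longrightarrow> (\<lambda>t. F (of_real (radius n) * cis t)) \<in> borel_measurable borel"
  by (rule measurable_radial[OF holomorphic_on_imp_continuous_on radius_nonneg radius_less])

lemma measurable_bdry: "F holomorphic_on ball 0 1 \<Longrightarrow> bdry F \<in> borel_measurable borel"
  unfolding bdry_def[abs_def] by (intro borel_measurable_lim_metric measurable_radius)

lemma Hinf_bdry: "F \<in> Hinf \<Longrightarrow> AE t in circ. radial_limit F t (bdry F t)"
  by (rule eventually_mono[OF Fatou_Hinf]) (auto simp: radial_limit_bdry)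

lemma Hinf_bdry_LIMSEQ:
  assumes "F \<in> Hinf"
  shows "AE t in circ. (\<lambda>n. F (of_real (radius n) * cis t)) \<longlonglongrightarrow> bdry F t"
  using Hinf_bdry[OF assms] by eventually_elim (rule radial_limit_LIMSEQ)

lemma Hinf_bdry_bounded:
  assumes F: "F \<in> Hinf" and M: "\<And>z. norm z < 1 \<Longrightarrow> norm (F z) \<le> M"
  shows "AE t in circ. norm (bdry F t) \<le> M"
  using Hinf_bdry_LIMSEQ[OF F]
proof eventually_elim
  case (elim t)
  from tendsto_norm[OF this] show ?case
    by (rule LIMSEQ_le_const2) (use M norm_radius_cis in blast)
qed

lemma integral_bdry_mult:
  assumes F: "F \<in> Hinf" and k: "continuous_on UNIV k" and c: "\<And>n. (\<integral>t. F (of_real (radius n) * cis t) * k t \<partial>circ) = c n"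
    and L: "c \<longlonglongrightarrow> L"
  shows "(\<integral>t. bdry F t * k t \<partial>circ) = L"
proof -
  have hol: "F holomorphic_on ball 0 1" using F by (simp add: Hinf_def)
  obtain M where M: "M \<ge> 0" "\<And>z. norm z < 1 \<Longrightarrow> norm (F z) \<le> M" using Hinf_bound[OF F] by blast
  have [measurable]: "k \<in> borel_measurable borel" by (rule borel_measurable_continuous_onI[OF k])
  note [measurable] = measurable_bdry[OF hol] measurable_radius[OF hol]
  have "(\<lambda>n. \<integral>t. F (of_real (radius n) * cis t) * k t \<partial>circ) \<longlonglongrightarrow> (\<integral>t. bdry F t * k t \<partial>circ)"
  proof (rule integral_dominated_convergence[where w="\<lambda>t. M * norm (k t)"])
    show "integrable circ (\<lambda>t. M * norm (k t))"
      by (intro integrable_circ_continuous continuous_intros k)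
    show "AE t in circ. (\<lambda>n. F (of_real (radius n) * cis t) * k t) \<longlonglongrightarrow> bdry F t * k t"
      using Hinf_bdry_LIMSEQ[OF F] by eventually_elim (intro tendsto_intros)
    show "AE t in circ. norm (F (of_real (radius n) * cis t) * k t) \<le> M * norm (k t)" for n
      using M norm_radius_cis by (auto simp: norm_mult intro!: mult_right_mono)
  qed measurable
  then show ?thesis using L LIMSEQ_unique unfolding c by blast
qed

text \<open>Dilations are continuous up to the circle, so the formulas are exact for them; dominated
  convergence transfers them to the boundary values of a bounded function.\<close>

lemma bdry_herglotz_reproduces:
  assumes F: "F \<in> Hinf" and w: "norm w < 1"
  shows "(\<integral>t. bdry F t * herglotz w t \<partial>circ) = 2 * F w - F 0"
    and "(\<integral>t. bdry F t * cnj (herglotz w t) \<partial>circ) = F 0"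
proof -
  have hol: "F holomorphic_on ball 0 1" using F by (simp add: Hinf_def)
  note d = dilation_continuous_holomorphic[OF hol]
  have wb: "w \<in> ball 0 1" using w by simp
  have "(\<lambda>n. F (of_real (radius n) * w)) \<longlonglongrightarrow> F w"
  proof (rule continuous_on_tendsto_compose[OF Hinf_continuous[OF F] _ wb])
    have "(\<lambda>n. of_real (radius n) * w) \<longlonglongrightarrow> of_real 1 * w" by (intro tendsto_intros radius_LIMSEQ)
    then show "(\<lambda>n. of_real (radius n) * w) \<longlonglongrightarrow> w" by simp
    show "\<forall>\<^sub>F n in sequentially. of_real (radius n) * w \<in> ball 0 1"
      using w radius_mult_ball by (intro always_eventually) auto
  qed
  then have "(\<lambda>n. 2 * F (of_real (radius n) * w) - F (of_real (radius n) * 0)) \<longlonglongrightarrow> 2 * F w - F 0"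
    by (auto intro!: tendsto_intros)
  then show "(\<integral>t. bdry F t * herglotz w t \<partial>circ) = 2 * F w - F 0"
    by (rule integral_bdry_mult[OF F continuous_herglotz[OF w] herglotz_reproduces[OF d w]])
  show "(\<integral>t. bdry F t * cnj (herglotz w t) \<partial>circ) = F 0"
    by (rule integral_bdry_mult[OF F _ cnj_herglotz_reproduces[OF d w]])
       (auto intro!: continuous_intros continuous_herglotz w)
qed

section \<open>Herglotz integrals of integrable functions\<close>

lemma norm_herglotz_mult_le:
  "norm z < 1 \<Longrightarrow> norm (herglotz z t * c) \<le> 2 / (1 - norm z) * norm c"
  unfolding norm_mult by (rule mult_right_mono[OF norm_herglotz_le]) auto

lemma integrable_mult_herglotz:
  assumes u: "integrable circ u" and z: "norm z < 1"
  shows "integrable circ (\<lambda>t. herglotz z t * u t)"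
proof (rule Bochner_Integration.integrable_bound[of circ "\<lambda>t. 2 / (1 - norm z) * norm (u t)"])
  show "integrable circ (\<lambda>t. 2 / (1 - norm z) * norm (u t))" using u by auto
  show "(\<lambda>t. herglotz z t * u t) \<in> borel_measurable circ" using u by auto
  show "AE t in circ. norm (herglotz z t * u t) \<le> norm (2 / (1 - norm z) * norm (u t))"
    by (intro AE_I2 order_trans[OF norm_herglotz_mult_le[OF z]]) (use z in simp)
qed

lemma integrable_bdry:
  assumes F: "F \<in> Hinf"
  shows "integrable circ (bdry F)"
proof -
  obtain M where M: "\<And>z. norm z < 1 \<Longrightarrow> norm (F z) \<le> M" using Hinf_bound[OF F] by blast
  show ?thesis
    by (rule integrable_circ_bounded[OF _ Hinf_bdry_bounded[OF F M]])
       (use F in \<open>auto simp: Hinf_def intro: measurable_bdry\<close>)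
qed

lemma integral_Re_bdry:
  assumes F: "F \<in> Hinf"
  shows "(\<integral>t. Re (bdry F t) \<partial>circ) = Re (F 0)"
  using bdry_herglotz_reproduces(1)[OF F, of 0] integral_Re[OF integrable_bdry[OF F]] by simp

text \<open>The real part is the Poisson integral of \<open>u\<close>, the imaginary part its
  harmonic conjugate normalised to vanish at the origin.\<close>

definition herglotz_int :: "(real \<Rightarrow> real) \<Rightarrow> complex \<Rightarrow> complex" where
  "herglotz_int u z = (\<integral>t. herglotz z t * complex_of_real (u t) \<partial>circ)"

lemma integrable_herglotz_int:
  assumes "integrable circ u" "norm z < 1"
  shows "integrable circ (\<lambda>t. herglotz z t * complex_of_real (u t))"
  using assms by (intro integrable_mult_herglotz) auto

text \<open>Write the imaginary part as \<open>(x - cnj x) / (2 * \<i>)\<close>: the first half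
  reproduces \<open>F\<close>, while the conjugated half sees only \<open>F 0\<close>. Thus a
  bounded function is recovered from its boundary imaginary part up to a real constant.\<close>

lemma herglotz_int_Im_bdry:
  assumes F: "F \<in> Hinf" and w: "norm w < 1"
  shows "\<i> * herglotz_int (\<lambda>t. Im (bdry F t)) w = F w - of_real (Re (F 0))"
proof -
  have "herglotz w t * complex_of_real (Im (bdry F t)) =
     (bdry F t * herglotz w t - cnj (bdry F t * cnj (herglotz w t))) / (2 * \<i>)" for t
  proof -
    have "complex_of_real (Im x) = (x - cnj x) / (2 * \<i>)" for x by (simp add: complex_eq_iff)
    from this[of "bdry F t"] show ?thesis
      by (simp only: complex_cnj_mult complex_cnj_cnj) (simp add: algebra_simps diff_divide_distrib)
  qed
  moreover have i1: "integrable circ (\<lambda>t. bdry F t * herglotz w t)"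
    using integrable_mult_herglotz[OF integrable_bdry[OF F] w] by (simp add: mult.commute)
  moreover have i2: "integrable circ (\<lambda>t. cnj (bdry F t * cnj (herglotz w t)))"
    using integrable_mult_herglotz[of "\<lambda>t. cnj (bdry F t)", OF _ w] integrable_bdry[OF F] by (simp add: mult.commute)
  ultimately have "herglotz_int (\<lambda>t. Im (bdry F t)) w = (\<integral>t. bdry F t * herglotz w t - cnj (bdry F t * cnj (herglotz w t)) \<partial>circ) / (2 * \<i>)"
    unfolding herglotz_int_def by simp
  also have "(\<integral>t. bdry F t * herglotz w t - cnj (bdry F t * cnj (herglotz w t)) \<partial>circ) = (2 * F w - F 0) - cnj (F 0)"
    using bdry_herglotz_reproduces[OF F w]
    by (subst Bochner_Integration.integral_diff[OF i1 i2]) (simp only: Bochner_Integration.integral_cnj)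
  finally show ?thesis by (simp add: complex_eq_iff)
qed

lemma herglotz_power_series:
  assumes "norm z < 1"
  shows "(\<lambda>n. (if n = 0 then 1 else 2) * cnj (cis t) ^ n * z^n) sums herglotz z t"
proof -
  define x where "x = cnj (cis t) * z"
  have "norm x < 1" using assms by (simp add: x_def norm_mult)
  then have "(\<lambda>n. 2 * x^n) sums (2 * (1 / (1 - x)))" by (intro sums_mult geometric_sums)
  from sums_diff[OF this sums_single[of 0 "\<lambda>_. 1"]]
  have "(\<lambda>n. 2 * x^n - (if n = 0 then 1 else 0)) sums (2 * (1 / (1 - x)) - 1)" .
  moreover have "2 * x^n - (if n = 0 then 1 else 0) = (if n = 0 then 1 else 2) * cnj (cis t) ^ n * z^n" for n
    by (simp add: x_def power_mult_distrib)
  moreover have "2 * (1 / (1 - x)) - 1 = herglotz z t"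
  proof -
    have "x = z / cis t" by (simp add: x_def cis_cnj divide_inverse)
    then have "1 - x = (cis t - z) / cis t" by (simp add: field_simps)
    then have "2 * (1 / (1 - x)) - 1 = 2 * (cis t / (cis t - z)) - 1" by simp
    then show ?thesis
      using cis_minus_nonzero[OF assms, of t] by (simp add: herglotz_def divide_simps)
  qed
  ultimately show ?thesis by simp
qed

text \<open>Integrating the geometric expansion of the kernel term by term gives a power series
  convergent on the whole disk.\<close>

lemma holomorphic_herglotz_int:
  assumes u: "integrable circ u"
  shows "herglotz_int u holomorphic_on ball 0 1"
proof (rule power_series_holomorphic)
  have [measurable]: "cis \<in> borel_measurable borel"
    by (intro borel_measurable_continuous_onI continuous_intros)
  have [measurable]: "u \<in> borel_measurable borel" using borel_measurable_integrable[OF u] by simp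
  fix z :: complex assume "z \<in> ball 0 1"
  then have z: "norm z < 1" by simp
  have "(\<lambda>n. \<integral>t. (if n = 0 then 1 else 2) * cnj (cis t) ^ n * z^n * complex_of_real (u t) \<partial>circ) sums herglotz_int u z"
    unfolding herglotz_int_def
  proof (rule sums_integral_circ)
    show "integrable circ (\<lambda>t. 2 * \<bar>u t\<bar>)" using u by auto
    show "norm ((if n = 0 then 1 else 2) * cnj (cis t) ^ n * z^n * complex_of_real (u t)) \<le> norm z ^ n * (2 * \<bar>u t\<bar>)" for n t
      by (auto simp: norm_mult norm_power)
    show "summable (\<lambda>n. norm z ^ n)" using z by (intro summable_geometric) auto
    show "(\<lambda>n. (if n = 0 then 1 else 2) * cnj (cis t) ^ n * z^n * complex_of_real (u t)) sums (herglotz z t * complex_of_real (u t))" for t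
      by (intro sums_mult2 herglotz_power_series z)
  qed measurable
  moreover have "(\<integral>t. (if n = 0 then 1 else 2) * cnj (cis t) ^ n * z^n * complex_of_real (u t) \<partial>circ)
     = (\<integral>t. (if n = 0 then 1 else 2) * cnj (cis t) ^ n * complex_of_real (u t) \<partial>circ) * (z - 0)^n" for n
    by (subst integral_mult_left_zero[symmetric]) (simp only: diff_zero mult_ac)
  ultimately show "(\<lambda>n. (\<integral>t. (if n = 0 then 1 else 2) * cnj (cis t) ^ n * complex_of_real (u t) \<partial>circ) * (z - 0)^n) sums herglotz_int u z"
    by simp
qed

lemma Re_herglotz_int:
  assumes "integrable circ u" "norm z < 1"
  shows "Re (herglotz_int u z) = (\<integral>t. Re (herglotz z t) * u t \<partial>circ)"
    and "integrable circ (\<lambda>t. Re (herglotz z t) * u t)"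
  using integral_Re[OF integrable_herglotz_int[OF assms]] integrable_Re[OF integrable_herglotz_int[OF assms]]
  by (simp_all add: herglotz_int_def)

lemma Re_herglotz_int_mono:
  assumes "integrable circ u" "integrable circ v" "norm z < 1" "\<And>t. u t \<le> v t"
  shows "Re (herglotz_int u z) \<le> Re (herglotz_int v z)"
  unfolding Re_herglotz_int(1)[OF assms(1,3)] Re_herglotz_int(1)[OF assms(2,3)]
  by (intro integral_mono Re_herglotz_int(2) assms mult_left_mono less_imp_le Re_herglotz_pos)

lemma herglotz_int_const: "norm z < 1 \<Longrightarrow> herglotz_int (\<lambda>_. c) z = of_real c"
  by (simp add: herglotz_int_def integral_herglotz)

lemma herglotz_int_0: "herglotz_int u 0 = of_real (\<integral>t. u t \<partial>circ)"
  by (simp add: herglotz_int_def)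

lemma herglotz_int_diff:
  assumes "integrable circ u" "integrable circ v" "norm z < 1"
  shows "herglotz_int (\<lambda>t. u t - v t) z = herglotz_int u z - herglotz_int v z"
  unfolding herglotz_int_def
  using Bochner_Integration.integral_diff[OF integrable_herglotz_int[OF assms(1,3)] integrable_herglotz_int[OF assms(2,3)]]
  by (simp add: right_diff_distrib)

lemma herglotz_int_add:
  assumes "integrable circ u" "integrable circ v" "norm z < 1"
  shows "herglotz_int (\<lambda>t. u t + v t) z = herglotz_int u z + herglotz_int v z"
  unfolding herglotz_int_def
  using Bochner_Integration.integral_add[OF integrable_herglotz_int[OF assms(1,3)] integrable_herglotz_int[OF assms(2,3)]]
  by (simp add: distrib_left)

lemma norm_herglotz_int_le:
  assumes u: "integrable circ u" and z: "norm z < 1"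
  shows "norm (herglotz_int u z) \<le> 2 / (1 - norm z) * (\<integral>t. \<bar>u t\<bar> \<partial>circ)"
proof -
  have "norm (herglotz_int u z) \<le> (\<integral>t. norm (herglotz z t * complex_of_real (u t)) \<partial>circ)"
    unfolding herglotz_int_def by (rule integral_norm_bound)
  also have "\<dots> \<le> (\<integral>t. 2 / (1 - norm z) * \<bar>u t\<bar> \<partial>circ)"
    using norm_herglotz_mult_le[OF z, of _ "complex_of_real (u t)" for t]
    by (intro integral_mono integrable_norm integrable_herglotz_int u z) (use u in auto)
  finally show ?thesis by simp
qed

section \<open>Functions with nonnegative real part\<close>

lemma mean_Re_radius:
  assumes "F holomorphic_on ball 0 1"
  shows "(\<integral>t. Re (F (of_real (radius n) * cis t)) \<partial>circ) = Re (F 0)"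
    and "integrable circ (\<lambda>t. Re (F (of_real (radius n) * cis t)))"
proof -
  note d = dilation_continuous_holomorphic[OF assms, of n]
  have i: "integrable circ (\<lambda>t. F (of_real (radius n) * cis t))"
    by (rule integrable_circ_continuous[OF continuous_cis_comp[OF d(1)]])
  show "(\<integral>t. Re (F (of_real (radius n) * cis t)) \<partial>circ) = Re (F 0)"
    using integral_Re[OF i] mean_value_circ[OF d] by simp
  show "integrable circ (\<lambda>t. Re (F (of_real (radius n) * cis t)))"
    using i by (rule integrable_Re)
qed

lemma Re_herglotz_int_nonneg:
  assumes "integrable circ u" "\<And>t. 0 \<le> u t" "norm z < 1"
  shows "0 \<le> Re (herglotz_int u z)"
  using Re_herglotz_int_mono[of "\<lambda>_. 0" u z] assms herglotz_int_const[of z 0] by simp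

lemma Re_herglotz_int_le:
  assumes "integrable circ u" "\<And>t. u t \<le> c" "norm z < 1"
  shows "Re (herglotz_int u z) \<le> c"
  using Re_herglotz_int_mono[of u "\<lambda>_. c" z] assms herglotz_int_const[of z c] by simp

text \<open>Radial limits are those of the bounded function \<open>1 / (1 + p)\<close>, which cannot
  vanish on a set of positive measure because the means of \<open>ln \<bar>1 + p\<bar>\<close> over circles are constant.\<close>

lemma positive_real_part_radial_limit:
  assumes hol: "p holomorphic_on ball 0 1" and pos: "\<And>z. norm z < 1 \<Longrightarrow> 0 \<le> Re (p z)"
  shows "AE t in circ. radial_limit p t (bdry p t)"
proof -
  define q where "q z = 1 / (1 + p z)" for z
  have ge1: "1 \<le> norm (1 + p z)" if "norm z < 1" for z
    using pos[OF that] complex_Re_le_cmod[of "1 + p z"] by simp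
  have nz: "1 + p z \<noteq> 0" if "norm z < 1" for z using ge1[OF that] by auto
  have q: "q \<in> Hinf"
  proof -
    have "q holomorphic_on ball 0 1"
      unfolding q_def[abs_def] using nz by (intro holomorphic_intros hol) auto
    moreover have "bounded (q ` ball 0 1)"
      unfolding bounded_iff using ge1 by (intro exI[of _ 1]) (auto simp: q_def norm_divide divide_le_eq)
    ultimately show ?thesis by (simp add: Hinf_def)
  qed
  define P where "P z = Ln (1 + p z)" for z
  have notneg: "1 + p z \<notin> \<real>\<^sub>\<le>\<^sub>0" if "norm z < 1" for z
    using pos[OF that] by (auto simp: complex_nonpos_Reals_iff)
  have Phol: "P holomorphic_on ball 0 1"
    unfolding P_def[abs_def] using notneg by (intro holomorphic_intros hol) auto
  have ReP: "Re (P z) = ln (norm (1 + p z))" if "norm z < 1" for z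
    unfolding P_def using nz[OF that] by simp
  define y where "y n t = Re (P (of_real (radius n) * cis t))" for n t
  have y: "y n t = ln (norm (1 + p (of_real (radius n) * cis t)))" "0 \<le> y n t" for n t
    unfolding y_def using ReP[OF norm_radius_cis] ge1[OF norm_radius_cis] by (auto intro!: ln_ge_zero)
  have [measurable]: "y n \<in> borel_measurable borel" for n
    using borel_measurable_integrable[OF mean_Re_radius(2)[OF Phol, of n]] by (simp add: y_def[abs_def])
  have "(\<integral>\<^sup>+t. liminf (\<lambda>n. ennreal (y n t)) \<partial>circ) \<le> liminf (\<lambda>n. \<integral>\<^sup>+t. ennreal (y n t) \<partial>circ)"
    by (rule nn_integral_liminf) measurable
  also have "(\<lambda>n. \<integral>\<^sup>+t. ennreal (y n t) \<partial>circ) = (\<lambda>n. ennreal (Re (P 0)))"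
  proof
    fix n
    show "(\<integral>\<^sup>+t. ennreal (y n t) \<partial>circ) = ennreal (Re (P 0))"
      using mean_Re_radius[OF Phol, of n] y(2)
      by (subst nn_integral_eq_integral) (auto simp: y_def[abs_def])
  qed
  finally have "(\<integral>\<^sup>+t. liminf (\<lambda>n. ennreal (y n t)) \<partial>circ) \<noteq> \<infinity>"
    by (auto simp: Liminf_const top_unique)
  then have "AE t in circ. liminf (\<lambda>n. ennreal (y n t)) \<noteq> \<infinity>"
    by (intro nn_integral_PInf_AE) measurable
  with Hinf_bdry[OF q] show ?thesis
  proof eventually_elim
    case (elim t)
    define L where "L = bdry q t"
    \<comment> \<open>If \<open>L\<close> were 0, then \<open>y n t\<close> would tend to infinity
      along the radii; Fatou's lemma and the constant means of \<open>y n\<close> make its lower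
      limit finite a.e.\<close>
    have "L \<noteq> 0"
    proof
      assume "L = 0"
      with radial_limit_LIMSEQ[OF elim(1)] have q0: "(\<lambda>n. q (of_real (radius n) * cis t)) \<longlonglongrightarrow> 0"
        by (simp add: L_def)
      obtain K where K: "K \<ge> 0" "liminf (\<lambda>n. ennreal (y n t)) = ennreal K"
        using elim(2) by (cases "liminf (\<lambda>n. ennreal (y n t))" rule: ennreal_cases) auto
      have "\<forall>\<^sub>F n in sequentially. norm (q (of_real (radius n) * cis t)) < exp (- (K + 1))"
        using tendstoD[OF q0, of "exp (- (K + 1))"] by (simp add: dist_norm)
      then have "\<forall>\<^sub>F n in sequentially. ennreal (K + 1) \<le> ennreal (y n t)"
      proof eventually_elim
        case (elim n)
        let ?z = "of_real (radius n) * cis t"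
        have "1 < exp (- (K + 1)) * norm (1 + p ?z)"
          using elim nz[OF norm_radius_cis, of n t] by (simp add: q_def norm_divide field_simps)
        then have "exp (K + 1) * 1 \<le> exp (K + 1) * (exp (- (K + 1)) * norm (1 + p ?z))"
          by (intro mult_left_mono) auto
        then have "exp (K + 1) \<le> norm (1 + p ?z)"
          by (simp only: mult.assoc[symmetric] exp_add[symmetric]) simp
        then have "K + 1 \<le> y n t"
          unfolding y(1) using ln_mono[of "exp (K+1)"] by simp
        then show ?case by (rule ennreal_leI)
      qed
      then have "ennreal (K + 1) \<le> liminf (\<lambda>n. ennreal (y n t))" by (rule Liminf_bounded)
      then show False using K by simp
    qed
    have "radial_limit p t (1 / L - 1)"
      unfolding radial_limit_def
    proof (rule Lim_transform_eventually)
      show "((\<lambda>r. 1 / q (of_real r * cis t) - 1) \<longlongrightarrow> 1 / L - 1) (at_left 1)"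
        using elim(1) \<open>L \<noteq> 0\<close> unfolding radial_limit_def L_def by (intro tendsto_intros) auto
      have "\<forall>\<^sub>F r in at_left (1::real). 0 < r \<and> r < 1"
        by (auto simp: eventually_at_left_field intro!: exI[of _ 0])
      then show "\<forall>\<^sub>F r in at_left (1::real). 1 / q (of_real r * cis t) - 1 = p (of_real r * cis t)"
        by eventually_elim (simp add: q_def)
    qed
    then show ?case using radial_limit_bdry by metis
  qed
qed

lemma herglotz_int_radial_limit:
  assumes "integrable circ u" "\<And>t. 0 \<le> u t"
  shows "AE t in circ. radial_limit (herglotz_int u) t (bdry (herglotz_int u) t)"
  by (rule positive_real_part_radial_limit[OF holomorphic_herglotz_int])
     (use assms Re_herglotz_int_nonneg in auto)

lemma herglotz_int_bdry_LIMSEQ: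
  assumes "integrable circ u" "\<And>t. 0 \<le> u t"
  shows "AE t in circ. (\<lambda>n. Re (herglotz_int u (of_real (radius n) * cis t))) \<longlonglongrightarrow> Re (bdry (herglotz_int u) t)"
  using herglotz_int_radial_limit[OF assms] by eventually_elim (intro tendsto_Re radial_limit_LIMSEQ)

lemma Re_bdry_herglotz_int_mono:
  assumes "integrable circ u" "integrable circ v" "\<And>t. 0 \<le> u t" "\<And>t. u t \<le> v t"
  shows "AE t in circ. Re (bdry (herglotz_int u) t) \<le> Re (bdry (herglotz_int v) t)"
proof -
  have "0 \<le> v t" for t using assms(3,4)[of t] by simp
  from herglotz_int_bdry_LIMSEQ[OF assms(1,3)] herglotz_int_bdry_LIMSEQ[OF assms(2) this]
  show ?thesis
    by eventually_elim
       (rule LIMSEQ_le, assumption, assumption, use assms norm_radius_cis in \<open>auto intro!: Re_herglotz_int_mono\<close>)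
qed

lemma Re_bdry_herglotz_int_nonneg:
  assumes "integrable circ u" "\<And>t. 0 \<le> u t"
  shows "AE t in circ. 0 \<le> Re (bdry (herglotz_int u) t)"
  using herglotz_int_bdry_LIMSEQ[OF assms]
  by eventually_elim (rule LIMSEQ_le_const, assumption, use assms norm_radius_cis in \<open>auto intro!: Re_herglotz_int_nonneg\<close>)

lemma measurable_Re_bdry_herglotz_int:
  assumes "integrable circ u"
  shows "(\<lambda>t. Re (bdry (herglotz_int u) t)) \<in> borel_measurable borel"
  using measurable_bdry[OF holomorphic_herglotz_int[OF assms]] by measurable

lemma Re_bdry_herglotz_int_bounded:
  assumes u: "integrable circ u" "\<And>t. 0 \<le> u t" and c: "\<And>t. u t \<le> c"
  shows "AE t in circ. Re (bdry (herglotz_int u) t) \<le> c"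
    and "integrable circ (\<lambda>t. Re (bdry (herglotz_int u) t))"
    and "(\<integral>t. Re (bdry (herglotz_int u) t) \<partial>circ) = (\<integral>t. u t \<partial>circ)"
proof -
  note lim = herglotz_int_bdry_LIMSEQ[OF u]
  note hol = holomorphic_herglotz_int[OF u(1)]
  note [measurable] = measurable_Re_bdry_herglotz_int[OF u(1)] borel_measurable_integrable[OF mean_Re_radius(2)[OF hol]]
  show "AE t in circ. Re (bdry (herglotz_int u) t) \<le> c"
    using lim by eventually_elim (rule LIMSEQ_le_const2, assumption, use u c norm_radius_cis in \<open>auto intro!: Re_herglotz_int_le\<close>)
  have b: "AE t in circ. norm (Re (herglotz_int u (of_real (radius n) * cis t))) \<le> c" for n
    using Re_herglotz_int_nonneg[OF u norm_radius_cis] Re_herglotz_int_le[OF u(1) c norm_radius_cis] by auto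
  show "integrable circ (\<lambda>t. Re (bdry (herglotz_int u) t))"
    by (rule integrable_dominated_convergence[OF _ _ _ lim b]) auto
  have "(\<lambda>n. \<integral>t. Re (herglotz_int u (of_real (radius n) * cis t)) \<partial>circ) \<longlonglongrightarrow> (\<integral>t. Re (bdry (herglotz_int u) t) \<partial>circ)"
    by (rule integral_dominated_convergence[OF _ _ _ lim b]) auto
  then have "(\<lambda>n::nat. Re (herglotz_int u 0)) \<longlonglongrightarrow> (\<integral>t. Re (bdry (herglotz_int u) t) \<partial>circ)"
    by (simp only: mean_Re_radius[OF hol])
  then show "(\<integral>t. Re (bdry (herglotz_int u) t) \<partial>circ) = (\<integral>t. u t \<partial>circ)"
    by (simp add: LIMSEQ_const_iff herglotz_int_0)
qed

text \<open>No mass escapes in the passage to the boundary. Fatou's lemma gives one inequality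
  between the means; the truncations \<open>min (u t) M\<close> give the other, because equality
  holds for bounded data and their boundary values lie below those of \<open>u\<close>. This
  equality is what later makes the saturation error vanish in mean.\<close>

lemma Re_bdry_herglotz_int:
  assumes u: "integrable circ u" "\<And>t. 0 \<le> u t"
  shows "integrable circ (\<lambda>t. Re (bdry (herglotz_int u) t))"
    and "(\<integral>t. Re (bdry (herglotz_int u) t) \<partial>circ) = (\<integral>t. u t \<partial>circ)"
proof -
  define A where "A t = Re (bdry (herglotz_int u) t)" for t
  define y where "y n t = Re (herglotz_int u (of_real (radius n) * cis t))" for n t
  note hol = holomorphic_herglotz_int[OF u(1)]
  have [measurable]: "A \<in> borel_measurable borel"
    unfolding A_def[abs_def] by (rule measurable_Re_bdry_herglotz_int[OF u(1)])
  have [measurable]: "u \<in> borel_measurable borel" using borel_measurable_integrable[OF u(1)] by simp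
  have [measurable]: "y n \<in> borel_measurable borel" for n
    using borel_measurable_integrable[OF mean_Re_radius(2)[OF hol, of n]] by (simp add: y_def[abs_def])
  have y0: "0 \<le> y n t" for n t unfolding y_def by (rule Re_herglotz_int_nonneg[OF u norm_radius_cis])
  have "AE t in circ. ennreal (A t) = liminf (\<lambda>n. ennreal (y n t))"
    using herglotz_int_bdry_LIMSEQ[OF u]
    by eventually_elim (auto simp: A_def y_def intro!: lim_imp_Liminf[symmetric] tendsto_ennrealI)
  then have "(\<integral>\<^sup>+t. ennreal (A t) \<partial>circ) = (\<integral>\<^sup>+t. liminf (\<lambda>n. ennreal (y n t)) \<partial>circ)"
    by (rule nn_integral_cong_AE)
  also have "\<dots> \<le> liminf (\<lambda>n. \<integral>\<^sup>+t. ennreal (y n t) \<partial>circ)"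
    by (rule nn_integral_liminf) measurable
  also have "(\<lambda>n. \<integral>\<^sup>+t. ennreal (y n t) \<partial>circ) = (\<lambda>n. ennreal (\<integral>t. u t \<partial>circ))"
  proof
    fix n
    show "(\<integral>\<^sup>+t. ennreal (y n t) \<partial>circ) = ennreal (\<integral>t. u t \<partial>circ)"
      using mean_Re_radius[OF hol, of n] y0
      by (subst nn_integral_eq_integral) (auto simp: y_def[abs_def] herglotz_int_0)
  qed
  finally have le: "(\<integral>\<^sup>+t. ennreal (A t) \<partial>circ) \<le> ennreal (\<integral>t. u t \<partial>circ)" by (simp add: Liminf_const)
  have A0: "AE t in circ. 0 \<le> A t" unfolding A_def by (rule Re_bdry_herglotz_int_nonneg[OF u])
  have Ai: "integrable circ A"
    by (rule integrableI_nonneg) (use A0 le in \<open>auto simp: le_less_trans\<close>)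
  then have "ennreal (\<integral>t. A t \<partial>circ) \<le> ennreal (\<integral>t. u t \<partial>circ)"
    using le nn_integral_eq_integral[OF Ai A0] by simp
  moreover have "0 \<le> (\<integral>t. u t \<partial>circ)" using u(2) by simp
  ultimately have 1: "(\<integral>t. A t \<partial>circ) \<le> (\<integral>t. u t \<partial>circ)" by (simp add: ennreal_le_iff)
  have 2: "(\<integral>t. u t \<partial>circ) \<le> (\<integral>t. A t \<partial>circ)"
  proof (rule LIMSEQ_le_const2)
    show "(\<lambda>M::nat. \<integral>t. min (u t) (real M) \<partial>circ) \<longlonglongrightarrow> (\<integral>t. u t \<partial>circ)"
    proof (rule integral_dominated_convergence[OF _ _ u(1)])
      show "AE t in circ. (\<lambda>M. min (u t) (real M)) \<longlonglongrightarrow> u t"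
      proof (rule AE_I2)
        fix t
        have "\<forall>\<^sub>F M in sequentially. u t = min (u t) (real M)"
          using eventually_ge_at_top[of "nat \<lceil>u t\<rceil>"] by eventually_elim linarith
        then show "(\<lambda>M. min (u t) (real M)) \<longlonglongrightarrow> u t" by (rule tendsto_eventually[OF eventually_mono]) auto
      qed
      show "AE t in circ. norm (min (u t) (real M)) \<le> u t" for M using u(2) by auto
    qed measurable
    show "\<exists>N. \<forall>M\<ge>N. (\<integral>t. min (u t) (real M) \<partial>circ) \<le> (\<integral>t. A t \<partial>circ)"
    proof (intro exI allI impI)
      fix M :: nat
      have uM: "integrable circ (\<lambda>t. min (u t) (real M))" using u(1) by auto
      have uM0: "0 \<le> min (u t) (real M)" for t using u(2) by auto
      have uMb: "min (u t) (real M) \<le> real M" for t by auto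
      have uMu: "min (u t) (real M) \<le> u t" for t by auto
      have "(\<integral>t. min (u t) (real M) \<partial>circ) = (\<integral>t. Re (bdry (herglotz_int (\<lambda>t. min (u t) (real M))) t) \<partial>circ)"
        by (rule Re_bdry_herglotz_int_bounded(3)[OF uM uM0 uMb, symmetric])
      also have "\<dots> \<le> (\<integral>t. A t \<partial>circ)"
        unfolding A_def
        by (rule integral_mono_AE[OF Re_bdry_herglotz_int_bounded(2)[OF uM uM0 uMb] Ai[unfolded A_def] Re_bdry_herglotz_int_mono[OF uM u(1) uM0 uMu]])
      finally show "(\<integral>t. min (u t) (real M) \<partial>circ) \<le> (\<integral>t. A t \<partial>circ)" .
    qed
  qed
  show "integrable circ (\<lambda>t. Re (bdry (herglotz_int u) t))" using Ai by (simp add: A_def[abs_def])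
  show "(\<integral>t. Re (bdry (herglotz_int u) t) \<partial>circ) = (\<integral>t. u t \<partial>circ)" using 1 2 by (simp add: A_def)
qed

section \<open>Inner functions from measurable sets\<close>

lemma integrable_indicator_circ: "E \<in> sets borel \<Longrightarrow> integrable circ (indicator E :: real \<Rightarrow> real)"
  by (simp add: integrable_real_indicator less_top[symmetric])

text \<open>By compactness \<open>cis s\<close> has positive distance from the arc points with
  parameter in \<open>C\<close>, so there the Poisson kernel is at most a constant times
  \<open>1 - r^2\<close>; the 4 comes from \<open>y \<le> 2 * x\<close>.\<close>

lemma herglotz_int_indicator_closed_off:
  assumes C: "closed C" and s: "s \<in> {0<..<2*pi}" "s \<notin> C"
  shows "(\<lambda>n. Re (herglotz_int (indicator C) (of_real (radius n) * cis s))) \<longlonglongrightarrow> 0"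
proof -
  have iC: "integrable circ (indicator C :: real \<Rightarrow> real)"
    using C by (intro integrable_indicator_circ) auto
  have "compact ({0..2*pi} \<inter> C)" using C by (intro compact_Int_closed) auto
  moreover have "continuous_on ({0..2*pi} \<inter> C) (\<lambda>t. 1 / (norm (cis t - cis s))^2)"
    using cis_eq_imp_eq[OF _ s(1)] s(2) by (intro continuous_intros) fastforce
  ultimately have "bounded ((\<lambda>t. 1 / (norm (cis t - cis s))^2) ` ({0..2*pi} \<inter> C))"
    by (intro compact_imp_bounded compact_continuous_image)
  then obtain B where B: "\<And>t. t \<in> {0..2*pi} \<inter> C \<Longrightarrow> 1 / (norm (cis t - cis s))^2 \<le> B"
    unfolding bounded_iff by fastforce
  \<comment> \<open>\<open>radius 0\<close> is 0, which the kernel estimate excludes.\<close>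
  have le: "Re (herglotz_int (indicator C) (of_real (radius n) * cis s)) \<le> 4 * \<bar>B\<bar> * (1 - (radius n)^2)" if n: "n > 0" for n
  proof -
    let ?z = "of_real (radius n) * cis s"
    have r: "0 < radius n" "radius n < 1" using n by (auto simp: radius_def inverse_less_1_iff)
    have r2: "0 \<le> 1 - (radius n)^2" using r by (simp add: power_le_one)
    have "Re (herglotz_int (indicator C) ?z) = (\<integral>t. Re (herglotz ?z t) * indicator C t \<partial>circ)"
      by (rule Re_herglotz_int(1)[OF iC norm_radius_cis])
    also have "\<dots> \<le> (\<integral>t. 4 * \<bar>B\<bar> * (1 - (radius n)^2) \<partial>circ)"
    proof (rule integral_mono_AE)
      show "AE t in circ. Re (herglotz ?z t) * indicator C t \<le> 4 * \<bar>B\<bar> * (1 - (radius n)^2)"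
        using AE_circ_open_interval
      proof eventually_elim
        case (elim t)
        show ?case
        proof (cases "t \<in> C")
          case True
          define x where "x = norm (cis t - ?z)"
          define y where "y = norm (cis t - cis s)"
          have "y \<le> 2 * x" "0 < x"
            unfolding x_def y_def using double_pole_kernel_bound[of "cis t" "cis s" "radius n"] r by auto
          moreover have "y > 0" unfolding y_def using cis_eq_imp_eq[OF _ s(1), of t] elim True s(2) by auto
          ultimately have "1 / x^2 \<le> 4 / y^2"
            using power_mono[of y "2*x" 2] by (simp add: field_simps)
          also have "\<dots> \<le> 4 * \<bar>B\<bar>" using B[of t] elim True by (auto simp: y_def)
          finally have "(1 - (radius n)^2) * (1 / x^2) \<le> (1 - (radius n)^2) * (4 * \<bar>B\<bar>)"
            using r2 by (rule mult_left_mono)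
          then show ?thesis
            using True r by (subst Re_herglotz[OF norm_radius_cis]) (simp add: norm_mult x_def mult_ac)
        qed (use r2 in simp)
      qed
    qed (auto intro: Re_herglotz_int(2)[OF iC norm_radius_cis])
    finally show ?thesis by simp
  qed
  show ?thesis
  proof (rule tendsto_sandwich)
    show "(\<lambda>n. 0::real) \<longlonglongrightarrow> 0" by simp
    have "(\<lambda>n. 4 * \<bar>B\<bar> * (1 - (radius n)^2)) \<longlonglongrightarrow> 4 * \<bar>B\<bar> * (1 - 1^2)"
      by (intro tendsto_intros radius_LIMSEQ)
    then show "(\<lambda>n. 4 * \<bar>B\<bar> * (1 - (radius n)^2)) \<longlonglongrightarrow> 0" by simp
    show "\<forall>\<^sub>F n in sequentially. 0 \<le> Re (herglotz_int (indicator C) (of_real (radius n) * cis s))"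
      using iC by (intro always_eventually allI Re_herglotz_int_nonneg norm_radius_cis) auto
    show "\<forall>\<^sub>F n in sequentially. Re (herglotz_int (indicator C) (of_real (radius n) * cis s)) \<le> 4 * \<bar>B\<bar> * (1 - (radius n)^2)"
      using eventually_gt_at_top[of 0] by eventually_elim (rule le)
  qed
qed

lemma AE_eq_if_le_integral_eq:
  fixes f g :: "real \<Rightarrow> real"
  assumes "integrable circ f" "integrable circ g" "AE t in circ. f t \<le> g t"
    "(\<integral>t. f t \<partial>circ) = (\<integral>t. g t \<partial>circ)"
  shows "AE t in circ. f t = g t"
proof -
  have "(\<integral>t. g t - f t \<partial>circ) = 0" using assms by simp
  moreover have "AE t in circ. 0 \<le> g t - f t" using assms(3) by eventually_elim simp
  ultimately have "AE t in circ. g t - f t = 0"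
    using integral_nonneg_eq_0_iff_AE[of circ "\<lambda>t. g t - f t"] assms by simp
  then show ?thesis by eventually_elim simp
qed

text \<open>The upper bound is pointwise: the limit is 0 off \<open>C\<close> and at most 1 on it.
  Equal means turn the inequality into equality a.e.\<close>

lemma bdry_indicator_closed:
  assumes C: "closed C"
  shows "AE t in circ. Re (bdry (herglotz_int (indicator C)) t) = indicator C t"
proof -
  have iC: "integrable circ (indicator C :: real \<Rightarrow> real)"
    using C by (intro integrable_indicator_circ) auto
  have nn: "0 \<le> (indicator C t :: real)" "(indicator C t :: real) \<le> 1" for t by (auto simp: indicator_def)
  show ?thesis
  proof (rule AE_eq_if_le_integral_eq[OF Re_bdry_herglotz_int_bounded(2)[OF iC nn] iC _ Re_bdry_herglotz_int_bounded(3)[OF iC nn]])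
    show "AE t in circ. Re (bdry (herglotz_int (indicator C)) t) \<le> indicator C t"
      using AE_circ_open_interval Re_bdry_herglotz_int_bounded(1)[OF iC nn] herglotz_int_bdry_LIMSEQ[OF iC nn(1)]
    proof eventually_elim
      case (elim t)
      show ?case
      proof (cases "t \<in> C")
        case False
        from LIMSEQ_unique[OF elim(3) herglotz_int_indicator_closed_off[OF C elim(1) False]] show ?thesis by simp
      qed (use elim in simp)
    qed
  qed
qed

text \<open>Inner regularity supplies a compact \<open>K\<close> inside \<open>E\<close> of almost
  full measure; its boundary indicator lies below \<open>l\<close> by monotonicity, so the mean
  deficit of \<open>l\<close> on \<open>E\<close> is at most \<open>e\<close>. Equal means then rule
  out an excess as well.\<close>

lemma bdry_indicator:
  assumes E [measurable]: "E \<in> sets borel"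
  shows "AE t in circ. Re (bdry (herglotz_int (indicator E)) t) = indicator E t"
proof -
  define l where "l t = Re (bdry (herglotz_int (indicator E)) t)" for t
  note iE = integrable_indicator_circ[OF E]
  have nn: "0 \<le> (indicator E t :: real)" "(indicator E t :: real) \<le> 1" for t by (auto simp: indicator_def)
  have il: "integrable circ l" unfolding l_def[abs_def] by (rule Re_bdry_herglotz_int_bounded(2)[OF iE nn])
  have ih: "integrable circ (\<lambda>t. max (indicator E t - l t) 0)" using il iE by auto
  have "(\<integral>t. max (indicator E t - l t) 0 \<partial>circ) \<le> 0"
  proof (rule field_le_epsilon)
    fix e :: real assume e: "e > 0"
    have "\<exists>K. K \<subseteq> E \<and> compact K \<and> measure circ E - e \<le> measure circ K"
    proof (cases "measure circ E - e < 0")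
      case True
      then show ?thesis by (intro exI[of _ "{}"]) auto
    next
      case False
      have "ennreal (measure circ E - e) < ennreal (measure circ E)"
        using e False by (intro ennreal_lessI) auto
      also have "\<dots> = emeasure circ E" by (simp add: circ.emeasure_eq_measure)
      also have "\<dots> = (SUP K \<in> {K. K \<subseteq> E \<and> compact K}. emeasure circ K)"
        by (rule inner_regular) auto
      finally obtain K where "K \<subseteq> E" "compact K" "ennreal (measure circ E - e) < emeasure circ K"
        by (auto simp: less_SUP_iff)
      then show ?thesis
        by (intro exI[of _ K]) (use False in \<open>auto simp: circ.emeasure_eq_measure ennreal_less_iff\<close>)
    qed
    then obtain K where K: "K \<subseteq> E" "compact K" "measure circ E - e \<le> measure circ K" by blast
    have Kc: "closed K" and Kb [measurable]: "K \<in> sets borel" using K(2) by (auto intro: compact_imp_closed borel_closed)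
    note iK = integrable_indicator_circ[OF Kb]
    have le: "(indicator K t :: real) \<le> indicator E t" "0 \<le> (indicator K t :: real)" for t
      using K(1) by (auto simp: indicator_def)
    have "AE t in circ. max (indicator E t - l t) 0 \<le> indicator E t - indicator K t"
      using bdry_indicator_closed[OF Kc] Re_bdry_herglotz_int_mono[OF iK iE le(2) le(1)]
    proof eventually_elim
      case (elim t)
      have "(indicator K t :: real) \<le> l t"
        using elim unfolding l_def by simp
      then show ?case using le(1)[of t] by simp
    qed
    then have "(\<integral>t. max (indicator E t - l t) 0 \<partial>circ) \<le> (\<integral>t. indicator E t - indicator K t \<partial>circ)"
      by (intro integral_mono_AE ih Bochner_Integration.integrable_diff iE iK)
    also have "\<dots> = measure circ E - measure circ K" using iE iK by simp
    finally show "(\<integral>t. max (indicator E t - l t) 0 \<partial>circ) \<le> 0 + e" using K(3) by simp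
  qed
  moreover have "0 \<le> (\<integral>t. max (indicator E t - l t) 0 \<partial>circ)" by (rule Bochner_Integration.integral_nonneg) simp
  ultimately have "(\<integral>t. max (indicator E t - l t) 0 \<partial>circ) = 0" by simp
  then have "AE t in circ. max (indicator E t - l t) 0 = 0"
    using integral_nonneg_eq_0_iff_AE[OF ih] by simp
  then have "AE t in circ. indicator E t \<le> l t" by eventually_elim (simp add: max_def split: if_splits)
  then have "AE t in circ. indicator E t = l t"
    by (rule AE_eq_if_le_integral_eq[OF iE il])
       (simp only: l_def Re_bdry_herglotz_int_bounded(3)[OF iE nn])
  then show ?thesis by (simp add: l_def eq_commute)
qed

text \<open>The squared moduli of \<open>1 + g\<close> and \<open>1 - g\<close> differ by
  \<open>4 * Re g\<close>, and \<open>2 * norm g \<le> (norm (1 + g))^2\<close>. The factor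
  \<open>norm g\<close> in the third bound matters: dividing by it leaves twice the cosine of the
  argument of \<open>g\<close>, with no trace of its possibly unbounded modulus.\<close>

lemma cayley_right_half_plane:
  fixes g :: complex
  assumes "0 \<le> Re g"
  shows "1 + g \<noteq> 0" "norm ((1 - g) / (1 + g)) \<le> 1"
    "(1 - norm ((1 - g) / (1 + g))^2) * norm g \<le> 2 * Re g"
proof -
  show nz: "1 + g \<noteq> 0" using assms by (auto simp: complex_eq_iff)
  have sq: "(norm (1 + g))^2 - (norm (1 - g))^2 = 4 * Re g"
    unfolding cmod_power2 by (simp add: power2_eq_square algebra_simps)
  then have "(norm (1 - g))^2 \<le> (norm (1 + g))^2" using assms by linarith
  then have "norm (1 - g) \<le> norm (1 + g)" by (rule power2_le_imp_le) simp
  then show "norm ((1 - g) / (1 + g)) \<le> 1" using nz by (simp add: norm_divide divide_le_eq)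
  have pos: "0 < (norm (1 + g))^2" using nz by simp
  have "2 * norm g \<le> 1 + (norm g)^2" using zero_le_power2[of "1 - norm g"] by (simp add: power2_eq_square algebra_simps)
  also have "\<dots> \<le> (norm (1 + g))^2"
    using assms unfolding cmod_power2 by (simp add: power2_eq_square algebra_simps)
  finally have le: "2 * norm g \<le> (norm (1 + g))^2" .
  have "1 - norm ((1 - g) / (1 + g))^2 = 4 * Re g / (norm (1 + g))^2"
    unfolding norm_divide power_divide sq[symmetric] using pos by (simp add: diff_divide_distrib)
  then have "(1 - norm ((1 - g) / (1 + g))^2) * norm g = 2 * Re g * (2 * norm g / (norm (1 + g))^2)" by simp
  also have "\<dots> \<le> 2 * Re g * 1" using assms le pos by (intro mult_left_mono) (auto simp: divide_le_eq)
  finally show "(1 - norm ((1 - g) / (1 + g))^2) * norm g \<le> 2 * Re g" by simp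
qed

text \<open>With \<open>s\<close> the Herglotz integral of the indicator, the exponential
  \<open>g\<close> has argument \<open>pi * (Re (s z) - 1/2)\<close>, between \<open>- pi/2\<close>
  and \<open>pi/2\<close>, so its Cayley transform stays in the closed disk. A.e. on the circle the
  real part is 0 or 1, the argument is a right angle, and the transform has modulus 1. The Cayley
  map is an involution, so \<open>g\<close> is recovered from
  \<open>\<i> * \<phi> z\<close>.\<close>

lemma inner_fun_of_set:
  assumes E: "E \<in> sets borel"
  obtains \<phi> where "inner_fun \<phi>"
    "\<And>z. norm z < 1 \<Longrightarrow> (1 - \<i> * \<phi> z) / (1 + \<i> * \<phi> z) = exp (\<i> * of_real pi * (herglotz_int (indicator E) z - 1/2))"
    "\<And>z. norm z < 1 \<Longrightarrow> (1 + \<i> * \<phi> z) / (1 - \<i> * \<phi> z) = exp (- \<i> * of_real pi * (herglotz_int (indicator E) z - 1/2))"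
proof -
  define s where "s = herglotz_int (indicator E)"
  define g where "g z = exp (\<i> * of_real pi * (s z - 1/2))" for z
  define \<phi> where "\<phi> z = - \<i> * ((1 - g z) / (1 + g z))" for z
  note iE = integrable_indicator_circ[OF E]
  have nn: "0 \<le> (indicator E t :: real)" "(indicator E t :: real) \<le> 1" for t by (auto simp: indicator_def)
  have s01: "0 \<le> Re (s z)" "Re (s z) \<le> 1" if "norm z < 1" for z
    unfolding s_def using Re_herglotz_int_nonneg[OF iE nn(1) that] Re_herglotz_int_le[OF iE nn(2) that] by auto
  have Reg: "Re (g z) = norm (g z) * cos (pi * (Re (s z) - 1/2))" for z
    by (simp add: g_def Re_exp norm_exp)
  have cosn: "0 \<le> cos (pi * (Re (s z) - 1/2))" if "norm z < 1" for z
  proof (rule cos_ge_zero)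
    have "pi * (-1/2) \<le> pi * (Re (s z) - 1/2)" "pi * (Re (s z) - 1/2) \<le> pi * (1/2)"
      using s01[OF that] by (intro mult_left_mono; simp)+
    then show "- (pi/2) \<le> pi * (Re (s z) - 1/2)" "pi * (Re (s z) - 1/2) \<le> pi/2" by auto
  qed
  have Reg0: "0 \<le> Re (g z)" if "norm z < 1" for z unfolding Reg using cosn[OF that] by simp
  have hs: "s holomorphic_on ball 0 1" unfolding s_def by (rule holomorphic_herglotz_int[OF iE])
  have hg: "g holomorphic_on ball 0 1" unfolding g_def[abs_def] by (intro holomorphic_intros hs)
  have h\<phi>: "\<phi> \<in> Hinf"
  proof -
    have "\<phi> holomorphic_on ball 0 1"
      unfolding \<phi>_def[abs_def] using cayley_right_half_plane(1)[OF Reg0] by (intro holomorphic_intros hg) auto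
    moreover have "bounded (\<phi> ` ball 0 1)"
      unfolding bounded_iff using cayley_right_half_plane(2)[OF Reg0]
      by (intro exI[of _ 1]) (auto simp: \<phi>_def norm_mult norm_divide)
    ultimately show ?thesis by (simp add: Hinf_def)
  qed
  have n\<phi>: "norm (\<phi> z) \<le> 1" "1 - (norm (\<phi> z))^2 \<le> 2 * cos (pi * (Re (s z) - 1/2))" if "norm z < 1" for z
  proof -
    have e: "norm (\<phi> z) = norm ((1 - g z) / (1 + g z))" by (simp add: \<phi>_def norm_mult norm_divide)
    show "norm (\<phi> z) \<le> 1" unfolding e by (rule cayley_right_half_plane(2)[OF Reg0[OF that]])
    have "(1 - (norm (\<phi> z))^2) * norm (g z) \<le> 2 * cos (pi * (Re (s z) - 1/2)) * norm (g z)"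
      using cayley_right_half_plane(3)[OF Reg0[OF that]] unfolding e Reg by (simp add: mult_ac)
    moreover have "norm (g z) > 0" by (simp add: g_def)
    ultimately show "1 - (norm (\<phi> z))^2 \<le> 2 * cos (pi * (Re (s z) - 1/2))"
      by (rule mult_right_le_imp_le)
  qed
  \<comment> \<open>Only the real part of \<open>s\<close> is followed to the boundary, through the
    cosine bound on \<open>1 - (norm (\<phi> z))^2\<close>; the radial limit of
    \<open>\<phi>\<close> itself comes from Fatou's theorem for bounded functions.\<close>
  have "AE t in circ. radial_limit \<phi> t (bdry \<phi> t) \<and> norm (bdry \<phi> t) = 1"
    using Hinf_bdry[OF h\<phi>] herglotz_int_bdry_LIMSEQ[OF iE nn(1)] bdry_indicator[OF E]
  proof eventually_elim
    case (elim t)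
    let ?z = "\<lambda>n. of_real (radius n) * cis t"
    have lim: "(\<lambda>n. \<phi> (?z n)) \<longlonglongrightarrow> bdry \<phi> t" by (rule radial_limit_LIMSEQ[OF elim(1)])
    have "(\<lambda>n. Re (s (?z n))) \<longlonglongrightarrow> indicator E t" using elim(2,3) by (simp add: s_def)
    then have "(\<lambda>n. 2 * cos (pi * (Re (s (?z n)) - 1/2))) \<longlonglongrightarrow> 2 * cos (pi * (indicator E t - 1/2))"
      by (intro tendsto_intros)
    moreover have "cos (pi * (indicator E t - 1/2)) = 0" by (auto simp: indicator_def)
    ultimately have c0: "(\<lambda>n. 2 * cos (pi * (Re (s (?z n)) - 1/2))) \<longlonglongrightarrow> 0" by simp
    have "(\<lambda>n. 1 - (norm (\<phi> (?z n)))^2) \<longlonglongrightarrow> 1 - (norm (bdry \<phi> t))^2"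
      by (intro tendsto_intros lim)
    from LIMSEQ_le[OF this c0] have "1 - (norm (bdry \<phi> t))^2 \<le> 0"
      using n\<phi>(2)[OF norm_radius_cis] by auto
    then have "1 \<le> norm (bdry \<phi> t)"
      by (metis abs_norm_cancel abs_square_less_1 diff_gt_0_iff_gt not_le)
    moreover have "norm (bdry \<phi> t) \<le> 1"
      by (rule LIMSEQ_le_const2[OF tendsto_norm[OF lim]]) (use n\<phi>(1)[OF norm_radius_cis] in auto)
    ultimately show ?case using elim(1) by simp
  qed
  then have "AE t in lborel. t \<in> {0..2*pi} \<longrightarrow> (\<exists>L. radial_limit \<phi> t L \<and> norm L = 1)"
    unfolding AE_circ by eventually_elim blast
  then have inner: "inner_fun \<phi>" using h\<phi> by (simp add: inner_fun_def)
  have ig: "\<i> * \<phi> z = (1 - g z) / (1 + g z)" for z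
    by (simp only: \<phi>_def mult.assoc[symmetric]) simp
  have eq1: "(1 - \<i> * \<phi> z) / (1 + \<i> * \<phi> z) = g z" and eq2: "(1 + \<i> * \<phi> z) / (1 - \<i> * \<phi> z) = inverse (g z)" if "norm z < 1" for z
  proof -
    have nz: "1 + g z \<noteq> 0" by (rule cayley_right_half_plane(1)[OF Reg0[OF that]])
    have gnz: "g z \<noteq> 0" by (simp add: g_def)
    have gen: "(x * y) / x = y" "x / (x * y) = inverse y" if "x \<noteq> 0" "y \<noteq> 0" for x y :: complex
      using that by (simp_all add: field_simps)
    have a: "1 - \<i> * \<phi> z = 2 / (1 + g z) * g z" "1 + \<i> * \<phi> z = 2 / (1 + g z)"
      unfolding ig using nz by (simp_all add: field_simps)
    show "(1 - \<i> * \<phi> z) / (1 + \<i> * \<phi> z) = g z" "(1 + \<i> * \<phi> z) / (1 - \<i> * \<phi> z) = inverse (g z)"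
      unfolding a by (rule gen; use nz gnz in simp)+
  qed
  show ?thesis
  proof (rule that[OF inner])
    fix z :: complex assume z: "norm z < 1"
    show "(1 - \<i> * \<phi> z) / (1 + \<i> * \<phi> z) = exp (\<i> * of_real pi * (herglotz_int (indicator E) z - 1/2))"
      using eq1[OF z] by (simp add: g_def s_def)
    show "(1 + \<i> * \<phi> z) / (1 - \<i> * \<phi> z) = exp (- \<i> * of_real pi * (herglotz_int (indicator E) z - 1/2))"
      using eq2[OF z] by (simp add: g_def s_def exp_minus[symmetric])
  qed
qed

section \<open>Truncation of the boundary argument\<close>

lemma saturation_parts:
  fixes P :: complex and m :: real
  assumes m: "m > 0" and P: "0 \<le> Re P"
  defines "D \<equiv> (1 + Re P / m)^2 + (Im P / m)^2"
  shows "Re (P / (1 + P / of_real m)) = Re P * (1 + Re P / m) / D + (Im P)^2 / m / D"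
    and "Im (P / (1 + P / of_real m)) = Im P / D"
    and "1 \<le> D"
    and "norm (P / (1 + P / of_real m)) \<le> m"
    and "1 \<le> norm (1 + P / of_real m)"
proof -
  have "1 \<le> (1 + Re P / m)^2" using m P by (simp add: one_le_power)
  then show D: "1 \<le> D" unfolding D_def by (simp add: add_increasing2)
  have y: "Re (1 + P / of_real m) = 1 + Re P / m" "Im (1 + P / of_real m) = Im P / m"
    by (simp_all add: Re_divide_of_real Im_divide_of_real)
  have "Re (P / (1 + P / of_real m)) = (Re P * (1 + Re P / m) + Im P * (Im P / m)) / D"
    unfolding Re_divide y D_def ..
  then show "Re (P / (1 + P / of_real m)) = Re P * (1 + Re P / m) / D + (Im P)^2 / m / D"
    by (simp add: add_divide_distrib power2_eq_square)
  have "Im (P / (1 + P / of_real m)) = (Im P * (1 + Re P / m) - Re P * (Im P / m)) / D"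
    unfolding Im_divide y D_def ..
  then show "Im (P / (1 + P / of_real m)) = Im P / D" by (simp add: algebra_simps)
  have "Re (1 + P / of_real m) \<ge> 1" using m P by simp
  then show g: "1 \<le> norm (1 + P / of_real m)" using complex_Re_le_cmod order_trans by blast
  have "norm (P / of_real m) \<le> norm (1 + P / of_real m)"
    using m P unfolding cmod_def by (intro real_sqrt_le_mono add_right_mono power_mono) auto
  then have "norm P \<le> m * norm (1 + P / of_real m)"
    using m by (simp add: norm_divide field_simps)
  then show "norm (P / (1 + P / of_real m)) \<le> m"
    using g m by (simp add: norm_divide divide_le_eq)
qed

text \<open>With \<open>P = A + i B\<close>, the three summands bound, respectively, the mass on \<open>\<bar>B\<bar> > m/4\<close> for small \<open>A\<close>,
  the mass for large \<open>A\<close>, and the part of \<open>B - Im (P / (1 + P/m))\<close> that is linear in \<open>A\<close>.\<close>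

definition sat_error :: "real \<Rightarrow> complex \<Rightarrow> real" where
  "sat_error m P = (let D = (1 + Re P / m)^2 + (Im P / m)^2 in
     65 * ((Im P)^2 / m / D) + (if Re P > m then Re P else 0)
     + Re P * (\<bar>Im P\<bar> / m) * (2 + Re P / m) / D)"

lemma sat_error_bounds:
  assumes m: "m > 0" and P: "0 \<le> Re P"
  shows "0 \<le> sat_error m P"
    and "\<bar>Im P\<bar> > m / 4 \<Longrightarrow> m \<le> sat_error m P"
    and "\<bar>Im P\<bar> \<le> m / 4 \<Longrightarrow> \<bar>Im P - Im (P / (1 + P / of_real m))\<bar> \<le> sat_error m P"
proof -
  define a b where "a = Re P / m" and "b = \<bar>Im P\<bar> / m"
  define D where "D = (1 + a)^2 + b^2"
  have a: "0 \<le> a" and b: "0 \<le> b" using m P by (auto simp: a_def b_def)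
  have RP: "Re P = m * a" and IP: "\<bar>Im P\<bar> = m * b" and IP2: "(Im P)^2 = m^2 * b^2"
    using m by (auto simp: a_def b_def power_divide power2_abs)
  have D': "(1 + Re P / m)^2 + (Im P / m)^2 = D" by (simp add: D_def a_def b_def power_divide)
  have D: "1 \<le> D" using saturation_parts(3)[OF m P] by (simp add: D')
  have E: "sat_error m P = 65 * (m * b^2 / D) + (if Re P > m then Re P else 0) + m * a * b * (2 + a) / D"
  proof -
    have "(Im P)^2 / m = m * b^2" unfolding IP2 using m by (simp add: power2_eq_square)
    moreover have "Re P * (\<bar>Im P\<bar> / m) * (2 + Re P / m) = m * a * b * (2 + a)"
      unfolding a_def[symmetric] b_def[symmetric] by (simp only: RP)
    ultimately show ?thesis unfolding sat_error_def Let_def D' by (simp only:)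
  qed
  have t1: "0 \<le> m * b^2 / D" and t2: "0 \<le> (if Re P > m then Re P else 0)" and t3: "0 \<le> m * a * b * (2 + a) / D"
    using m D a b P by auto
  show "0 \<le> sat_error m P" unfolding E using t1 t2 t3 by linarith
  show "m \<le> sat_error m P" if "\<bar>Im P\<bar> > m / 4"
  proof (cases "Re P > m")
    case True
    then show ?thesis unfolding E using t1 t3 by simp
  next
    case False
    then have a1: "a \<le> 1" using m by (simp add: a_def divide_le_eq)
    have b4: "1/4 \<le> b" using that m by (simp add: b_def field_simps)
    have "(1 + a)^2 \<le> 2^2" using a a1 by (intro power_mono) auto
    moreover have "(1/4)^2 \<le> b^2" using b4 by (intro power_mono) auto
    \<comment> \<open>\<open>(1 + a)^2 \<le> 4 = 64 * (1/4)^2 \<le> 64 * b^2\<close>; adding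
      \<open>b^2\<close> explains the weight 65 in \<open>sat_error\<close>.\<close>
    ultimately have "D \<le> 65 * b^2" unfolding D_def by (simp add: power2_eq_square)
    then have "1 \<le> 65 * b^2 / D" using D by (simp add: le_divide_eq)
    then have "m * 1 \<le> m * (65 * b^2 / D)" using m by (intro mult_left_mono) auto
    then show ?thesis unfolding E using t2 t3 by (simp add: mult_ac)
  qed
  show "\<bar>Im P - Im (P / (1 + P / of_real m))\<bar> \<le> sat_error m P" if "\<bar>Im P\<bar> \<le> m / 4"
  proof -
    have b4: "b \<le> 1/4" using that m by (simp add: b_def field_simps)
    have "Im P - Im (P / (1 + P / of_real m)) = Im P * ((D - 1) / D)"
      unfolding saturation_parts(2)[OF m P] D' using D by (simp add: field_simps)
    then have "\<bar>Im P - Im (P / (1 + P / of_real m))\<bar> = m * b * ((D - 1) / D)"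
      using D by (simp add: abs_mult IP)
    \<comment> \<open>\<open>D - 1 = a * (2 + a) + b^2\<close>: the first summand gives the third
      term of \<open>sat_error\<close>, the second a cubic remainder that \<open>b \<le> 1/4\<close>
      lets the first term absorb.\<close>
    also have "\<dots> = m * a * b * (2 + a) / D + b * (m * b^2 / D)"
      unfolding D_def by (simp add: add_divide_distrib[symmetric]) (simp add: power2_eq_square algebra_simps)
    also have "\<dots> \<le> m * a * b * (2 + a) / D + 65 * (m * b^2 / D)"
      using b4 t1 by (intro add_left_mono mult_right_mono) auto
    also have "\<dots> \<le> sat_error m P" unfolding E using t2 by simp
    finally show ?thesis .
  qed
qed

text \<open>The bounds are uniform in \<open>m\<close>, so \<open>Re P\<close> serves as majorant
  for dominated convergence. The first rests on
  \<open>b * (2 + a) \<le> 2 * b * (1 + a) \<le> (1 + a)^2 + b^2\<close>, the second on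
  \<open>1 + a \<le> (1 + a)^2\<close>.\<close>

lemma saturation_dominated:
  assumes m: "m > 0" and P: "0 \<le> Re P"
  defines "D \<equiv> (1 + Re P / m)^2 + (Im P / m)^2"
  shows "0 \<le> Re P * (\<bar>Im P\<bar> / m) * (2 + Re P / m) / D" "Re P * (\<bar>Im P\<bar> / m) * (2 + Re P / m) / D \<le> Re P"
    and "0 \<le> Re P * (1 + Re P / m) / D" "Re P * (1 + Re P / m) / D \<le> Re P"
proof -
  define a b where "a = Re P / m" and "b = \<bar>Im P\<bar> / m"
  have a: "0 \<le> a" and b: "0 \<le> b" using m P by (auto simp: a_def b_def)
  have D': "D = (1 + a)^2 + b^2" by (simp add: D_def a_def b_def power_divide)
  have D: "1 \<le> D" using saturation_parts(3)[OF m P] by (simp add: D_def)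
  have "0 \<le> (1 + a - b)^2" by simp
  then have "2 * (b * (1 + a)) \<le> D" unfolding D' by (simp add: power2_eq_square algebra_simps)
  moreover have "b * (2 + a) \<le> 2 * (b * (1 + a))" using a b by (simp add: algebra_simps)
  ultimately have "b * (2 + a) / D \<le> 1" using D by (simp add: divide_le_eq)
  then have "Re P * (b * (2 + a) / D) \<le> Re P * 1" using P by (intro mult_left_mono)
  then show "Re P * (\<bar>Im P\<bar> / m) * (2 + Re P / m) / D \<le> Re P" by (simp add: a_def b_def mult.assoc)
  show "0 \<le> Re P * (\<bar>Im P\<bar> / m) * (2 + Re P / m) / D" "0 \<le> Re P * (1 + Re P / m) / D" using m P D by auto
  have "(1 + a) * 1 \<le> (1 + a)^2" unfolding power2_eq_square using a by (intro mult_left_mono) auto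
  then have "1 + a \<le> D" unfolding D' by (simp add: add_increasing2)
  then have "(1 + a) / D \<le> 1" using D by (simp add: divide_le_eq)
  then have "Re P * ((1 + a) / D) \<le> Re P * 1" using P by (intro mult_left_mono)
  then show "Re P * (1 + Re P / m) / D \<le> Re P" by (simp add: a_def)
qed

text \<open>Reciprocals are shifted by \<open>1/m\<close>, so this Moebius map takes the right
  half-plane onto the disk with diameter from 0 to \<open>m\<close>: bounded for each
  \<open>m\<close>, yet tending to the identity as \<open>m\<close> grows.\<close>

definition saturate :: "real \<Rightarrow> (complex \<Rightarrow> complex) \<Rightarrow> complex \<Rightarrow> complex" where
  "saturate m p z = p z / (1 + p z / of_real m)"

lemma saturate_Hinf:
  assumes "p holomorphic_on ball 0 1" "\<And>z. norm z < 1 \<Longrightarrow> 0 \<le> Re (p z)" and m: "m > 0"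
  shows "saturate m p \<in> Hinf"
proof -
  have "1 + p z / of_real m \<noteq> 0" if "norm z < 1" for z
    using saturation_parts(5)[OF m assms(2)[OF that]] by auto
  then have "saturate m p holomorphic_on ball 0 1"
    unfolding saturate_def[abs_def] using m by (intro holomorphic_intros assms) auto
  moreover have "bounded (saturate m p ` ball 0 1)"
    unfolding bounded_iff saturate_def using saturation_parts(4)[OF m assms(2)] by (intro exI[of _ m]) auto
  ultimately show ?thesis by (simp add: Hinf_def)
qed

lemma bdry_saturate:
  assumes "radial_limit p t P" "0 \<le> Re P" "m > 0"
  shows "bdry (saturate m p) t = P / (1 + P / of_real m)"
proof (rule radial_limit_bdry)
  have "1 + P / of_real m \<noteq> 0" using saturation_parts(5)[OF assms(3,2)] by auto
  then show "radial_limit (saturate m p) t (P / (1 + P / of_real m))"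
    using assms(1,3) unfolding radial_limit_def saturate_def by (intro tendsto_intros) auto
qed

text \<open>The terms \<open>Y\<close> and \<open>R\<close> are dominated by \<open>Re (P t)\<close>
  and tend to 0 pointwise. The term \<open>W\<close> contains the square of \<open>Im (P t)\<close>,
  for which no majorant is at hand; its mean is computed instead, as
  \<open>Re (saturate (m n) p 0)\<close> minus the mean of \<open>X\<close>. Both tend to the mean
  of \<open>u\<close>, the second because the boundary real part has that mean.\<close>

lemma sat_error_integral:
  fixes m :: "nat \<Rightarrow> real"
  assumes u: "integrable circ u" "\<And>t. 0 \<le> u t"
    and m: "\<And>n. m n > 0" "filterlim m at_top sequentially"
  defines "P \<equiv> bdry (herglotz_int u)"
  shows "integrable circ (\<lambda>t. sat_error (m n) (P t))"
    and "(\<lambda>n. \<integral>t. sat_error (m n) (P t) \<partial>circ) \<longlonglongrightarrow> 0"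
proof -
  define p where "p = herglotz_int u"
  have hol: "p holomorphic_on ball 0 1" unfolding p_def by (rule holomorphic_herglotz_int[OF u(1)])
  have pos: "0 \<le> Re (p z)" if "norm z < 1" for z unfolding p_def by (rule Re_herglotz_int_nonneg[OF u that])
  note Q = saturate_Hinf[OF hol pos m(1)]
  have [measurable]: "P \<in> borel_measurable borel"
    unfolding P_def by (rule measurable_bdry[OF hol[unfolded p_def]])
  have P0: "AE t in circ. 0 \<le> Re (P t)" unfolding P_def by (rule Re_bdry_herglotz_int_nonneg[OF u])
  have iA: "integrable circ (\<lambda>t. Re (P t))" and intA: "(\<integral>t. Re (P t) \<partial>circ) = (\<integral>t. u t \<partial>circ)"
    unfolding P_def by (rule Re_bdry_herglotz_int[OF u])+
  have minf: "(\<lambda>n. c / m n) \<longlonglongrightarrow> 0" for c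
    by (rule tendsto_divide_0[OF tendsto_const filterlim_at_top_imp_at_infinity[OF m(2)]])
  define D where "D n t = (1 + Re (P t) / m n)^2 + (Im (P t) / m n)^2" for n t
  define W where "W n t = (Im (P t))^2 / m n / D n t" for n t
  define X where "X n t = Re (P t) * (1 + Re (P t) / m n) / D n t" for n t
  define Y where "Y n t = (if Re (P t) > m n then Re (P t) else 0)" for n t
  define R where "R n t = Re (P t) * (\<bar>Im (P t)\<bar> / m n) * (2 + Re (P t) / m n) / D n t" for n t
  have [measurable]: "D n \<in> borel_measurable borel" for n unfolding D_def[abs_def] by measurable
  have [measurable]: "X n \<in> borel_measurable borel" "Y n \<in> borel_measurable borel" "R n \<in> borel_measurable borel" for n
    unfolding X_def[abs_def] Y_def[abs_def] R_def[abs_def] by measurable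
  have Dlim: "(\<lambda>n. D n t) \<longlonglongrightarrow> 1" for t
  proof -
    have "(\<lambda>n. D n t) \<longlonglongrightarrow> (1 + 0)^2 + 0^2" unfolding D_def by (intro tendsto_intros minf)
    then show ?thesis by simp
  qed
  have Xb: "AE t in circ. norm (X n t) \<le> Re (P t)" for n
    using P0
  proof eventually_elim
    case (elim t)
    from saturation_dominated(3,4)[OF m(1)[of n] elim] show ?case
      by (simp only: X_def D_def real_norm_def abs_of_nonneg)
  qed
  have Yb: "AE t in circ. norm (Y n t) \<le> Re (P t)" for n
    using P0 by eventually_elim (auto simp: Y_def)
  have Rb: "AE t in circ. norm (R n t) \<le> Re (P t)" for n
    using P0
  proof eventually_elim
    case (elim t)
    from saturation_dominated(1,2)[OF m(1)[of n] elim] show ?case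
      by (simp only: R_def D_def real_norm_def abs_of_nonneg)
  qed
  have Xl: "AE t in circ. (\<lambda>n. X n t) \<longlonglongrightarrow> Re (P t)"
  proof (rule AE_I2)
    fix t
    have "(\<lambda>n. X n t) \<longlonglongrightarrow> Re (P t) * (1 + 0) / 1" unfolding X_def by (intro tendsto_intros minf Dlim) simp
    then show "(\<lambda>n. X n t) \<longlonglongrightarrow> Re (P t)" by simp
  qed
  have Yl: "AE t in circ. (\<lambda>n. Y n t) \<longlonglongrightarrow> 0"
  proof (rule AE_I2)
    fix t
    have "\<forall>\<^sub>F n in sequentially. Re (P t) \<le> m n" using m(2) by (simp add: filterlim_at_top)
    then have "\<forall>\<^sub>F n in sequentially. Y n t = 0" by eventually_elim (simp add: Y_def)
    then show "(\<lambda>n. Y n t) \<longlonglongrightarrow> 0" by (rule tendsto_eventually)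
  qed
  have Rl: "AE t in circ. (\<lambda>n. R n t) \<longlonglongrightarrow> 0"
  proof (rule AE_I2)
    fix t
    have "(\<lambda>n. R n t) \<longlonglongrightarrow> Re (P t) * 0 * (2 + 0) / 1" unfolding R_def by (intro tendsto_intros minf Dlim) simp
    then show "(\<lambda>n. R n t) \<longlonglongrightarrow> 0" by simp
  qed
  have ib: "integrable circ Z" if Z: "Z \<in> borel_measurable borel" "AE t in circ. norm (Z t) \<le> Re (P t)" for Z :: "real \<Rightarrow> real"
  proof (rule Bochner_Integration.integrable_bound[OF iA])
    show "AE t in circ. norm (Z t) \<le> norm (Re (P t))" using Z(2) by eventually_elim simp
  qed (use Z in auto)
  have iX: "integrable circ (X n)" and iY: "integrable circ (Y n)" and iR: "integrable circ (R n)" for n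
    by (rule ib[OF _ Xb] ib[OF _ Yb] ib[OF _ Rb], measurable)+
  have lX: "(\<lambda>n. \<integral>t. X n t \<partial>circ) \<longlonglongrightarrow> (\<integral>t. Re (P t) \<partial>circ)"
    by (rule integral_dominated_convergence[OF _ _ iA Xl Xb]) auto
  have lY: "(\<lambda>n. \<integral>t. Y n t \<partial>circ) \<longlonglongrightarrow> (\<integral>t. 0 \<partial>circ)"
    by (rule integral_dominated_convergence[OF _ _ iA Yl Yb]) auto
  have lR: "(\<lambda>n. \<integral>t. R n t \<partial>circ) \<longlonglongrightarrow> (\<integral>t. 0 \<partial>circ)"
    by (rule integral_dominated_convergence[OF _ _ iA Rl Rb]) auto
  have ReQ: "AE t in circ. Re (bdry (saturate (m n) p) t) = X n t + W n t" for n
    using herglotz_int_radial_limit[OF u] P0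
    by eventually_elim
       (subst bdry_saturate[OF _ _ m(1)], auto simp: p_def P_def X_def W_def D_def saturation_parts(1)[OF m(1)])
  have iReQ: "integrable circ (\<lambda>t. Re (bdry (saturate (m n) p) t))" for n
    by (rule integrable_Re[OF integrable_bdry[OF Q]])
  have WQ: "AE t in circ. Re (bdry (saturate (m n) p) t) - X n t = W n t" for n
    using ReQ[of n] by eventually_elim simp
  have [measurable]: "W n \<in> borel_measurable borel" for n unfolding W_def[abs_def] by measurable
  have iW: "integrable circ (W n)" for n
    by (rule Bochner_Integration.integrable_cong_AE_imp[OF Bochner_Integration.integrable_diff[OF iReQ iX]]) (use WQ in auto)
  have intW: "(\<integral>t. W n t \<partial>circ) = Re (saturate (m n) p 0) - (\<integral>t. X n t \<partial>circ)" for n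
  proof -
    have "(\<integral>t. W n t \<partial>circ) = (\<integral>t. Re (bdry (saturate (m n) p) t) - X n t \<partial>circ)"
      by (rule integral_cong_AE) (use WQ[of n] borel_measurable_integrable[OF iReQ] in \<open>auto simp: eq_commute\<close>)
    then show ?thesis using iReQ iX by (simp add: integral_Re_bdry[OF Q])
  qed
  have "(\<lambda>n. Re (p 0 / (1 + p 0 / of_real (m n)))) \<longlonglongrightarrow> Re (p 0 / (1 + 0))"
  proof (intro tendsto_intros)
    have "(\<lambda>n. complex_of_real (1 / m n)) \<longlonglongrightarrow> of_real 0" by (intro tendsto_of_real minf)
    then have "(\<lambda>n. p 0 * complex_of_real (1 / m n)) \<longlonglongrightarrow> p 0 * of_real 0" by (rule tendsto_mult_left)
    then show "(\<lambda>n. p 0 / of_real (m n)) \<longlonglongrightarrow> 0" by simp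
  qed simp
  then have "(\<lambda>n. Re (saturate (m n) p 0)) \<longlonglongrightarrow> (\<integral>t. u t \<partial>circ)"
    by (simp add: saturate_def p_def herglotz_int_0)
  then have lW: "(\<lambda>n. \<integral>t. W n t \<partial>circ) \<longlonglongrightarrow> (\<integral>t. u t \<partial>circ) - (\<integral>t. Re (P t) \<partial>circ)"
    unfolding intW by (rule tendsto_diff[OF _ lX])
  have eq: "sat_error (m n) (P t) = 65 * W n t + Y n t + R n t" for n t
    by (simp add: sat_error_def Let_def W_def Y_def R_def D_def)
  show "integrable circ (\<lambda>t. sat_error (m n) (P t))"
    unfolding eq using iW iY iR by auto
  have "(\<integral>t. sat_error (m n) (P t) \<partial>circ) = 65 * (\<integral>t. W n t \<partial>circ) + (\<integral>t. Y n t \<partial>circ) + (\<integral>t. R n t \<partial>circ)" for n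
    unfolding eq using iW[of n] iY[of n] iR[of n] by simp
  moreover have "(\<lambda>n. 65 * (\<integral>t. W n t \<partial>circ) + (\<integral>t. Y n t \<partial>circ) + (\<integral>t. R n t \<partial>circ)) \<longlonglongrightarrow>
      65 * ((\<integral>t. u t \<partial>circ) - (\<integral>t. Re (P t) \<partial>circ)) + (\<integral>t. 0 \<partial>circ) + (\<integral>t. 0 \<partial>circ)"
    by (intro tendsto_intros lW lY lR)
  ultimately show "(\<lambda>n. \<integral>t. sat_error (m n) (P t) \<partial>circ) \<longlonglongrightarrow> 0"
    by (simp add: intA)
qed

definition trunc_at :: "real \<Rightarrow> real \<Rightarrow> real" where
  "trunc_at m x = max (- m) (min x m)"

lemma norm_saturate_diff_le:
  assumes "m > 0" "0 \<le> Re (p z)"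
  shows "norm (saturate m p z - p z) \<le> (norm (p z))^2 / m"
proof -
  note g = saturation_parts(5)[OF assms]
  then have nz: "1 + p z / of_real m \<noteq> 0" by auto
  have "saturate m p z - p z = - ((p z)^2 / of_real m) / (1 + p z / of_real m)"
    unfolding saturate_def using nz assms(1) by (simp add: field_simps power2_eq_square)
  also have "norm \<dots> = ((norm (p z))^2 / m) / norm (1 + p z / of_real m)"
    using assms(1) by (simp add: norm_divide norm_power norm_mult)
  also have "\<dots> \<le> ((norm (p z))^2 / m) / 1"
    using g assms(1) by (intro divide_left_mono) auto
  finally show ?thesis by simp
qed

text \<open>If both imaginary parts are at most \<open>m/4\<close> in modulus, the argument is at
  most \<open>m/2 + m/4 + m/4\<close> and is not truncated. Otherwise one error term is at least
  \<open>m\<close>, while the two sides differ by at most \<open>m + m/2 + 2 * m\<close>, hence the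
  factor 4.\<close>

lemma trunc_at_sat_error:
  assumes m: "m > 0" "2 * \<bar>\<alpha>\<bar> \<le> m" and P1: "0 \<le> Re P1" and P2: "0 \<le> Re P2"
  shows "\<bar>trunc_at m (\<alpha> + Im P1 - Im P2) - (\<alpha> + Im (P1 / (1 + P1 / of_real m)) - Im (P2 / (1 + P2 / of_real m)))\<bar>
     \<le> 4 * (sat_error m P1 + sat_error m P2)"
proof -
  define J1 J2 where "J1 = Im (P1 / (1 + P1 / of_real m))" and "J2 = Im (P2 / (1 + P2 / of_real m))"
  have J: "\<bar>J1\<bar> \<le> m" "\<bar>J2\<bar> \<le> m"
    unfolding J1_def J2_def using saturation_parts(4)[OF m(1)] P1 P2 abs_Im_le_cmod order_trans by blast+
  note e0 = sat_error_bounds(1)[OF m(1) P1] sat_error_bounds(1)[OF m(1) P2]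
  have c: "\<bar>trunc_at m x\<bar> \<le> m" for x using m by (auto simp: trunc_at_def)
  show ?thesis
  proof (cases "\<bar>Im P1\<bar> \<le> m / 4 \<and> \<bar>Im P2\<bar> \<le> m / 4")
    case True
    then have "trunc_at m (\<alpha> + Im P1 - Im P2) = \<alpha> + Im P1 - Im P2" using m by (auto simp: trunc_at_def)
    moreover have "\<bar>Im P1 - J1\<bar> \<le> sat_error m P1" "\<bar>Im P2 - J2\<bar> \<le> sat_error m P2"
      unfolding J1_def J2_def using True by (intro sat_error_bounds(3) m P1 P2; simp)+
    moreover have "\<bar>(\<alpha> + Im P1 - Im P2) - (\<alpha> + J1 - J2)\<bar> \<le> \<bar>Im P1 - J1\<bar> + \<bar>Im P2 - J2\<bar>"
      using abs_triangle_ineq4[of "Im P1 - J1" "Im P2 - J2"] by (simp add: algebra_simps)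
    ultimately show ?thesis using e0 unfolding J1_def[symmetric] J2_def[symmetric] by simp
  next
    case False
    then have "m \<le> sat_error m P1 + sat_error m P2"
      using sat_error_bounds(2)[OF m(1) P1] sat_error_bounds(2)[OF m(1) P2] e0 by linarith
    then have "4 * m \<le> 4 * (sat_error m P1 + sat_error m P2)" by simp
    moreover have "\<bar>trunc_at m (\<alpha> + Im P1 - Im P2) - (\<alpha> + J1 - J2)\<bar> \<le> 4 * m"
      using J c[of "\<alpha> + Im P1 - Im P2"] m by linarith
    ultimately show ?thesis unfolding J1_def[symmetric] J2_def[symmetric] by (rule order_trans[rotated])
  qed
qed

text \<open>The truncated argument is replaced by the boundary imaginary part of the saturated
  functions, at a cost \<open>h n\<close> that vanishes in mean. For these bounded functions the
  Herglotz integral is known exactly, and they converge to \<open>p1\<close>, \<open>p2\<close>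
  uniformly on the smaller disk.\<close>

lemma truncated_argument_limit:
  fixes m :: "nat \<Rightarrow> real"
  assumes u1: "integrable circ u1" "\<And>t. 0 \<le> u1 t" and u2: "integrable circ u2" "\<And>t. 0 \<le> u2 t"
    and m: "\<And>n. m n > 0" "filterlim m at_top sequentially" and \<rho>: "\<rho> < 1"
  defines "p1 \<equiv> herglotz_int u1" and "p2 \<equiv> herglotz_int u2"
  shows "uniform_limit (cball 0 \<rho>)
     (\<lambda>n z. \<i> * herglotz_int (\<lambda>t. trunc_at (m n) (\<alpha> + Im (bdry p1 t) - Im (bdry p2 t))) z)
     (\<lambda>z. \<i> * of_real \<alpha> + (p1 z - p1 0) - (p2 z - p2 0)) sequentially"
proof -
  have hol: "p1 holomorphic_on ball 0 1" "p2 holomorphic_on ball 0 1"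
    unfolding p1_def p2_def by (rule holomorphic_herglotz_int u1 u2)+
  have pos: "0 \<le> Re (p1 z)" "0 \<le> Re (p2 z)" if "norm z < 1" for z
    unfolding p1_def p2_def using that by (auto intro!: Re_herglotz_int_nonneg u1 u2)
  note [measurable] = measurable_bdry[OF hol(1)] measurable_bdry[OF hol(2)]
  define v where "v t = \<alpha> + Im (bdry p1 t) - Im (bdry p2 t)" for t
  have [measurable]: "v \<in> borel_measurable borel" unfolding v_def[abs_def] by measurable
  define Q1 Q2 where "Q1 n = saturate (m n) p1" and "Q2 n = saturate (m n) p2" for n
  have Q: "Q1 n \<in> Hinf" "Q2 n \<in> Hinf" for n
    unfolding Q1_def Q2_def by (rule saturate_Hinf[OF hol(1) pos(1) m(1)] saturate_Hinf[OF hol(2) pos(2) m(1)]; simp)+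
  define J1 J2 where "J1 n t = Im (bdry (Q1 n) t)" and "J2 n t = Im (bdry (Q2 n) t)" for n t
  have iJ: "integrable circ (J1 n)" "integrable circ (J2 n)" for n
    unfolding J1_def[abs_def] J2_def[abs_def] by (rule integrable_Im[OF integrable_bdry[OF Q(1)]] integrable_Im[OF integrable_bdry[OF Q(2)]])+
  define E1 E2 where "E1 n t = sat_error (m n) (bdry p1 t)" and "E2 n t = sat_error (m n) (bdry p2 t)" for n t
  have iE: "integrable circ (E1 n)" "integrable circ (E2 n)" for n
    unfolding E1_def[abs_def] E2_def[abs_def] p1_def p2_def by (rule sat_error_integral(1) u1 u2 m)+
  have lE: "(\<lambda>n. \<integral>t. E1 n t \<partial>circ) \<longlonglongrightarrow> 0" "(\<lambda>n. \<integral>t. E2 n t \<partial>circ) \<longlonglongrightarrow> 0"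
    unfolding E1_def E2_def p1_def p2_def by (rule sat_error_integral(2) u1 u2 m)+
  define h where "h n t = trunc_at (m n) (v t) - (\<alpha> + J1 n t - J2 n t)" for n t
  have iC: "integrable circ (\<lambda>t. trunc_at (m n) (v t))" for n
    by (rule integrable_circ_bounded[where B="m n"])
       (use less_imp_le[OF m(1)[of n]] in \<open>auto simp: trunc_at_def[abs_def] abs_le_iff\<close>)
  have iaJ: "integrable circ (\<lambda>t. \<alpha> + J1 n t - J2 n t)" for n using iJ by auto
  have ih: "integrable circ (h n)" for n unfolding h_def[abs_def] using iC iaJ by auto
  have hb: "(\<integral>t. \<bar>h n t\<bar> \<partial>circ) \<le> 4 * ((\<integral>t. E1 n t \<partial>circ) + (\<integral>t. E2 n t \<partial>circ))" if mn: "2 * \<bar>\<alpha>\<bar> \<le> m n" for n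
  proof -
    have "AE t in circ. \<bar>h n t\<bar> \<le> 4 * (E1 n t + E2 n t)"
      using herglotz_int_radial_limit[OF u1] herglotz_int_radial_limit[OF u2]
        Re_bdry_herglotz_int_nonneg[OF u1] Re_bdry_herglotz_int_nonneg[OF u2]
    proof eventually_elim
      case (elim t)
      note e = elim[folded p1_def p2_def]
      show ?case
        unfolding h_def v_def J1_def J2_def Q1_def Q2_def E1_def E2_def
          bdry_saturate[OF e(1) e(3) m(1)] bdry_saturate[OF e(2) e(4) m(1)]
        by (rule trunc_at_sat_error[OF m(1) mn e(3) e(4)])
    qed
    then have "(\<integral>t. \<bar>h n t\<bar> \<partial>circ) \<le> (\<integral>t. 4 * (E1 n t + E2 n t) \<partial>circ)"
      using ih iE by (intro integral_mono_AE) auto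
    then show ?thesis using iE by simp
  qed
  define c where "c = 2 / (1 - \<rho>)"
  define M1 M2 where "M1 = c * (\<integral>t. \<bar>u1 t\<bar> \<partial>circ)" and "M2 = c * (\<integral>t. \<bar>u2 t\<bar> \<partial>circ)"
  have cz: "2 / (1 - norm z) \<le> c" if "z \<in> cball 0 \<rho>" for z :: complex
    unfolding c_def using that \<rho> by (intro divide_left_mono) auto
  have pM: "norm (p1 z) \<le> M1" "norm (p2 z) \<le> M2" if "z \<in> cball 0 \<rho>" for z
  proof -
    have z: "norm z < 1" using that \<rho> by simp
    show "norm (p1 z) \<le> M1" "norm (p2 z) \<le> M2"
      unfolding p1_def p2_def M1_def M2_def
      using norm_herglotz_int_le[OF u1(1) z] norm_herglotz_int_le[OF u2(1) z] cz[OF that]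
      by (meson mult_right_mono order_trans integral_nonneg abs_ge_zero Bochner_Integration.integral_nonneg)+
  qed
  \<comment> \<open>Besides the cost of \<open>h n\<close>, four differences between saturated and
    original functions occur, at \<open>z\<close> and at 0, each bounded by a squared sup norm over
    \<open>m n\<close>.\<close>
  define b where "b n = c * (4 * ((\<integral>t. E1 n t \<partial>circ) + (\<integral>t. E2 n t \<partial>circ))) + 2 * (M1^2 + M2^2) / m n" for n
  have "b \<longlonglongrightarrow> c * (4 * (0 + 0)) + 0"
    unfolding b_def[abs_def]
    by (intro tendsto_intros lE tendsto_divide_0[OF tendsto_const filterlim_at_top_imp_at_infinity[OF m(2)]])
  then have blim: "b \<longlonglongrightarrow> 0" by simp
  have est: "norm (\<i> * herglotz_int (\<lambda>t. trunc_at (m n) (v t)) z - (\<i> * of_real \<alpha> + (p1 z - p1 0) - (p2 z - p2 0))) \<le> b n"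
    if z: "z \<in> cball 0 \<rho>" and mn: "2 * \<bar>\<alpha>\<bar> \<le> m n" for n z
  proof -
    have z1: "norm z < 1" using z \<rho> by simp
    have zz: "0 \<in> cball 0 \<rho>" using z by (auto intro: order_trans[OF norm_ge_zero])
    have cl: "herglotz_int (\<lambda>t. trunc_at (m n) (v t)) z = herglotz_int (h n) z + herglotz_int (\<lambda>t. \<alpha> + J1 n t - J2 n t) z"
      using herglotz_int_add[OF ih iaJ z1, of n n] by (simp add: h_def)
    have "herglotz_int (\<lambda>t. \<alpha> + J1 n t - J2 n t) z = of_real \<alpha> + herglotz_int (J1 n) z - herglotz_int (J2 n) z"
      using iJ z1 by (subst herglotz_int_diff, simp, simp, simp, subst herglotz_int_add) (auto simp: herglotz_int_const)
    moreover have "\<i> * herglotz_int (J1 n) z = Q1 n z - of_real (Re (Q1 n 0))"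
      "\<i> * herglotz_int (J2 n) z = Q2 n z - of_real (Re (Q2 n 0))"
      unfolding J1_def[abs_def] J2_def[abs_def] by (rule herglotz_int_Im_bdry[OF Q(1) z1] herglotz_int_Im_bdry[OF Q(2) z1])+
    ultimately have J: "\<i> * herglotz_int (\<lambda>t. \<alpha> + J1 n t - J2 n t) z
        = \<i> * of_real \<alpha> + (Q1 n z - of_real (Re (Q1 n 0))) - (Q2 n z - of_real (Re (Q2 n 0)))"
      by (simp only: distrib_left right_diff_distrib)
    \<comment> \<open>\<open>p1 0\<close> and \<open>p2 0\<close> are integrals of real functions,
      and saturation preserves the real axis.\<close>
    have real0: "of_real (Re (Q1 n 0)) = Q1 n 0" "of_real (Re (Q2 n 0)) = Q2 n 0"
      by (auto simp: Q1_def Q2_def saturate_def p1_def p2_def herglotz_int_0 complex_eq_iff Im_divide)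
    have q: "norm (Q1 n w - p1 w) \<le> M1^2 / m n" "norm (Q2 n w - p2 w) \<le> M2^2 / m n" if w: "w \<in> cball 0 \<rho>" for w
    proof -
      have w1: "norm w < 1" using w \<rho> by simp
      have "norm (Q1 n w - p1 w) \<le> (norm (p1 w))^2 / m n" "norm (Q2 n w - p2 w) \<le> (norm (p2 w))^2 / m n"
        unfolding Q1_def Q2_def by (rule norm_saturate_diff_le[OF m(1)], rule pos[OF w1])+
      moreover have "(norm (p1 w))^2 / m n \<le> M1^2 / m n" "(norm (p2 w))^2 / m n \<le> M2^2 / m n"
        using pM[OF w] m(1)[of n] by (auto intro!: divide_right_mono power_mono)
      ultimately show "norm (Q1 n w - p1 w) \<le> M1^2 / m n" "norm (Q2 n w - p2 w) \<le> M2^2 / m n" by linarith+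
    qed
    have "norm (herglotz_int (h n) z) \<le> 2 / (1 - norm z) * (\<integral>t. \<bar>h n t\<bar> \<partial>circ)"
      by (rule norm_herglotz_int_le[OF ih z1])
    also have "\<dots> \<le> c * (4 * ((\<integral>t. E1 n t \<partial>circ) + (\<integral>t. E2 n t \<partial>circ)))"
      using \<rho> by (intro mult_mono cz[OF z] hb[OF mn]) (auto simp: c_def)
    finally have hn: "norm (\<i> * herglotz_int (h n) z) \<le> c * (4 * ((\<integral>t. E1 n t \<partial>circ) + (\<integral>t. E2 n t \<partial>circ)))"
      by (simp add: norm_mult)
    have eq: "\<i> * herglotz_int (\<lambda>t. trunc_at (m n) (v t)) z - (\<i> * of_real \<alpha> + (p1 z - p1 0) - (p2 z - p2 0))
      = \<i> * herglotz_int (h n) z + (Q1 n z - p1 z) - (Q1 n 0 - p1 0) - (Q2 n z - p2 z) + (Q2 n 0 - p2 0)"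
      unfolding cl distrib_left J real0 by (simp add: algebra_simps)
    have "norm (\<i> * herglotz_int (h n) z + (Q1 n z - p1 z) - (Q1 n 0 - p1 0) - (Q2 n z - p2 z) + (Q2 n 0 - p2 0))
       \<le> norm (\<i> * herglotz_int (h n) z) + norm (Q1 n z - p1 z) + norm (Q1 n 0 - p1 0) + norm (Q2 n z - p2 z) + norm (Q2 n 0 - p2 0)"
      by (intro norm_triangle_mono norm_triangle_le_diff add_mono order_refl)
    also have "\<dots> \<le> c * (4 * ((\<integral>t. E1 n t \<partial>circ) + (\<integral>t. E2 n t \<partial>circ))) + M1^2 / m n + M1^2 / m n + M2^2 / m n + M2^2 / m n"
      by (intro add_mono hn q z zz)
    also have "\<dots> = b n" by (simp add: b_def add_divide_distrib)
    finally show ?thesis unfolding eq .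
  qed
  show ?thesis
    unfolding v_def[symmetric]
  proof (rule uniform_limitI)
    fix e :: real assume "e > 0"
    then have "\<forall>\<^sub>F n in sequentially. b n < e" by (rule order_tendstoD(2)[OF blim])
    moreover have "\<forall>\<^sub>F n in sequentially. 2 * \<bar>\<alpha>\<bar> \<le> m n" using m(2) by (simp add: filterlim_at_top)
    ultimately show "\<forall>\<^sub>F n in sequentially. \<forall>z\<in>cball 0 \<rho>. dist (\<i> * herglotz_int (\<lambda>t. trunc_at (m n) (v t)) z)
        (\<i> * of_real \<alpha> + (p1 z - p1 0) - (p2 z - p2 0)) < e"
      by eventually_elim (use est in \<open>fastforce simp: dist_norm intro: le_less_trans\<close>)
  qed
qed

section \<open>Factorization of real outer functions\<close>

text \<open>A layer count: raising the level from \<open>N\<close> to \<open>Suc N\<close> moves the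
  clipped value by one exactly when \<open>j\<close> lies at or beyond the new level on either
  side.\<close>

lemma trunc_at_int_eq_sum:
  fixes j :: int
  shows "max (- int N) (min j (int N)) = (\<Sum>k\<in>{1..N}. of_bool (int k \<le> j) - of_bool (j \<le> - int k))"
proof (induction N)
  case (Suc N)
  then show ?case by auto
qed simp

lemma trunc_at_pi_eq_sum:
  assumes "v = real_of_int j * pi"
  shows "trunc_at (pi * real N) v
    = pi * (\<Sum>k\<in>{1..N}. of_bool (real k * pi \<le> v) - of_bool (v \<le> - (real k * pi)))"
proof -
  have "trunc_at (pi * real N) v = pi * max (- real N) (min (real_of_int j) (real N))"
    unfolding trunc_at_def assms by (simp add: max_mult_distrib_left min_mult_distrib_left mult.commute)
  also have "max (- real N) (min (real_of_int j) (real N)) = real_of_int (max (- int N) (min j (int N)))"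
    by (simp add: max_def min_def)
  also have "\<dots> = (\<Sum>k\<in>{1..N}. of_bool (int k \<le> j) - of_bool (j \<le> - int k))"
    unfolding trunc_at_int_eq_sum by simp
  also have "\<dots> = (\<Sum>k\<in>{1..N}. of_bool (real k * pi \<le> v) - of_bool (v \<le> - (real k * pi)))"
  proof (rule sum.cong)
    fix k
    have "int k \<le> j \<longleftrightarrow> real k * pi \<le> v" unfolding assms by simp linarith
    moreover have "j \<le> - int k \<longleftrightarrow> v \<le> - (real k * pi)"
    proof -
      have "j \<le> - int k \<longleftrightarrow> real_of_int j \<le> - real k" by linarith
      also have "\<dots> \<longleftrightarrow> real_of_int j * pi \<le> - real k * pi"
        by (rule mult_le_cancel_right_pos[symmetric]) simp
      finally show ?thesis by (simp add: assms)
    qed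
    ultimately show "(of_bool (int k \<le> j) - of_bool (j \<le> - int k) :: real) = of_bool (real k * pi \<le> v) - of_bool (v \<le> - (real k * pi))"
      by simp
  qed simp
  finally show ?thesis .
qed

lemma outer_fun_Herglotz:
  assumes "outer_fun F"
  obtains \<alpha> u where "integrable circ u" "\<And>z. norm z < 1 \<Longrightarrow> F z = exp (\<i> * of_real \<alpha> + herglotz_int u z)"
proof -
  from assms obtain c w where c: "norm c = 1"
    and int: "set_integrable lborel {0..2*pi} (\<lambda>\<theta>. ln (w \<theta> :: real))"
    and F: "\<And>z. norm z < 1 \<Longrightarrow> F z = c * exp (complex_of_real (1 / (2*pi)) *
        (LINT \<theta>:{0..2*pi}|lborel. ((cis \<theta> + z) / (cis \<theta> - z)) * complex_of_real (ln (w \<theta>))))"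
    unfolding outer_fun_def by auto
  \<comment> \<open>The hypothesis yields measurability of \<open>ln (w t)\<close> only after
    cutting off to the period, so the cut-off is built into \<open>u\<close>.\<close>
  define u where "u t = indicator {0..2*pi} t * ln (w t)" for t
  have [measurable]: "u \<in> borel_measurable borel"
    using borel_measurable_integrable[OF int[unfolded set_integrable_def]] by (simp add: u_def[abs_def])
  have "set_integrable lborel {0..2*pi} u"
    using int unfolding set_integrable_def by (rule back_subst[where P="integrable lborel"]) (auto simp: u_def indicator_def)
  then have iu: "integrable circ u" by (simp add: integrable_circ_iff)
  have H: "herglotz_int u z = complex_of_real (1 / (2*pi)) *
        (LINT \<theta>:{0..2*pi}|lborel. ((cis \<theta> + z) / (cis \<theta> - z)) * complex_of_real (ln (w \<theta>)))" for z
  proof -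
    have "herglotz_int u z = (1/(2*pi)) *\<^sub>R (LINT t:{0..2*pi}|lborel. herglotz z t * complex_of_real (u t))"
      unfolding herglotz_int_def by (rule integral_circ) measurable
    also have "(LINT t:{0..2*pi}|lborel. herglotz z t * complex_of_real (u t))
      = (LINT \<theta>:{0..2*pi}|lborel. ((cis \<theta> + z) / (cis \<theta> - z)) * complex_of_real (ln (w \<theta>)))"
      unfolding set_lebesgue_integral_def
      by (intro Bochner_Integration.integral_cong) (auto simp: u_def indicator_def herglotz_def)
    finally show ?thesis by (simp add: scaleR_conv_of_real)
  qed
  have "c = exp (\<i> * of_real (Arg c))"
    using Arg_eq[of c] c by (cases "c = 0") auto
  then show ?thesis using F H by (intro that[OF iu, of "Arg c"]) (simp add: exp_add)
qed

text \<open>Eventually all values lie in one closed ball, on which \<open>exp\<close> is uniformly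
  continuous; the extra 1 in the radius leaves room for the approximants.\<close>

lemma uniform_limit_exp:
  fixes g :: "nat \<Rightarrow> complex \<Rightarrow> complex"
  assumes "uniform_limit K g l F" and l: "\<And>z. z \<in> K \<Longrightarrow> norm (l z) \<le> C"
  shows "uniform_limit K (\<lambda>n z. exp (g n z)) (\<lambda>z. exp (l z)) F"
proof -
  have "uniformly_continuous_on (cball 0 (C + 1)) (exp :: complex \<Rightarrow> complex)"
    by (intro compact_uniformly_continuous continuous_intros) auto
  moreover have "\<forall>\<^sub>F n in F. g n ` K \<subseteq> cball 0 (C + 1)"
    using uniform_limitD[OF assms(1), of 1, simplified]
  proof eventually_elim
    case (elim n)
    show ?case
    proof (rule image_subsetI)
      fix z assume z: "z \<in> K"
      have "norm (g n z) \<le> norm (l z) + norm (g n z - l z)" by (metis norm_triangle_sub)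
      then show "g n z \<in> cball 0 (C + 1)" using l[OF z] elim z by (force simp: dist_norm)
    qed
  qed
  moreover have "l ` K \<subseteq> cball 0 (C + 1)" using l by force
  ultimately show ?thesis
    using uniform_limit_compose[OF assms(1)] by (simp add: o_def)
qed

theorem theorem6p1:
  fixes f :: "complex \<Rightarrow> complex"
  assumes "f \<in> RO"
  shows "\<exists>\<phi>p \<phi>m :: nat \<Rightarrow> complex \<Rightarrow> complex.
    (\<forall>n\<ge>1. inner_fun (\<phi>p n) \<and> inner_fun (\<phi>m n)) \<and>
    (\<forall>K. compact K \<and> K \<subseteq> ball 0 1 \<longrightarrow>
      uniform_limit K
        (\<lambda>N z. complex_of_real (norm (f 0)) *
           (\<Prod>n\<in>{1..N}. ((1 - \<i> * \<phi>p n z) / (1 + \<i> * \<phi>p n z)) *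
                          ((1 + \<i> * \<phi>m n z) / (1 - \<i> * \<phi>m n z))))
        f sequentially)"
proof -
  from assms have outer: "outer_fun f"
    and real: "AE t in circ. \<exists>L. radial_limit f t L \<and> Im L = 0"
    unfolding RO_def AE_circ by auto
  obtain \<alpha> u where u: "integrable circ u"
    and f: "\<And>z. norm z < 1 \<Longrightarrow> f z = exp (\<i> * of_real \<alpha> + herglotz_int u z)"
    by (rule outer_fun_Herglotz[OF outer]) (rule that)
  define u1 u2 where "u1 t = max (u t) 0" and "u2 t = max (- u t) 0" for t
  have u1: "integrable circ u1" "0 \<le> u1 t" and u2: "integrable circ u2" "0 \<le> u2 t" for t
    unfolding u1_def[abs_def] u2_def[abs_def] using u by auto
  define p1 p2 where "p1 = herglotz_int u1" and "p2 = herglotz_int u2"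
  have "u = (\<lambda>t. u1 t - u2 t)" by (auto simp: u1_def u2_def)
  then have f12: "f z = exp (\<i> * of_real \<alpha> + p1 z - p2 z)" if "norm z < 1" for z
    using f[OF that] herglotz_int_diff[OF u1(1) u2(1) that] by (simp add: p1_def p2_def algebra_simps)
  have hol: "p1 holomorphic_on ball 0 1" "p2 holomorphic_on ball 0 1"
    unfolding p1_def p2_def by (rule holomorphic_herglotz_int u1 u2)+
  note [measurable] = measurable_bdry[OF hol(1)] measurable_bdry[OF hol(2)]
  define v where "v t = \<alpha> + Im (bdry p1 t) - Im (bdry p2 t)" for t
  have [measurable]: "v \<in> borel_measurable borel" unfolding v_def[abs_def] by measurable
  \<comment> \<open>The radial limit of \<open>f\<close> is the exponential of a number with
    imaginary part \<open>v t\<close>; being real, it forces \<open>sin (v t) = 0\<close>.\<close>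
  have vpi: "AE t in circ. \<exists>j::int. v t = real_of_int j * pi"
    using real herglotz_int_radial_limit[OF u1] herglotz_int_radial_limit[OF u2]
  proof eventually_elim
    case (elim t)
    then obtain L where L: "radial_limit f t L" "Im L = 0" by blast
    have "(\<lambda>n. exp (\<i> * of_real \<alpha> + p1 (of_real (radius n) * cis t) - p2 (of_real (radius n) * cis t)))
        \<longlonglongrightarrow> exp (\<i> * of_real \<alpha> + bdry p1 t - bdry p2 t)"
      using radial_limit_LIMSEQ[OF elim(2)] radial_limit_LIMSEQ[OF elim(3)]
      unfolding p1_def p2_def by (intro tendsto_intros)
    then have "(\<lambda>n. f (of_real (radius n) * cis t)) \<longlonglongrightarrow> exp (\<i> * of_real \<alpha> + bdry p1 t - bdry p2 t)"
      by (simp only: f12[OF norm_radius_cis])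
    then have "L = exp (\<i> * of_real \<alpha> + bdry p1 t - bdry p2 t)"
      using radial_limit_LIMSEQ[OF L(1)] LIMSEQ_unique by blast
    with L(2) have "sin (v t) = 0" by (simp add: Im_exp v_def)
    then show ?case using sin_zero_iff_int2 by blast
  qed
  define Ep Em where "Ep k = {t. real k * pi \<le> v t}" and "Em k = {t. v t \<le> - (real k * pi)}" for k :: nat
  have E: "Ep k \<in> sets borel" "Em k \<in> sets borel" for k unfolding Ep_def Em_def by measurable
  define sp sm where "sp k = herglotz_int (indicator (Ep k))" and "sm k = herglotz_int (indicator (Em k))" for k
  have "\<exists>\<phi>. inner_fun \<phi> \<and> (\<forall>z. norm z < 1 \<longrightarrow> (1 - \<i> * \<phi> z) / (1 + \<i> * \<phi> z) = exp (\<i> * of_real pi * (sp k z - 1/2)))" for k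
    unfolding sp_def by (rule inner_fun_of_set[OF E(1)[of k]]) blast
  then obtain \<phi>p where \<phi>p: "\<And>k. inner_fun (\<phi>p k)"
    "\<And>k z. norm z < 1 \<Longrightarrow> (1 - \<i> * \<phi>p k z) / (1 + \<i> * \<phi>p k z) = exp (\<i> * of_real pi * (sp k z - 1/2))"
    by metis
  have "\<exists>\<phi>. inner_fun \<phi> \<and> (\<forall>z. norm z < 1 \<longrightarrow> (1 + \<i> * \<phi> z) / (1 - \<i> * \<phi> z) = exp (- \<i> * of_real pi * (sm k z - 1/2)))" for k
    unfolding sm_def by (rule inner_fun_of_set[OF E(2)[of k]]) blast
  then obtain \<phi>m where \<phi>m: "\<And>k. inner_fun (\<phi>m k)"
    "\<And>k z. norm z < 1 \<Longrightarrow> (1 + \<i> * \<phi>m k z) / (1 - \<i> * \<phi>m k z) = exp (- \<i> * of_real pi * (sm k z - 1/2))"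
    by metis
  \<comment> \<open>The layer count needs \<open>v t\<close> to be an integer multiple of
    \<open>pi\<close>, which holds a.e. and therefore suffices under the integral.\<close>
  have trunc: "herglotz_int (\<lambda>t. trunc_at (pi * real N) (v t)) z = of_real pi * (\<Sum>k\<in>{1..N}. sp k z - sm k z)"
    if z: "norm z < 1" for N z
  proof -
    note iI = integrable_indicator_circ[OF E(1)] integrable_indicator_circ[OF E(2)]
    have "AE t in circ. trunc_at (pi * real N) (v t) = pi * (\<Sum>k\<in>{1..N}. indicator (Ep k) t - indicator (Em k) t)"
      using vpi
    proof eventually_elim
      case (elim t)
      then obtain j :: int where "v t = real_of_int j * pi" by blast
      from trunc_at_pi_eq_sum[OF this, of N] show ?case
        by (simp add: indicator_def Ep_def Em_def of_bool_def)
    qed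
    then have "AE t in circ. herglotz z t * complex_of_real (trunc_at (pi * real N) (v t))
      = of_real pi * (\<Sum>k\<in>{1..N}. herglotz z t * complex_of_real (indicator (Ep k) t) - herglotz z t * complex_of_real (indicator (Em k) t))"
      by eventually_elim (simp add: sum_distrib_left algebra_simps)
    then have "herglotz_int (\<lambda>t. trunc_at (pi * real N) (v t)) z
      = (\<integral>t. of_real pi * (\<Sum>k\<in>{1..N}. herglotz z t * complex_of_real (indicator (Ep k) t) - herglotz z t * complex_of_real (indicator (Em k) t)) \<partial>circ)"
      unfolding herglotz_int_def using E by (intro integral_cong_AE) (auto simp: trunc_at_def)
    also have "\<dots> = of_real pi * (\<Sum>k\<in>{1..N}. sp k z - sm k z)"
      unfolding sp_def sm_def herglotz_int_def
      using integrable_herglotz_int[OF iI(1) z] integrable_herglotz_int[OF iI(2) z]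
      by (simp add: Bochner_Integration.integral_sum Bochner_Integration.integral_diff)
    finally show ?thesis .
  qed
  \<comment> \<open>The shifts by 1/2 in the two factors of each pair cancel, leaving only
    \<open>sp n z - sm n z\<close> in the exponent.\<close>
  have prod: "(\<Prod>n\<in>{1..N}. ((1 - \<i> * \<phi>p n z) / (1 + \<i> * \<phi>p n z)) * ((1 + \<i> * \<phi>m n z) / (1 - \<i> * \<phi>m n z)))
      = exp (\<i> * herglotz_int (\<lambda>t. trunc_at (pi * real N) (v t)) z)" if z: "norm z < 1" for N z
  proof -
    have "(\<Prod>n\<in>{1..N}. ((1 - \<i> * \<phi>p n z) / (1 + \<i> * \<phi>p n z)) * ((1 + \<i> * \<phi>m n z) / (1 - \<i> * \<phi>m n z)))
      = (\<Prod>n\<in>{1..N}. exp (\<i> * of_real pi * (sp n z - sm n z)))"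
      by (simp add: \<phi>p(2)[OF z] \<phi>m(2)[OF z] exp_add[symmetric] algebra_simps)
    also have "\<dots> = exp (\<Sum>n\<in>{1..N}. \<i> * of_real pi * (sp n z - sm n z))" by (simp add: exp_sum)
    also have "(\<Sum>n\<in>{1..N}. \<i> * of_real pi * (sp n z - sm n z)) = \<i> * herglotz_int (\<lambda>t. trunc_at (pi * real N) (v t)) z"
      by (simp only: trunc[OF z] sum_distrib_left mult.assoc)
    finally show ?thesis .
  qed
  \<comment> \<open>A logarithm of \<open>f\<close> with the real constant
    \<open>p1 0 - p2 0\<close>, the logarithm of \<open>norm (f 0)\<close>, removed; the unimodular
    constant of \<open>f\<close> survives as \<open>\<alpha>\<close>.\<close>
  define l where "l z = \<i> * of_real \<alpha> + (p1 z - p1 0) - (p2 z - p2 0)" for z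
  have f0: "complex_of_real (norm (f 0)) * exp (l z) = f z" if "norm z < 1" for z
  proof -
    have "norm (f 0) = exp (Re (p1 0) - Re (p2 0))" using f12[of 0] by simp
    then have "complex_of_real (norm (f 0)) = exp (p1 0 - p2 0)"
      by (simp add: exp_of_real[symmetric] p1_def p2_def herglotz_int_0)
    then show ?thesis using f12[OF that] by (simp add: l_def exp_add[symmetric] algebra_simps)
  qed
  have unif: "uniform_limit K
        (\<lambda>N z. complex_of_real (norm (f 0)) *
           (\<Prod>n\<in>{1..N}. ((1 - \<i> * \<phi>p n z) / (1 + \<i> * \<phi>p n z)) * ((1 + \<i> * \<phi>m n z) / (1 - \<i> * \<phi>m n z))))
        f sequentially" if K: "compact K" "K \<subseteq> ball 0 1" for K
  proof -
    obtain \<rho> where \<rho>: "\<rho> < 1" "K \<subseteq> cball 0 \<rho>"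
    proof (cases "K = {}")
      case False
      then obtain x where "x \<in> K" "\<And>y. y \<in> K \<Longrightarrow> norm y \<le> norm x"
        using continuous_attains_sup[OF K(1), of norm] by (auto intro: continuous_intros)
      with K(2) show ?thesis by (intro that[of "norm x"]) auto
    qed (use that[of 0] in simp)
    \<comment> \<open>The limit lemma asks for strictly positive truncation levels, so level 0 is
      skipped by \<open>Suc\<close>; the shift of the sequence is undone at the end.\<close>
    have lim: "uniform_limit (cball 0 \<rho>) (\<lambda>N z. \<i> * herglotz_int (\<lambda>t. trunc_at (pi * real (Suc N)) (v t)) z) l sequentially"
      unfolding l_def[abs_def] v_def p1_def p2_def
    proof (rule truncated_argument_limit[OF u1 u2 _ _ \<rho>(1)])
      show "filterlim (\<lambda>N. pi * real (Suc N)) at_top sequentially"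
        by (intro filterlim_tendsto_pos_mult_at_top[OF tendsto_const] filterlim_compose[OF filterlim_real_sequentially filterlim_Suc]) auto
    qed simp
    have "continuous_on K l"
      unfolding l_def[abs_def]
      by (intro continuous_intros continuous_on_subset[OF holomorphic_on_imp_continuous_on[OF hol(1)] K(2)]
          continuous_on_subset[OF holomorphic_on_imp_continuous_on[OF hol(2)] K(2)])
    then have "bounded (l ` K)" using K(1) compact_continuous_image compact_imp_bounded by blast
    then obtain C where "\<And>z. z \<in> K \<Longrightarrow> norm (l z) \<le> C" unfolding bounded_iff by blast
    then have "uniform_limit K (\<lambda>N z. exp (\<i> * herglotz_int (\<lambda>t. trunc_at (pi * real (Suc N)) (v t)) z)) (\<lambda>z. exp (l z)) sequentially"
      by (rule uniform_limit_exp[OF uniform_limit_on_subset[OF lim \<rho>(2)]])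
    then have "uniform_limit K (\<lambda>N z. complex_of_real (norm (f 0)) * exp (\<i> * herglotz_int (\<lambda>t. trunc_at (pi * real (Suc N)) (v t)) z))
        (\<lambda>z. complex_of_real (norm (f 0)) * exp (l z)) sequentially"
      by (rule bounded_linear.uniform_limit[OF bounded_linear_mult_right])
    moreover have "norm z < 1" if "z \<in> K" for z using that K(2) by auto
    ultimately have "uniform_limit K (\<lambda>N z. complex_of_real (norm (f 0)) *
           (\<Prod>n\<in>{1..Suc N}. ((1 - \<i> * \<phi>p n z) / (1 + \<i> * \<phi>p n z)) * ((1 + \<i> * \<phi>m n z) / (1 - \<i> * \<phi>m n z)))) f sequentially"
      by (subst uniform_limit_cong'[OF _ f0[symmetric]]) (simp_all only: prod)
    then show ?thesis
      by (rule filterlim_sequentially_Suc[THEN iffD1])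
  qed
  show ?thesis
    using \<phi>p(1) \<phi>m(1) unif by blast
qed

end
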